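(* Let $(\phi^k,\boldsymbol\vartheta^k)$, $k\ge0$, be the iHDG-II iterates for the backward Euler HDG discretization of the homogeneous linearized shallow water system, and let $\mathcal A,\mathcal B,\mathcal C,\mathcal G$ be the constants defined in the context. Assume that the mesh size $h$, the time step $\Delta t$ and the solution order $p$ are chosen such that $\mathcal B>0$ and $\mathcal C<1$. Then the approximate solution $(\phi^k,\boldsymbol\vartheta^k)$ at the $k$th iteration converges to zero in the following sense: $$\|(\phi^k,\boldsymbol\vartheta^k\cdot\mathbf n)\|^2_{\mathcal E_h}\le\mathcal C^k\,\|(\phi^0,\boldsymbol\vartheta^0\cdot\mathbf n)\|^2_{\mathcal E_h},$$ $$\|(\phi^k,\boldsymbol\vartheta^k)\|^2_{\Omega_h}\le\Delta t\,(\mathcal A+\mathcal G\mathcal C)\,\mathcal C^{k-1}\,\|(\phi^0,\boldsymbol\vartheta^0\cdot\mathbf n)\|^2_{\mathcal E_h}$$ (the second estimate for $k\ge1$).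
   Context: Setting. $\Omega\subset\mathbb R^2$ is open and bounded, partitioned into finitely many non-overlapping tensor-product (quadrilateral) elements $K$ with Lipschitz boundaries; $\Omega_h$ is their union, $\mathcal E_h$ the mesh skeleton (set of all faces), $h$ the maximal element diameter. On $\partial K$, $\mathbf n^-=\mathbf n=(\mathbf n_1,\mathbf n_2)$ is the outward unit normal of $K$, $\mathbf n^+=-\mathbf n^-$; $(\cdot)^-$ is the trace from inside $K$, $(\cdot)^+$ the trace from the neighboring element. $(\cdot,\cdot)_K$, $\langle\cdot,\cdot\rangle_{\partial K}$ are $L^2$ inner products, $\|\cdot\|_K,\|\cdot\|_{\partial K}$ the induced norms, and $\|w\|_{\Phi,D}:=\|\sqrt\Phi\,w\|_D$. $\mathcal P^p(K)$ is the space of polynomials of degree at most $p$ on $K$. Parameters: $\Phi>0$ constant mean geopotential height, $\gamma\ge0$ bottom friction, $f=f_0+\beta(y-y_m)$ the Coriolis parameter with given constants $f_0,\beta,y_m$, time step $\Delta t>0$. iHDG-II iteration (one backward Euler step, homogeneous data: zero initial value, forcing and boundary data). Given elementwise polynomials $\phi^k$ and $\boldsymbol\vartheta^k=(u^k,v^k)$, the next iterate $\phi^{k+1},u^{k+1},v^{k+1}$, with restrictions in $\mathcal P^p(K)$, solves on each $K$, for all $\varphi_1,\varphi_2,\varphi_3\in\mathcal P^p(K)$, $$\Big(\tfrac{\phi^{k+1}}{\Delta t},\varphi_1\Big)_K-(\Phi\boldsymbol\vartheta^{k+1},\nabla\varphi_1)_K+\big\langle\Phi\boldsymbol\vartheta^{k+1}\cdot\mathbf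 n+\sqrt\Phi(\phi^{k+1}-\hat\phi^{k,k+1}),\varphi_1\big\rangle_{\partial K}=0,$$ $$\Big(\tfrac{\Phi u^{k+1}}{\Delta t},\varphi_2\Big)_K-\Big(\Phi\phi^{k+1},\tfrac{\partial\varphi_2}{\partial x}\Big)_K+\langle\Phi\hat\phi^{k,k+1}\mathbf n_1,\varphi_2\rangle_{\partial K}=(f\Phi v^{k+1}-\gamma\Phi u^{k+1},\varphi_2)_K,$$ $$\Big(\tfrac{\Phi v^{k+1}}{\Delta t},\varphi_3\Big)_K-\Big(\Phi\phi^{k+1},\tfrac{\partial\varphi_3}{\partial y}\Big)_K+\langle\Phi\hat\phi^{k,k+1}\mathbf n_2,\varphi_3\rangle_{\partial K}=(-f\Phi u^{k+1}-\gamma\Phi v^{k+1},\varphi_3)_K,$$ with $$\hat\phi^{k,k+1}=\tfrac12\{(\phi^{k+1})^-+(\phi^k)^+\}+\tfrac{\sqrt\Phi}{2}\{(\boldsymbol\vartheta^{k+1})^-\cdot\mathbf n^-+(\boldsymbol\vartheta^k)^+\cdot\mathbf n^+\}.$$ On faces contained in $\partial\Omega$ the exterior values $(\phi^k)^+$, $(\boldsymbol\vartheta^k)^+$ are zero (homogeneous boundary data). Norms: $\|(\phi^k,\boldsymbol\vartheta^k)\|^2_{\Omega_h}:=\sum_K\big(\|\phi^k\|_K^2+\|\boldsymbol\vartheta^k\|_{\Phi,K}^2\big)$, and $\|(\phi^k,\boldsymbol\vartheta^k\cdot\mathbf n)\|^2_{\mathcal E_h}:=\|\phi^k\|^2_{\mathcal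 E_h}+\|\boldsymbol\vartheta^k\cdot\mathbf n\|^2_{\Phi,\mathcal E_h}$, where, since the traces are double-valued on interior faces, the skeleton norm collects both sides: it equals $\sum_K\big(\|(\phi^k)^-\|^2_{\partial K}+\|(\boldsymbol\vartheta^k\cdot\mathbf n)^-\|^2_{\Phi,\partial K}\big)$. Constants: $\varepsilon>0$ is a constant, and $0<c\le1$ is a constant for which the inverse trace inequality $(w,w)_K\ge\frac{2ch}{d(p+1)(p+2)}\langle w,w\rangle_{\partial K}$ (with $d=2$) holds for all elements $K$ and all $w\in\mathcal P^p(K)$ (and componentwise for vectors). Define $$\mathcal A:=\frac{\max\{1,\Phi\}+\sqrt\Phi}{4\varepsilon},\qquad \mathcal G:=\frac{\varepsilon(\max\{1,\Phi\}+\sqrt\Phi)}{4},\qquad \mathcal C:=\frac{\mathcal A}{\mathcal B},\qquad \mathcal B:=\min\{\mathcal B_1,\mathcal B_2\},$$ $$\mathcal B_1:=\frac{ch}{\Delta t(p+1)(p+2)}+\frac{2\sqrt\Phi-(\Phi+\sqrt\Phi)\varepsilon}{4},$$ $$\mathcal B_2:=\Big(\gamma+\frac1{\Delta t}\Big)\frac{ch}{(p+1)(p+2)}+\frac{2\sqrt\Phi-(1+\sqrt\Phi)\varepsilon}{4}.$$ *)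

theory Defs
  imports "HOL-Analysis.Analysis"
begin

type_synonym point = "real \<times> real"

text \<open>A quadrilateral is given by its vertices in cyclic order (either orientation).\<close>

type_synonym quad = "point \<times> point \<times> point \<times> point"

fun quad_path :: "quad \<Rightarrow> real \<Rightarrow> point" where
  "quad_path (a, b, c, d) = linepath a b +++ linepath b c +++ linepath c d +++ linepath d a"

fun edges :: "quad \<Rightarrow> (point \<times> point) set" where
  "edges (a, b, c, d) = {(a, b), (b, c), (c, d), (d, a)}"

text \<open>Non-degenerate simple quadrilaterals. They are not required to be convex; their
  boundary is automatically Lipschitz.\<close>

fun is_quad :: "quad \<Rightarrow> bool" where
  "is_quad (a, b, c, d) \<longleftrightarrow>
     simple_path (quad_path (a, b, c, d)) \<and>
     \<not> collinear {a, b, c} \<and> \<not> collinear {b, c, d} \<and>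
     \<not> collinear {c, d, a} \<and> \<not> collinear {d, a, b}"

definition cell :: "quad \<Rightarrow> point set" where
  "cell K = path_image (quad_path K) \<union> inside (path_image (quad_path K))"

text \<open>Hanging nodes are allowed: an edge may be shared with several neighbours.\<close>

definition quad_mesh :: "point set \<Rightarrow> quad set \<Rightarrow> bool" where
  "quad_mesh \<Omega> T \<longleftrightarrow>
     open \<Omega> \<and> bounded \<Omega> \<and> finite T \<and> (\<forall>K\<in>T. is_quad K) \<and>
     (\<forall>K\<in>T. \<forall>K'\<in>T. K \<noteq> K' \<longrightarrow> interior (cell K) \<inter> interior (cell K') = {}) \<and>
     (\<Union>K\<in>T. cell K) = closure \<Omega>"

definition mesh_size :: "quad set \<Rightarrow> real" where
  "mesh_size T = Max ((\<lambda>K. diameter (cell K)) ` T)"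

text \<open>The outward unit normal at \<open>x\<close> is the unit vector \<open>n\<close> such that, near \<open>x\<close>, the set is the
  half-plane with outer normal \<open>n\<close> through \<open>x\<close>. For a quadrilateral this determines \<open>n\<close> at every
  boundary point that is not a vertex; the value at the vertices is irrelevant below.\<close>

definition outward_normal :: "point set \<Rightarrow> point \<Rightarrow> point" where
  "outward_normal S x =
     (THE n. norm n = 1 \<and> (\<exists>r>0. \<forall>y\<in>ball x r. y \<in> S \<longleftrightarrow> (y - x) \<bullet> n \<le> 0))"

abbreviation nrm :: "quad \<Rightarrow> point \<Rightarrow> point" where
  "nrm K \<equiv> outward_normal (cell K)"

text \<open>Polynomials of total degree at most \<open>p\<close>. A polynomial on an element is identified with its
  unique polynomial extension to the plane, so that its trace on the boundary is its restriction.\<close>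

definition poly_space :: "nat \<Rightarrow> (point \<Rightarrow> real) set" where
  "poly_space p = {w. \<exists>a :: nat \<Rightarrow> nat \<Rightarrow> real.
     \<forall>x y. w (x, y) = (\<Sum>i\<le>p. \<Sum>j\<le>p - i. a i j * x ^ i * y ^ j)}"

definition pdx :: "(point \<Rightarrow> real) \<Rightarrow> point \<Rightarrow> real" where
  "pdx w z = deriv (\<lambda>s. w (s, snd z)) (fst z)"

definition pdy :: "(point \<Rightarrow> real) \<Rightarrow> point \<Rightarrow> real" where
  "pdy w z = deriv (\<lambda>s. w (fst z, s)) (snd z)"

definition grad :: "(point \<Rightarrow> real) \<Rightarrow> point \<Rightarrow> point" where
  "grad w z = (pdx w z, pdy w z)"

definition vol_inner :: "quad \<Rightarrow> (point \<Rightarrow> 'a::real_inner) \<Rightarrow> (point \<Rightarrow> 'a) \<Rightarrow> real" where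
  "vol_inner K v w = (LINT x:cell K|lborel. v x \<bullet> w x)"

text \<open>Integration over the boundary with respect to arc length.\<close>

definition bdry_inner :: "quad \<Rightarrow> (point \<Rightarrow> 'a::real_inner) \<Rightarrow> (point \<Rightarrow> 'a) \<Rightarrow> real" where
  "bdry_inner K v w =
     (\<Sum>(a, b)\<in>edges K. dist a b *
        (LINT t:{0..1}|lborel. v (linepath a b t) \<bullet> w (linepath a b t)))"

definition vol_norm :: "quad \<Rightarrow> (point \<Rightarrow> 'a::real_inner) \<Rightarrow> real" where
  "vol_norm K w = sqrt (vol_inner K w w)"

definition bdry_norm :: "quad \<Rightarrow> (point \<Rightarrow> 'a::real_inner) \<Rightarrow> real" where
  "bdry_norm K w = sqrt (bdry_inner K w w)"

definition vol_wnorm :: "real \<Rightarrow> quad \<Rightarrow> (point \<Rightarrow> 'a::real_inner) \<Rightarrow> real" where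
  "vol_wnorm \<Phi> K w = vol_norm K (\<lambda>x. sqrt \<Phi> *\<^sub>R w x)"

definition bdry_wnorm :: "real \<Rightarrow> quad \<Rightarrow> (point \<Rightarrow> 'a::real_inner) \<Rightarrow> real" where
  "bdry_wnorm \<Phi> K w = bdry_norm K (\<lambda>x. sqrt \<Phi> *\<^sub>R w x)"

text \<open>Broken functions assign to every element a function on it; \<open>w K\<close> restricted to the boundary
  of \<open>K\<close> is the trace from inside.\<close>

type_synonym 'a broken = "quad \<Rightarrow> point \<Rightarrow> 'a"

definition velocity :: "real broken \<Rightarrow> real broken \<Rightarrow> point broken" where
  "velocity u v K x = (u K x, v K x)"

text \<open>Trace from the neighbouring element, zero on the boundary of the domain. On the boundary of
  \<open>K\<close>, inside the domain, a neighbour exists everywhere and is unique except at the finitely many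
  vertices of the mesh, so the choice made there is irrelevant.\<close>

definition ext_trace :: "point set \<Rightarrow> quad set \<Rightarrow> 'a::zero broken \<Rightarrow> 'a broken" where
  "ext_trace \<Omega> T w K x =
     (if x \<in> frontier \<Omega> then 0
      else w (SOME K'. K' \<in> T \<and> K' \<noteq> K \<and> x \<in> cell K') x)"

text \<open>The numerical trace, where \<open>\<phi>, \<theta>\<close> is the old and \<open>\<phi>', \<theta>'\<close> the new iterate.\<close>

definition phi_hat ::
  "point set \<Rightarrow> quad set \<Rightarrow> real \<Rightarrow> real broken \<Rightarrow> point broken \<Rightarrow> real broken \<Rightarrow> point broken \<Rightarrow>
     real broken" where
  "phi_hat \<Omega> T \<Phi> \<phi> \<theta> \<phi>' \<theta>' K x =
     1 / 2 * (\<phi>' K x + ext_trace \<Omega> T \<phi> K x) +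
     sqrt \<Phi> / 2 * (\<theta>' K x \<bullet> nrm K x + ext_trace \<Omega> T \<theta> K x \<bullet> (- nrm K x))"

definition coriolis :: "real \<Rightarrow> real \<Rightarrow> real \<Rightarrow> point \<Rightarrow> real" where
  "coriolis f\<^sub>0 \<beta> y\<^sub>m z = f\<^sub>0 + \<beta> * (snd z - y\<^sub>m)"

definition ihdg2_step ::
  "point set \<Rightarrow> quad set \<Rightarrow> nat \<Rightarrow> real \<Rightarrow> real \<Rightarrow> (point \<Rightarrow> real) \<Rightarrow> real \<Rightarrow>
     real broken \<Rightarrow> real broken \<Rightarrow> real broken \<Rightarrow>
     real broken \<Rightarrow> real broken \<Rightarrow> real broken \<Rightarrow> bool" where
  "ihdg2_step \<Omega> T p \<Phi> \<gamma> f \<Delta>t \<phi> u v \<phi>' u' v' \<longleftrightarrow>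
     (\<forall>K\<in>T.
        \<phi>' K \<in> poly_space p \<and> u' K \<in> poly_space p \<and> v' K \<in> poly_space p \<and>
        (let \<theta>' = velocity u' v' K;
             \<phi>h = phi_hat \<Omega> T \<Phi> \<phi> (velocity u v) \<phi>' (velocity u' v') K
         in
           (\<forall>w\<in>poly_space p.
              vol_inner K (\<lambda>x. \<phi>' K x / \<Delta>t) w
              - vol_inner K (\<lambda>x. \<Phi> *\<^sub>R \<theta>' x) (grad w)
              + bdry_inner K (\<lambda>x. \<Phi> * (\<theta>' x \<bullet> nrm K x) + sqrt \<Phi> * (\<phi>' K x - \<phi>h x)) w
              = 0) \<and>
           (\<forall>w\<in>poly_space p.
              vol_inner K (\<lambda>x. \<Phi> * u' K x / \<Delta>t) w
              - vol_inner K (\<lambda>x. \<Phi> * \<phi>' K x) (pdx w)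
              + bdry_inner K (\<lambda>x. \<Phi> * \<phi>h x * fst (nrm K x)) w
              = vol_inner K (\<lambda>x. f x * \<Phi> * v' K x - \<gamma> * \<Phi> * u' K x) w) \<and>
           (\<forall>w\<in>poly_space p.
              vol_inner K (\<lambda>x. \<Phi> * v' K x / \<Delta>t) w
              - vol_inner K (\<lambda>x. \<Phi> * \<phi>' K x) (pdy w)
              + bdry_inner K (\<lambda>x. \<Phi> * \<phi>h x * snd (nrm K x)) w
              = vol_inner K (\<lambda>x. - f x * \<Phi> * u' K x - \<gamma> * \<Phi> * v' K x) w)))"

text \<open>\<open>\<parallel>(\<phi>, \<theta>)\<parallel>\<^sup>2\<close> over the elements and \<open>\<parallel>(\<phi>, \<theta> \<cdot> n)\<parallel>\<^sup>2\<close> over the skeleton, the latter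
  collecting the traces from both sides of each face.\<close>

definition mesh_norm2 :: "quad set \<Rightarrow> real \<Rightarrow> real broken \<Rightarrow> point broken \<Rightarrow> real" where
  "mesh_norm2 T \<Phi> \<phi> \<theta> = (\<Sum>K\<in>T. (vol_norm K (\<phi> K))\<^sup>2 + (vol_wnorm \<Phi> K (\<theta> K))\<^sup>2)"

definition skeleton_norm2 :: "quad set \<Rightarrow> real \<Rightarrow> real broken \<Rightarrow> point broken \<Rightarrow> real" where
  "skeleton_norm2 T \<Phi> \<phi> \<theta> =
     (\<Sum>K\<in>T. (bdry_norm K (\<phi> K))\<^sup>2 + (bdry_wnorm \<Phi> K (\<lambda>x. \<theta> K x \<bullet> nrm K x))\<^sup>2)"

definition inverse_trace_ineq :: "quad set \<Rightarrow> nat \<Rightarrow> real \<Rightarrow> bool" where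
  "inverse_trace_ineq T p c \<longleftrightarrow>
     (\<forall>K\<in>T. \<forall>w\<in>poly_space p.
        vol_inner K w w \<ge>
          2 * c * mesh_size T / (2 * (real p + 1) * (real p + 2)) * bdry_inner K w w)"

definition const_A :: "real \<Rightarrow> real \<Rightarrow> real" where
  "const_A \<Phi> \<epsilon> = (max 1 \<Phi> + sqrt \<Phi>) / (4 * \<epsilon>)"

definition const_G :: "real \<Rightarrow> real \<Rightarrow> real" where
  "const_G \<Phi> \<epsilon> = \<epsilon> * (max 1 \<Phi> + sqrt \<Phi>) / 4"

definition const_B1 :: "real \<Rightarrow> real \<Rightarrow> real \<Rightarrow> real \<Rightarrow> real \<Rightarrow> nat \<Rightarrow> real" where
  "const_B1 \<Phi> \<epsilon> \<Delta>t c h p =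
     c * h / (\<Delta>t * (real p + 1) * (real p + 2)) + (2 * sqrt \<Phi> - (\<Phi> + sqrt \<Phi>) * \<epsilon>) / 4"

definition const_B2 :: "real \<Rightarrow> real \<Rightarrow> real \<Rightarrow> real \<Rightarrow> real \<Rightarrow> real \<Rightarrow> nat \<Rightarrow> real" where
  "const_B2 \<Phi> \<gamma> \<epsilon> \<Delta>t c h p =
     (\<gamma> + 1 / \<Delta>t) * (c * h / ((real p + 1) * (real p + 2)))
     + (2 * sqrt \<Phi> - (1 + sqrt \<Phi>) * \<epsilon>) / 4"

definition const_B :: "real \<Rightarrow> real \<Rightarrow> real \<Rightarrow> real \<Rightarrow> real \<Rightarrow> real \<Rightarrow> nat \<Rightarrow> real" where
  "const_B \<Phi> \<gamma> \<epsilon> \<Delta>t c h p = min (const_B1 \<Phi> \<epsilon> \<Delta>t c h p) (const_B2 \<Phi> \<gamma> \<epsilon> \<Delta>t c h p)"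

definition const_C :: "real \<Rightarrow> real \<Rightarrow> real \<Rightarrow> real \<Rightarrow> real \<Rightarrow> real \<Rightarrow> nat \<Rightarrow> real" where
  "const_C \<Phi> \<gamma> \<epsilon> \<Delta>t c h p = const_A \<Phi> \<epsilon> / const_B \<Phi> \<gamma> \<epsilon> \<Delta>t c h p"

end

theory Submission
  imports Defs
begin

text \<open>
  Testing the scheme with the new iterate itself gives an energy identity on every element: the
  Coriolis terms cancel, the divergence theorem removes the gradient terms, and only the boundary
  terms with the numerical trace remain. Young's inequality with weight \<open>\<epsilon>\<close> and the inverse trace
  inequality bound the new skeleton norm by the norm of the exterior traces of the old iterate, and
  exchanging the two sides of every face bounds the latter by the old skeleton norm.

  The geometry is reduced to a local statement: by the Jordan curve theorem a quadrilateral is a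
  half-plane near every boundary point that is not a vertex. Hence the indicator function of the
  element on a generic horizontal line is a signed sum of half-lines ending at the edges, which
  yields the divergence theorem by Fubini, also for non-convex elements. Likewise two elements that
  share such a point lie on opposite sides of the face, so there the neighbour is unique and has the
  opposite normal.
\<close>

section \<open>Jordan curves and quadrilaterals\<close>

text \<open>Two obstacles shape the proof. \<open>nrm\<close> and \<open>ext_trace\<close> are
  defined by description and choice, so nothing is known of them at the vertices; boundary
  statements are therefore proved off a finite set, for edge integrals that ignore finite sets. And
  hanging nodes rule out matching edges with edges; faces are exchanged through the integral over
  the overlap of two edges, which is symmetric in both.

  The constants come from one pointwise inequality for the flux. With q = sqrt \<Phi>, the product
  of the two new traces cancels, and Young's inequality leaves the squares of the old traces with
  coefficients (q^2 + q) / (4 \<epsilon>) and (1 + q) / (4 \<epsilon>), the second one relative to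
  the weight \<Phi>; \<open>const_A\<close> is their maximum. The new traces keep the second
  summands of \<open>const_B1\<close> and \<open>const_B2\<close>. The resulting estimate on an
  element is read twice: if the volume terms are turned into boundary terms, they supply the first
  summands and give the contraction by A / B; if they are kept, the possibly negative boundary
  coefficients are bounded below by -G, which gives the estimate on the elements.\<close>

lemma connected_component_set_bij_image:
  fixes f :: "'a::euclidean_space \<Rightarrow> 'b::euclidean_space"
  assumes "linear f" "bij f" "x \<in> S"
  shows "connected_component_set (f ` S) (f x) = f ` connected_component_set S x"
proof
  obtain g where g: "linear g" "g \<circ> f = id"
    using linear_injective_left_inverse[OF assms(1) bij_is_inj[OF assms(2)]] by blast
  have "g (f z) = z" for z using g(2) by (metis comp_apply id_apply)
  then have "g = inv f" using assms(2) by (metis bij_is_surj ext surj_f_inv_f)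
  then have lin: "linear (inv f)" using g(1) by simp
  have "connected (inv f ` connected_component_set (f ` S) (f x))"
    by (intro connected_linear_image lin connected_connected_component)
  have "inv f ` connected_component_set (f ` S) (f x) \<subseteq> connected_component_set S x"
  proof (rule connected_component_maximal)
    show "x \<in> inv f ` connected_component_set (f ` S) (f x)"
      using assms by (auto intro!: image_eqI[of _ _ "f x"] simp: bij_is_inj)
    show "connected (inv f ` connected_component_set (f ` S) (f x))" by fact
    show "inv f ` connected_component_set (f ` S) (f x) \<subseteq> S"
      using image_mono[OF connected_component_subset[of "f ` S" "f x"], of "inv f"] bij_is_inj[OF assms(2)]
      by (simp add: image_inv_f_f)
  qed
  then show "connected_component_set (f ` S) (f x) \<subseteq> f ` connected_component_set S x"
    using image_mono[of _ _ f] image_f_inv_f[OF bij_is_surj[OF assms(2)]] by metis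
  show "f ` connected_component_set S x \<subseteq> connected_component_set (f ` S) (f x)"
    using assms by (intro connected_component_maximal connected_linear_image connected_connected_component image_mono connected_component_subset) auto
qed

text \<open>\<open>inside\<close> collects the bounded components of the complement, and a linear
  bijection of Euclidean spaces preserves components and boundedness in both directions.\<close>

lemma inside_bij_linear_image:
  fixes f :: "'a::euclidean_space \<Rightarrow> 'b::euclidean_space"
  assumes "linear f" "bij f"
  shows "inside (f ` S) = f ` inside S"
proof -
  have c: "- f ` S = f ` (- S)" using assms(2) by (simp add: bij_image_Compl_eq)
  have b: "bounded (f ` A) \<longleftrightarrow> bounded A" for A
  proof
    obtain g where g: "linear g" "g \<circ> f = id"
      using linear_injective_left_inverse[OF assms(1) bij_is_inj[OF assms(2)]] by blast
    assume "bounded (f ` A)"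
    then have "bounded (g ` f ` A)" using g(1) by (simp add: bounded_linear_image linear_conv_bounded_linear)
    then show "bounded A" using g(2) by (simp add: image_comp)
  qed (use assms(1) in \<open>simp add: bounded_linear_image linear_conv_bounded_linear\<close>)
  have "f x \<in> inside (f ` S) \<longleftrightarrow> x \<in> inside S" for x
  proof (cases "x \<in> S")
    case True then show ?thesis by (simp add: inside_def)
  next
    case False
    then have "f x \<notin> f ` S" using assms(2) by (auto simp: bij_def inj_eq)
    then show ?thesis using False assms
      by (simp add: inside_def c connected_component_set_bij_image b)
  qed
  then show ?thesis using assms(2) by (auto simp: bij_def) (metis image_eqI surjD)
qed

text \<open>\<open>Jordan_inside_outside\<close> speaks of paths in the complex plane; the linear
  bijection \<open>f\<close> commutes with frontier, inside and outside and so carries it over to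
  pairs. That the whole curve is the frontier of either side later decides on which side of an edge
  the element lies.\<close>

lemma Jordan_frontier_plane:
  fixes g :: "real \<Rightarrow> real \<times> real"
  assumes "simple_path g" "pathfinish g = pathstart g"
  shows "frontier (inside (path_image g)) = path_image g"
    and "frontier (outside (path_image g)) = path_image g"
proof -
  define f where "f = (\<lambda>z::real \<times> real. Complex (fst z) (snd z))"
  have lin: "linear f" by (auto simp: f_def linear_iff complex_eq_iff)
  have bij: "bij f" 
    by (rule o_bij[where g = "\<lambda>z. (Re z, Im z)"]) (auto simp: f_def fun_eq_iff)
  have "simple_path (f \<circ> g)"
    using simple_path_linear_image_eq[OF lin bij_is_inj[OF bij]] assms by simp
  moreover have "pathfinish (f \<circ> g) = pathstart (f \<circ> g)"
    using assms by (simp add: pathfinish_compose pathstart_compose)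
  ultimately have J: "frontier (inside (path_image (f \<circ> g))) = path_image (f \<circ> g)"
      "frontier (outside (path_image (f \<circ> g))) = path_image (f \<circ> g)"
    using Jordan_inside_outside by blast+
  have cl: "closure (f ` S) = f ` closure S" for S
    by (rule closure_injective_linear_image[OF lin bij_is_inj[OF bij], symmetric])
  have fr: "frontier (f ` S) = f ` frontier S" for S
    by (simp add: frontier_def cl interior_bijective_linear_image lin bij image_set_diff bij_is_inj)
  have ins: "inside (f ` S) = f ` inside S" for S
    by (rule inside_bij_linear_image[OF lin bij])
  have outs: "outside (f ` S) = f ` outside S" for S
    by (simp add: outside_inside ins bij_image_Compl_eq[OF bij, symmetric] image_Un image_Int[OF bij_is_inj[OF bij]])
  show "frontier (inside (path_image g)) = path_image g"
    using J(1) by (simp add: path_image_compose ins fr inj_image_eq_iff[OF bij_is_inj[OF bij]])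
  show "frontier (outside (path_image g)) = path_image g"
    using J(2) by (simp add: path_image_compose outs fr inj_image_eq_iff[OF bij_is_inj[OF bij]])
qed

lemma is_quad_distinct:
  assumes "is_quad (a, b, c, d)"
  shows "distinct [a, b, c, d]"
proof -
  have "\<not> collinear {a, b, c}" "\<not> collinear {b, c, d}" "\<not> collinear {c, d, a}" "\<not> collinear {d, a, b}"
    using assms by auto
  then show ?thesis by (auto simp: insert_commute)
qed

lemma path_image_quad: "path_image (quad_path K) = (\<Union>(a, b)\<in>edges K. closed_segment a b)"
  by (cases K) (auto simp: path_image_join)

text \<open>Splitting off one edge of the simple closed path after the other leaves only common end
  points as intersections, and an open segment omits its end points.\<close>

lemma quad_edges_disjoint:
  assumes "is_quad K" "(a, b) \<in> edges K" "(a', b') \<in> edges K" "(a, b) \<noteq> (a', b')"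
  shows "open_segment a b \<inter> closed_segment a' b' = {}"
proof -
  obtain p q r s where K: "K = (p, q, r, s)" by (cases K)
  have d: "distinct [p, q, r, s]" using is_quad_distinct assms(1) unfolding K by blast
  have sp: "simple_path (linepath p q +++ linepath q r +++ linepath r s +++ linepath s p)"
    using assms(1) by (simp add: K)
  then have 1: "closed_segment p q \<inter> (closed_segment q r \<union> closed_segment r s \<union> closed_segment s p) \<subseteq> {p, q}"
    and 2: "arc (linepath q r +++ linepath r s +++ linepath s p)"
    by (auto simp: simple_path_join_loop_eq path_image_join)
  from 2 have 3: "closed_segment q r \<inter> (closed_segment r s \<union> closed_segment s p) \<subseteq> {r}"
    and 4: "arc (linepath r s +++ linepath s p)"
    by (auto simp: arc_join_eq path_image_join)
  from 4 have 5: "closed_segment r s \<inter> closed_segment s p \<subseteq> {s}" by (auto simp: arc_join_eq)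
  have e: "p \<in> closed_segment p q" "q \<in> closed_segment p q" "q \<in> closed_segment q r" 
    "r \<in> closed_segment q r" "r \<in> closed_segment r s" "s \<in> closed_segment r s"
     "s \<in> closed_segment s p" "p \<in> closed_segment s p" by auto
  show ?thesis
    using assms(2-4) d 1 3 5 e unfolding K open_segment_def
    by (simp, elim disjE; simp; blast)
qed

section \<open>The local shape of a quadrilateral at its edges\<close>

text \<open>The property under the description operator of \<open>outward_normal\<close>, named so
  that existence and uniqueness of the normal can be treated apart.\<close>

definition half_plane_at :: "point set \<Rightarrow> point \<Rightarrow> point \<Rightarrow> bool" where
  "half_plane_at S x n \<longleftrightarrow>
     norm n = 1 \<and> (\<exists>r>0. \<forall>y\<in>ball x r. y \<in> S \<longleftrightarrow> (y - x) \<bullet> n \<le> 0)"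

text \<open>The two half-planes must agree on a point reached from \<open>x\<close> in direction
  \<open>n - m\<close>. For unit vectors \<open>(n - m) \<bullet> m \<le> 0\<close>, hence also
  \<open>(n - m) \<bullet> n \<le> 0\<close>, and twice the latter number is the squared norm of
  \<open>n - m\<close>.\<close>

lemma half_plane_at_unique:
  assumes "half_plane_at S x n" "half_plane_at S x m"
  shows "n = m"
proof -
  from assms obtain r where r: "r > 0" "\<And>y. y \<in> ball x r \<Longrightarrow> y \<in> S \<longleftrightarrow> (y - x) \<bullet> n \<le> 0"
    and n: "norm n = 1" unfolding half_plane_at_def by blast
  from assms obtain s where s: "s > 0" "\<And>y. y \<in> ball x s \<Longrightarrow> y \<in> S \<longleftrightarrow> (y - x) \<bullet> m \<le> 0"
    and m: "norm m = 1" unfolding half_plane_at_def by blast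
  \<comment> \<open>Since \<open>norm (n - m) \<le> 2\<close>, the factor 1/4 keeps the test point
    strictly inside both balls.\<close>
  define \<delta> where "\<delta> = min r s / 4"
  have \<delta>: "\<delta> > 0" using r(1) s(1) by (simp add: \<delta>_def)
  define y where "y = x + \<delta> *\<^sub>R (n - m)"
  have "norm (n - m) \<le> 2" using norm_triangle_ineq4[of n m] n m by simp
  then have "\<delta> * norm (n - m) \<le> \<delta> * 2" using \<delta> by (intro mult_left_mono) auto
  also have "\<dots> < min r s" using r(1) s(1) unfolding \<delta>_def by linarith
  finally have "y \<in> ball x r" "y \<in> ball x s"
    using \<delta> by (auto simp: y_def dist_norm)
  then have "(y - x) \<bullet> n \<le> 0 \<longleftrightarrow> (y - x) \<bullet> m \<le> 0" using r(2) s(2) by blast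
  then have e: "(n - m) \<bullet> n \<le> 0 \<longleftrightarrow> (n - m) \<bullet> m \<le> 0"
    using \<delta> by (simp add: y_def mult_le_0_iff)
  have nm: "n \<bullet> n = 1" "m \<bullet> m = 1" using n m by (simp_all add: norm_eq_1)
  have "n \<bullet> m \<le> 1" using norm_cauchy_schwarz[of n m] n m by simp
  then have "(n - m) \<bullet> m \<le> 0" by (simp add: inner_diff_left nm)
  with e have "(n - m) \<bullet> (n - m) \<le> 0"
    using \<open>n \<bullet> m \<le> 1\<close> by (simp add: inner_diff_left inner_diff_right nm inner_commute)
  then show ?thesis using inner_ge_zero[of "n-m"] by auto
qed

lemma outward_normal_eq: "half_plane_at S x n \<Longrightarrow> outward_normal S x = n"
  unfolding outward_normal_def half_plane_at_def[symmetric]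
  using half_plane_at_unique by (blast intro: the_equality)

lemma closed_cell: "is_quad K \<Longrightarrow> closed (cell K)"
  unfolding cell_def by (cases K) (metis is_quad.simps closed_path_image_Un_inside simple_path_imp_path)

lemma compact_cell:
  assumes "is_quad K" shows "compact (cell K)"
proof -
  have "path (quad_path K)" using assms by (cases K) (metis is_quad.simps simple_path_imp_path)
  then have "bounded (cell K)"
    unfolding cell_def by (simp add: bounded_path_image bounded_inside)
  then show ?thesis using closed_cell[OF assms] by (simp add: compact_eq_bounded_closed)
qed

lemma frontier_cell_subset:
  assumes "is_quad K" shows "frontier (cell K) \<subseteq> path_image (quad_path K)"
proof -
  have "path (quad_path K)" using assms by (cases K) (metis is_quad.simps simple_path_imp_path)
  then have "open (inside (path_image (quad_path K)))" by (simp add: closed_path_image open_inside)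
  then have "inside (path_image (quad_path K)) \<subseteq> interior (cell K)"
    by (intro interior_maximal) (auto simp: cell_def)
  moreover have "closure (cell K) = cell K" using closed_cell[OF assms] by simp
  ultimately show ?thesis by (auto simp: frontier_def cell_def)
qed

lemma inner_perp_eq_0_iff:
  fixes y d :: point
  assumes "d \<noteq> 0"
  shows "y \<bullet> (snd d, - fst d) = 0 \<longleftrightarrow> (\<exists>s. y = s *\<^sub>R d)"
proof
  assume *: "y \<bullet> (snd d, - fst d) = 0"
  show "\<exists>s. y = s *\<^sub>R d"
  proof (cases "fst d = 0")
    case True
    then have "snd d \<noteq> 0" using assms by (simp add: prod_eq_iff)
    then show ?thesis using * True by (intro exI[of _ "snd y / snd d"]) (auto simp: inner_prod_def prod_eq_iff)
  next
    case False
    then show ?thesis using * by (intro exI[of _ "fst y / fst d"]) (auto simp: inner_prod_def prod_eq_iff field_simps)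
  qed
qed (auto simp: inner_prod_def)

text \<open>Near \<open>x\<close> the curve is a straight line, so a small ball splits into two open
  half-balls that avoid the curve; each is connected and hence lies in the inside or misses it. They
  cannot both do the same, because \<open>x\<close> is in the closure of the inside and of the
  outside.\<close>

lemma half_plane_at_edge:
  assumes K: "is_quad K" and ab: "(a, b) \<in> edges K" and x: "x \<in> open_segment a b"
  shows "\<exists>n. half_plane_at (cell K) x n \<and> n \<bullet> (b - a) = 0"
proof -
  define P where "P = path_image (quad_path K)"
  have sp: "simple_path (quad_path K)" "pathfinish (quad_path K) = pathstart (quad_path K)"
    using K by (cases K; simp)+
  have fi: "frontier (inside P) = P" and fo: "frontier (outside P) = P"
    unfolding P_def using Jordan_frontier_plane[OF sp] by auto
  have "a \<noteq> b" using x by auto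
  then have d0: "b - a \<noteq> 0" by simp
  obtain t where t: "0 < t" "t < 1" "x = a + t *\<^sub>R (b - a)"
    using x by (auto simp: in_segment algebra_simps)
  define n0 where "n0 = (snd (b - a), - fst (b - a)) /\<^sub>R norm (b - a)"
  have "norm (snd (b - a), - fst (b - a)) = norm (b - a)"
    by (simp add: norm_prod_def power2_commute add.commute)
  then have n0: "norm n0 = 1" using d0 by (simp add: n0_def del: scaleR_Pair)
  have n0b: "n0 \<bullet> (b - a) = 0" by (simp add: n0_def inner_prod_def algebra_simps)
  have n0iff: "y \<bullet> n0 = 0 \<longleftrightarrow> (\<exists>s. y = s *\<^sub>R (b - a))" for y
    using inner_perp_eq_0_iff[OF d0, of y] d0 by (simp add: n0_def del: scaleR_Pair)
  \<comment> \<open>The other three edges; they form a closed set that misses \<open>x\<close> and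
    therefore a whole ball around it.\<close>
  define C where "C = (\<Union>(a', b')\<in>edges K - {(a, b)}. closed_segment a' b')"
  have "finite (edges K)" by (cases K) auto
  then have "closed C" unfolding C_def by (intro closed_UN) auto
  moreover have "x \<notin> C" using quad_edges_disjoint[OF K ab] x unfolding C_def by blast
  ultimately obtain r1 where r1: "r1 > 0" "ball x r1 \<inter> C = {}"
    by (metis (no_types) Compl_iff disjoint_eq_subset_Compl open_Compl open_contains_ball)
  have PC: "P = C \<union> closed_segment a b" using ab unfolding P_def C_def path_image_quad by auto
  \<comment> \<open>The distances to \<open>a\<close> and \<open>b\<close> make the ball end before
    the edge does, so that within it the edge and its full line coincide.\<close>
  define r where "r = min r1 (min (dist x a) (dist x b))"
  have "x \<noteq> a" "x \<noteq> b" using x by (auto simp: open_segment_def)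
  then have r: "r > 0" using r1 by (simp add: r_def)
  have line: "y \<in> P \<longleftrightarrow> (y - x) \<bullet> n0 = 0" if y: "y \<in> ball x r" for y
  proof
    assume "y \<in> P"
    then have "y \<in> closed_segment a b" using PC r1 y by (auto simp: r_def)
    then obtain s where "y = a + s *\<^sub>R (b - a)" by (auto simp: in_segment algebra_simps)
    then have "y - x = (s - t) *\<^sub>R (b - a)" by (simp add: t algebra_simps)
    then show "(y - x) \<bullet> n0 = 0" using n0iff by blast
  next
    assume "(y - x) \<bullet> n0 = 0"
    then obtain s where s: "y - x = s *\<^sub>R (b - a)" using n0iff by blast
    then have ys: "y = a + (t + s) *\<^sub>R (b - a)" by (simp add: t algebra_simps)
    have "dist x y = \<bar>s\<bar> * norm (b - a)" by (metis dist_commute dist_norm norm_scaleR s)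
    moreover have "dist x a = t * norm (b - a)" using t by (simp add: dist_norm)
    moreover have "dist x b = (1 - t) * norm (b - a)"
    proof -
      have "x - b = (t - 1) *\<^sub>R (b - a)" by (simp add: t algebra_simps)
      then show ?thesis using t by (simp add: dist_norm)
    qed
    moreover have "dist x y < dist x a" "dist x y < dist x b" using y by (auto simp: r_def)
    ultimately have "\<bar>s\<bar> < t" "\<bar>s\<bar> < 1 - t" using d0 by (simp_all add: mult_less_cancel_right)
    then have "y \<in> closed_segment a b"
      unfolding in_segment using ys by (intro exI[of _ "t + s"]) (auto simp: algebra_simps)
    then show "y \<in> P" using PC by blast
  qed
  define H where "H m = ball x r \<inter> {y. (y - x) \<bullet> m < 0}" for m
  have conH: "connected (H m)" for m
  proof -
    have "{y. (y - x) \<bullet> m < 0} = {y. m \<bullet> y < m \<bullet> x}" by (metis (no_types, opaque_lifting) inner_commute inner_diff_left diff_less_0_iff_less)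
    then show ?thesis unfolding H_def
      by (metis convex_connected convex_Int convex_ball convex_halfspace_lt)
  qed
  have H: "H m \<inter> inside P = {} \<or> H m \<subseteq> inside P" if "m = n0 \<or> m = - n0" for m
  proof -
    have "H m \<inter> P = {}" using line that unfolding H_def by auto
    then show ?thesis using connected_Int_frontier[OF conH[of m], of "inside P"] fi by blast
  qed
  have ball: "ball x r \<subseteq> H n0 \<union> H (- n0) \<union> P" using line unfolding H_def by force
  have xP: "x \<in> P" using line[of x] r by simp
  have "\<not> (H n0 \<inter> inside P = {} \<and> H (- n0) \<inter> inside P = {})"
  proof
    assume "H n0 \<inter> inside P = {} \<and> H (- n0) \<inter> inside P = {}"
    then have "ball x r \<inter> inside P = {}" using ball inside_no_overlap[of P] by blast
    moreover have "x \<in> closure (inside P)" using xP fi by (auto simp: frontier_def)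
    ultimately show False using r by (meson centre_in_ball disjoint_iff open_Int_closure_eq_empty open_ball)
  qed
  moreover have "\<not> (H n0 \<subseteq> inside P \<and> H (- n0) \<subseteq> inside P)"
  proof
    assume "H n0 \<subseteq> inside P \<and> H (- n0) \<subseteq> inside P"
    then have "ball x r \<inter> outside P = {}"
      using ball outside_no_overlap[of P] inside_Int_outside[of P] by blast
    moreover have "x \<in> closure (outside P)" using xP fo by (auto simp: frontier_def)
    ultimately show False using r by (meson centre_in_ball disjoint_iff open_Int_closure_eq_empty open_ball)
  qed
  ultimately obtain m where m: "m = n0 \<or> m = - n0" "H m \<subseteq> inside P" "H (- m) \<inter> inside P = {}"
    using H[of n0] H[of "- n0"] by (metis minus_minus)
  have "y \<in> cell K \<longleftrightarrow> (y - x) \<bullet> m \<le> 0" if y: "y \<in> ball x r" for y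
  proof -
    consider "(y - x) \<bullet> m = 0" | "(y - x) \<bullet> m < 0" | "(y - x) \<bullet> m > 0" by linarith
    then show ?thesis
    proof cases
      case 1
      then show ?thesis using line[OF y] m(1) by (auto simp: cell_def P_def)
    next
      case 2
      then show ?thesis using m(2) y by (auto simp: cell_def P_def H_def)
    next
      case 3
      then have "y \<in> H (- m)" using y by (simp add: H_def)
      moreover have "y \<notin> P" using line[OF y] m(1) 3 by auto
      ultimately show ?thesis using m(3) 3 by (auto simp: cell_def P_def)
    qed
  qed
  then have "half_plane_at (cell K) x m" using m(1) n0 r unfolding half_plane_at_def by auto
  moreover have "m \<bullet> (b - a) = 0" using m(1) n0b by auto
  ultimately show ?thesis by blast
qed

text \<open>Moving the base point along the edge does not change its inner product with the normal,
  so the normal at one point also serves the nearby ones. It is thus locally constant, and an open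
  segment is connected.\<close>

lemma half_plane_at_edge_const:
  assumes K: "is_quad K" and ab: "(a, b) \<in> edges K"
  shows "\<exists>n. n \<bullet> (b - a) = 0 \<and> (\<forall>x\<in>open_segment a b. half_plane_at (cell K) x n)"
proof (cases "open_segment a b = {}")
  case True then show ?thesis by (intro exI[of _ 0]) auto
next
  case False
  define N where "N = outward_normal (cell K)"
  have N: "half_plane_at (cell K) x (N x)" "N x \<bullet> (b - a) = 0" if "x \<in> open_segment a b" for x
    using half_plane_at_edge[OF K ab that] outward_normal_eq unfolding N_def by metis+
  obtain x0 where x0: "x0 \<in> open_segment a b" using False by blast
  have "N x0 = N x" if "x \<in> open_segment a b" for x
  proof (rule connected_local_const[OF _ x0 that])
    show "connected (open_segment a b)" by (simp add: convex_connected)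
    show "\<forall>x\<in>open_segment a b. \<forall>\<^sub>F y in at x within open_segment a b. N x = N y"
    proof
      fix x assume x: "x \<in> open_segment a b"
      obtain r where r: "r > 0" "\<And>y. y \<in> ball x r \<Longrightarrow> y \<in> cell K \<longleftrightarrow> (y - x) \<bullet> N x \<le> 0"
        and n: "norm (N x) = 1" using N(1)[OF x] unfolding half_plane_at_def by blast
      have "N x = N y" if y: "y \<in> open_segment a b" "dist y x < r" for y
      proof -
        obtain s t where st: "x = a + t *\<^sub>R (b - a)" "y = a + s *\<^sub>R (b - a)"
          using x y by (auto simp: in_segment algebra_simps)
        then have "y - x = (s - t) *\<^sub>R (b - a)" by (simp add: scaleR_diff_left)
        then have "(y - x) \<bullet> N x = 0" using N(2)[OF x] by (simp only: inner_scaleR_left inner_commute[of "b - a"] mult_zero_right)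
        then have yx: "y \<bullet> N x = x \<bullet> N x" by (simp add: inner_diff_left)
        have "half_plane_at (cell K) y (N x)"
          unfolding half_plane_at_def
        proof (intro conjI n exI[of _ "r - dist y x"] ballI)
          fix z assume "z \<in> ball y (r - dist y x)"
          then have "z \<in> ball x r" using dist_triangle[of x z y] by (simp add: dist_commute)
          then show "z \<in> cell K \<longleftrightarrow> (z - y) \<bullet> N x \<le> 0" using r(2)[of z] yx by (simp add: inner_diff_left)
        qed (use y in simp)
        then show ?thesis using outward_normal_eq unfolding N_def by metis
      qed
      then show "\<forall>\<^sub>F y in at x within open_segment a b. N x = N y"
        unfolding eventually_at using r(1) by blast
    qed
  qed
  then show ?thesis using N x0 by (intro exI[of _ "N x0"]) metis
qed

section \<open>The divergence theorem for polygonal regions\<close>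

text \<open>An interface that is stable under exchanging the coordinates, so that one proof by
  horizontal slices serves both directions. Normals belong to edges instead of points, which keeps
  the vertices out of the statements.\<close>

locale polygonal_region =
  fixes S :: "point set" and E :: "(point \<times> point) set" and N :: "point \<times> point \<Rightarrow> point"
  assumes compact_S: "compact S" and finite_E: "finite E"
    and frontier_S: "frontier S \<subseteq> (\<Union>(a, b)\<in>E. closed_segment a b)"
    and nondeg: "(a, b) \<in> E \<Longrightarrow> a \<noteq> b"
    and perp: "(a, b) \<in> E \<Longrightarrow> N (a, b) \<bullet> (b - a) = 0"
    and half_plane: "(a, b) \<in> E \<Longrightarrow> x \<in> open_segment a b \<Longrightarrow> half_plane_at S x (N (a, b))"
    and disj: "(a, b) \<in> E \<Longrightarrow> (a', b') \<in> E \<Longrightarrow> (a, b) \<noteq> (a', b') \<Longrightarrow>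
      open_segment a b \<inter> closed_segment a' b' = {}"

text \<open>The abscissa at which the line through the edge has height \<open>y\<close>. For a
  horizontal edge the division by zero yields a meaningless value, which \<open>crosses\<close>
  filters out.\<close>

definition level_x :: "point \<times> point \<Rightarrow> real \<Rightarrow> real" where
  "level_x e y = fst (fst e) +
     (y - snd (fst e)) / (snd (snd e) - snd (fst e)) * (fst (snd e) - fst (fst e))"

text \<open>The open segment is empty for equal heights, so a horizontal edge never crosses; end
  points never count.\<close>

definition crosses :: "point \<times> point \<Rightarrow> real \<Rightarrow> bool" where
  "crosses e y \<longleftrightarrow> y \<in> open_segment (snd (fst e)) (snd (snd e))"

lemma crosses_level_in_segment:
  assumes "crosses (a, b) y"
  shows "(level_x (a, b) y, y) \<in> open_segment a b"
proof -
  obtain t where t: "0 < t" "t < 1" "y = (1 - t) * snd a + t * snd b" "snd a \<noteq> snd b"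
    using assms by (auto simp: crosses_def in_segment)
  then have "y - snd a = t * (snd b - snd a)" by (simp add: algebra_simps)
  then have "(y - snd a) / (snd b - snd a) = t" using t by simp
  then have "level_x (a, b) y = (1 - t) * fst a + t * fst b"
    by (simp add: level_x_def) (simp add: algebra_simps)
  then have "(level_x (a, b) y, y) = (1 - t) *\<^sub>R a + t *\<^sub>R b"
    using t by (simp add: prod_eq_iff)
  moreover have "a \<noteq> b" using t by auto
  ultimately show ?thesis using t by (auto simp: in_segment)
qed

lemma segment_level:
  assumes "(x, y) \<in> closed_segment a b" "y \<noteq> snd a" "y \<noteq> snd b"
  shows "crosses (a, b) y" "x = level_x (a, b) y"
proof -
  obtain t where t: "0 \<le> t" "t \<le> 1" "(x, y) = (1 - t) *\<^sub>R a + t *\<^sub>R b"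
    using assms by (auto simp: in_segment)
  then have y: "y = (1 - t) * snd a + t * snd b" and x: "x = (1 - t) * fst a + t * fst b"
    by (simp_all add: prod_eq_iff)
  have ne: "snd a \<noteq> snd b" using assms y by (auto simp: algebra_simps)
  have "t \<noteq> 0" "t \<noteq> 1" using assms y by auto
  then show "crosses (a, b) y" using t y ne by (auto simp: crosses_def in_segment intro!: exI[of _ t])
  have "y - snd a = t * (snd b - snd a)" using y by (simp add: algebra_simps)
  then have "(y - snd a) / (snd b - snd a) = t" using ne by simp
  then show "x = level_x (a, b) y" using x by (simp add: level_x_def algebra_simps)
qed

text \<open>The conversion factor between arc length and height along an edge: for nonzero
  \<open>d\<close>, a unit vector orthogonal to \<open>d\<close> is, up to sign, \<open>d\<close>
  normalised and turned by a right angle.\<close>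

lemma norm_mult_fst_normal:
  fixes n d :: point
  assumes "n \<bullet> d = 0" "norm n = 1"
  shows "norm d * \<bar>fst n\<bar> = \<bar>snd d\<bar>"
proof -
  have 1: "fst n * fst d = - (snd n * snd d)" using assms(1) by (simp add: inner_prod_def)
  have 2: "(fst n)\<^sup>2 + (snd n)\<^sup>2 = 1" using assms(2) by (simp add: norm_prod_def)
  have "(norm d * \<bar>fst n\<bar>)\<^sup>2 = ((fst d)\<^sup>2 + (snd d)\<^sup>2) * (fst n)\<^sup>2"
    by (simp add: norm_prod_def power_mult_distrib)
  also have "\<dots> = (fst n * fst d)\<^sup>2 + (snd d)\<^sup>2 * (fst n)\<^sup>2" by (simp add: algebra_simps power_mult_distrib)
  also have "\<dots> = (snd d)\<^sup>2 * ((fst n)\<^sup>2 + (snd n)\<^sup>2)" unfolding 1 by (simp add: algebra_simps power_mult_distrib)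
  also have "\<dots> = \<bar>snd d\<bar>\<^sup>2" using 2 by simp
  finally show ?thesis by (rule power2_eq_imp_eq) auto
qed

context polygonal_region
begin

lemma finite_crosses: "finite {e\<in>E. crosses e y}" using finite_E by simp

lemma normal_facts:
  assumes "(a, b) \<in> E"
  shows "norm (N (a, b)) = 1" "dist a b * \<bar>fst (N (a, b))\<bar> = \<bar>snd b - snd a\<bar>"
proof -
  have "open_segment a b \<noteq> {}" using nondeg[OF assms] by simp
  then obtain x where "x \<in> open_segment a b" by blast
  then show 1: "norm (N (a, b)) = 1" using half_plane[OF assms] by (auto simp: half_plane_at_def)
  show "dist a b * \<bar>fst (N (a, b))\<bar> = \<bar>snd b - snd a\<bar>"
    using norm_mult_fst_normal[OF perp[OF assms] 1] by (simp add: dist_norm norm_minus_commute)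
qed

lemma fst_normal_nz: "e \<in> E \<Longrightarrow> crosses e y \<Longrightarrow> fst (N e) \<noteq> 0"
  using normal_facts[of "fst e" "snd e"] by (cases e) (auto simp: crosses_def)

text \<open>If the normal points to the right, the region ends at the edge and contains the edge
  point, so the half-line is closed. If it points to the left, the region starts there, and the
  subtracted half-line is open so that the edge point remains. The slice identity then holds at
  every point of the line, not just almost everywhere.\<close>

definition jump :: "point \<times> point \<Rightarrow> real \<Rightarrow> real \<Rightarrow> real" where
  "jump e y x = sgn (fst (N e)) *
     (if x < level_x e y \<or> x = level_x e y \<and> fst (N e) > 0 then 1 else 0)"

lemma jump_locally_const:
  assumes "x \<noteq> level_x e y"
  shows "\<forall>\<^sub>F x' in at x. jump e y x = jump e y x'"
proof -
  have "\<forall>\<^sub>F x' in at x. x' \<in> (if x < level_x e y then {..<level_x e y} else {level_x e y<..})"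
    using assms by (intro eventually_at_in_open') auto
  then show ?thesis by eventually_elim (use assms in \<open>auto simp: jump_def split: if_splits\<close>)
qed

text \<open>On a horizontal line that avoids the vertices, the indicator function of the region is a
  signed sum of indicator functions of half-lines: both sides have the same jumps, and both vanish
  far to the right.\<close>

lemma indicator_slice:
  assumes y: "y \<notin> snd ` (fst ` E \<union> snd ` E)"
  shows "indicator S (x, y) = (\<Sum>e\<in>{e\<in>E. crosses e y}. jump e y x)"
proof -
  let ?A = "{e\<in>E. crosses e y}"
  have onedge: "crosses (a, b) y \<and> x = level_x (a, b) y"
    if "(a, b) \<in> E" "(x, y) \<in> closed_segment a b" for a b x
  proof -
    have "y \<noteq> snd a" "y \<noteq> snd b" using y that(1) by force+
    then show ?thesis using segment_level[OF that(2)] by blast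
  qed
  define D where "D x = indicator S (x, y) - (\<Sum>e\<in>?A. jump e y x)" for x
  have loc: "\<forall>\<^sub>F x' in at x. D x = D x'" for x
  proof (cases "\<exists>e\<in>?A. level_x e y = x")
    case False
    have "\<forall>\<^sub>F x' in at x. \<forall>e\<in>?A. jump e y x = jump e y x'"
      by (intro eventually_ball_finite finite_crosses ballI jump_locally_const) (use False in auto)
    moreover have "\<forall>\<^sub>F x' in at x. ((x', y) \<in> S) = ((x, y) \<in> S)"
    proof -
      have "(x, y) \<notin> frontier S"
        using frontier_S onedge False by fastforce
      then have *: "(x, y) \<in> interior S \<or> (x, y) \<in> interior (- S)"
        by (auto simp: frontier_def interior_closure)
      have t: "((\<lambda>x'. (x', y)) \<longlongrightarrow> (x, y)) (at x)" by (intro tendsto_intros)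
      show ?thesis
      proof (cases "(x, y) \<in> interior S")
        case True
        have "\<forall>\<^sub>F x' in at x. (x', y) \<in> interior S" by (rule topological_tendstoD[OF t _ True]) simp
        then show ?thesis by eventually_elim (use True interior_subset in blast)
      next
        case False
        with * have i: "(x, y) \<in> interior (- S)" by simp
        have "\<forall>\<^sub>F x' in at x. (x', y) \<in> interior (- S)" by (rule topological_tendstoD[OF t _ i]) simp
        then show ?thesis by eventually_elim (use i interior_subset in blast)
      qed
    qed
    ultimately show ?thesis
      by eventually_elim (auto simp: D_def indicator_def intro!: sum.cong)
  next
    case True
    then obtain e where e: "e \<in> E" "crosses e y" "level_x e y = x" by auto
    obtain a b where ab: "e = (a, b)" by (cases e)
    have xy: "(x, y) \<in> open_segment a b" using crosses_level_in_segment e ab by metis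
    \<comment> \<open>Only one edge passes through the point, since no other edge meets the open
      segment of \<open>e\<close>. All other summands are locally constant there, and only the jump
      of \<open>e\<close> has to be compared with that of the indicator.\<close>
    have other: "level_x e' y \<noteq> x" if "e' \<in> ?A - {e}" for e'
    proof
      assume *: "level_x e' y = x"
      obtain a' b' where ab': "e' = (a', b')" by (cases e')
      have "(x, y) \<in> open_segment a' b'" using crosses_level_in_segment that * ab' by blast
      then show False using disj[of a b a' b'] xy that e ab ab' open_closed_segment by blast
    qed
    have "\<forall>\<^sub>F x' in at x. \<forall>e'\<in>?A - {e}. jump e' y x = jump e' y x'"
      by (intro eventually_ball_finite finite_Diff finite_crosses ballI jump_locally_const not_sym[OF other])
    moreover have "\<forall>\<^sub>F x' in at x.
      indicator S (x, y) - jump e y x = (indicator S (x', y) - jump e y x' :: real)"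
    proof -
      have nz: "fst (N e) \<noteq> 0" using fst_normal_nz e by blast
      obtain r where r: "r > 0" "\<And>z. z \<in> ball (x, y) r \<Longrightarrow> z \<in> S \<longleftrightarrow> (z - (x, y)) \<bullet> N e \<le> 0"
        using half_plane[of a b, OF _ xy] e ab unfolding half_plane_at_def by blast
      have *: "(x', y) \<in> S \<longleftrightarrow> (x' - x) * fst (N e) \<le> 0" if "dist x' x < r" for x'
        using r(2)[of "(x', y)"] that by (simp add: dist_prod_def dist_commute inner_prod_def)
      have "indicator S (x, y) - jump e y x = (indicator S (x', y) - jump e y x' :: real)"
        if "dist x' x < r" for x'
        using *[OF that] *[of x] r(1) nz unfolding jump_def e(3) indicator_def
        by (cases "fst (N e) > 0") (auto simp: mult_le_0_iff sgn_if)
      then show ?thesis unfolding eventually_at using r(1) by blast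
    qed
    ultimately show ?thesis
    proof eventually_elim
      case (elim x')
      have "D z = (indicator S (z, y) - jump e y z) - (\<Sum>e\<in>?A - {e}. jump e y z)" for z
        using sum.remove[OF finite_crosses, of e y "\<lambda>e. jump e y z"] e by (simp add: D_def)
      then show ?case using elim by simp
    qed
  qed
  have const: "D x = D x'" for x x'
    by (rule connected_local_const[of UNIV]) (use loc in auto)
  obtain B where B: "\<And>z. z \<in> S \<Longrightarrow> norm z \<le> B"
    using compact_imp_bounded[OF compact_S] unfolding bounded_iff by blast
  have "\<forall>\<^sub>F x in at_top. \<forall>e\<in>?A. level_x e y < x"
    by (intro eventually_ball_finite finite_crosses ballI eventually_gt_at_top)
  moreover have "\<forall>\<^sub>F x in at_top. B < x" by (rule eventually_gt_at_top)
  ultimately have "\<forall>\<^sub>F x in at_top. D x = 0"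
  proof eventually_elim
    case (elim x)
    have "(x, y) \<notin> S"
    proof
      assume "(x, y) \<in> S"
      then have "norm (x, y) \<le> B" by (rule B)
      then show False using norm_fst_le[of x y] elim by simp
    qed
    moreover have "jump e y x = 0" if "e \<in> ?A" for e using bspec[OF elim(1) that] by (simp add: jump_def)
    ultimately show ?case by (simp add: D_def)
  qed
  then obtain x' where "D x' = 0" using eventually_happens'[OF trivial_limit_at_top_linorder] by blast
  then have "D x = 0" using const by metis
  then show ?thesis by (simp add: D_def)
qed

text \<open>The half-lines are cut off at a common left end \<open>m\<close>, and the fundamental
  theorem of calculus is applied to each interval. The values of \<open>g\<close> at
  \<open>m\<close> cancel because the signs add up to zero.\<close>

lemma integral_slice:
  fixes g h :: "point \<Rightarrow> real"
  assumes y: "y \<notin> snd ` (fst ` E \<union> snd ` E)"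
    and g: "\<And>x. ((\<lambda>s. g (s, y)) has_real_derivative h (x, y)) (at x)"
    and h: "continuous_on UNIV h"
  shows "(\<integral>x. indicator S (x, y) * h (x, y) \<partial>lborel) =
    (\<Sum>e\<in>{e\<in>E. crosses e y}. sgn (fst (N e)) * g (level_x e y, y))"
proof -
  let ?A = "{e\<in>E. crosses e y}"
  obtain B where B: "\<And>z. z \<in> S \<Longrightarrow> norm z \<le> B"
    using compact_imp_bounded[OF compact_S] unfolding bounded_iff by blast
  have "\<forall>\<^sub>F x in at_bot. \<forall>e\<in>?A. x < level_x e y"
    by (intro eventually_ball_finite finite_crosses ballI eventually_gt_at_bot)
  moreover have "\<forall>\<^sub>F x in at_bot. x < - B" by (rule eventually_gt_at_bot)
  ultimately have "\<forall>\<^sub>F x in at_bot. x < - B \<and> (\<forall>e\<in>?A. x < level_x e y)" by eventually_elim auto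
  then obtain m where m: "m < - B" "\<And>e. e \<in> ?A \<Longrightarrow> m < level_x e y"
    using eventually_happens'[OF trivial_limit_at_bot_linorder] by blast
  have out: "(x, y) \<notin> S" if "x \<le> m" for x
  proof
    assume "(x, y) \<in> S"
    then have "norm (x, y) \<le> B" by (rule B)
    then show False using norm_fst_le[of x y] m that by simp
  qed
  \<comment> \<open>To the left of everything each half-line contributes its full sign, while the
    indicator of the region vanishes.\<close>
  have "(\<Sum>e\<in>?A. sgn (fst (N e))) = (\<Sum>e\<in>?A. jump e y m)"
    by (intro sum.cong) (use m in \<open>auto simp: jump_def\<close>)
  also have "\<dots> = 0" using indicator_slice[OF y, of m] out[of m] by simp
  finally have s0: "(\<Sum>e\<in>?A. sgn (fst (N e))) = 0" .
  have hc: "continuous_on A (\<lambda>x. h (x, y))" for A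
    by (rule continuous_on_compose2[OF h]) (auto intro!: continuous_intros)
  have FTC: "has_bochner_integral lborel (\<lambda>x. h (x, y) * indicator {m..level_x e y} x) (g (level_x e y, y) - g (m, y))"
    if "e \<in> ?A" for e
    by (rule has_bochner_integral_FTC_Icc_real) (use m(2)[OF that] g hc[of UNIV] in \<open>auto simp: continuous_on_eq_continuous_at\<close>)
  have "(\<integral>x. indicator S (x, y) * h (x, y) \<partial>lborel) =
    (\<integral>x. (\<Sum>e\<in>?A. sgn (fst (N e)) * (h (x, y) * indicator {m..level_x e y} x)) \<partial>lborel)"
  proof (rule integral_cong_AE)
    have "h \<in> borel_measurable borel" using h by (rule borel_measurable_continuous_onI)
    then have [measurable]: "(\<lambda>x. h (x, y)) \<in> borel_measurable borel" by measurable
    have [measurable]: "S \<in> sets borel" using compact_S by (simp add: borel_compact)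
    show "(\<lambda>x. indicator S (x, y) * h (x, y)) \<in> borel_measurable lborel" by measurable
    show "(\<lambda>x. (\<Sum>e\<in>?A. sgn (fst (N e)) * (h (x, y) * indicator {m..level_x e y} x))) \<in> borel_measurable lborel"
      by measurable
    \<comment> \<open>At the end of an interval the closed interval and the half-line may disagree;
      these finitely many points are discarded.\<close>
    have "finite (insert m ((\<lambda>e. level_x e y) ` ?A))" using finite_crosses by simp
    then have "AE x in lborel. x \<notin> insert m ((\<lambda>e. level_x e y) ` ?A)"
      by (intro AE_not_in finite_imp_null_set_lborel)
    then show "AE x in lborel. indicator S (x, y) * h (x, y) =
      (\<Sum>e\<in>?A. sgn (fst (N e)) * (h (x, y) * indicator {m..level_x e y} x))"
    proof eventually_elim
      case (elim x)
      show ?case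
      proof (cases "x < m")
        case True
        then show ?thesis using out[of x] by (simp add: indicator_def)
      next
        case False
        have "indicator S (x, y) * h (x, y) = (\<Sum>e\<in>?A. jump e y x * h (x, y))"
          unfolding indicator_slice[OF y] by (simp add: sum_distrib_right)
        also have "\<dots> = (\<Sum>e\<in>?A. sgn (fst (N e)) * (h (x, y) * indicator {m..level_x e y} x))"
          by (intro sum.cong) (use False elim in \<open>auto simp: jump_def indicator_def\<close>)
        finally show ?thesis .
      qed
    qed
  qed
  also have "\<dots> = (\<Sum>e\<in>?A. sgn (fst (N e)) * (g (level_x e y, y) - g (m, y)))"
    by (intro has_bochner_integral_integral_eq has_bochner_integral_sum has_bochner_integral_mult_right FTC)
  also have "\<dots> = (\<Sum>e\<in>?A. sgn (fst (N e)) * g (level_x e y, y)) - (\<Sum>e\<in>?A. sgn (fst (N e))) * g (m, y)"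
    by (simp add: sum_subtractf right_diff_distrib sum_distrib_right)
  finally show ?thesis using s0 by simp
qed

text \<open>Height is related to the edge parameter by an affine map whose Jacobian is length times
  the absolute first normal component; the sign from the slice turns this into the component itself.
  A horizontal edge gives zero on both sides.\<close>

lemma has_integral_crossing:
  fixes g :: "point \<Rightarrow> real"
  assumes g: "continuous_on UNIV g" and e: "(a, b) \<in> E"
  shows "has_bochner_integral lborel
    (\<lambda>y. if crosses (a, b) y then sgn (fst (N (a, b))) * g (level_x (a, b) y, y) else 0)
    (dist a b * (LINT t:{0..1}|lborel. g (linepath a b t)) * fst (N (a, b)))"
proof (cases "snd a = snd b")
  case True
  then have "\<not> crosses (a, b) y" for y by (simp add: crosses_def)
  moreover have "fst (N (a, b)) = 0" using normal_facts[OF e] True nondeg[OF e] by simp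
  ultimately show ?thesis by (simp add: has_bochner_integral_zero)
next
  case False
  define c where "c = snd b - snd a"
  have c: "c \<noteq> 0" using False by (simp add: c_def)
  let ?F = "\<lambda>y. if crosses (a, b) y then sgn (fst (N (a, b))) * g (level_x (a, b) y, y) else 0"
  have cr: "crosses (a, b) (snd a + c * t) \<longleftrightarrow> 0 < t \<and> t < 1" for t
  proof -
    have "snd b = snd a + c" by (simp add: c_def)
    then show ?thesis using c
      by (cases "c > 0") (auto simp: crosses_def open_segment_eq_real_ivl zero_less_mult_iff mult_less_0_iff
          mult_less_cancel_left1 mult_less_cancel_left2)
  qed
  have lp: "(level_x (a, b) (snd a + c * t), snd a + c * t) = linepath a b t" for t
    using c by (simp add: level_x_def c_def[symmetric] linepath_def prod_eq_iff algebra_simps)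
       (simp add: c_def algebra_simps)
  have F: "?F (snd a + c * t) = sgn (fst (N (a, b))) * (indicator {0<..<1} t * g (linepath a b t))" for t
    by (simp add: cr lp)
  have gl: "continuous_on UNIV (\<lambda>t. g (linepath a b t))"
    by (rule continuous_on_compose2[OF g]) (auto intro!: continuous_intros)
  have i1: "integrable lborel (\<lambda>t. indicator {0..1} t *\<^sub>R g (linepath a b t))"
    using continuous_on_subset[OF gl] by (intro borel_integrable_compact) auto
  have [measurable]: "(\<lambda>t. g (linepath a b t)) \<in> borel_measurable borel"
    using gl by (rule borel_measurable_continuous_onI)
  have ae: "AE t in lborel. indicator {0..1} t *\<^sub>R g (linepath a b t) = indicator {0<..<1} t * g (linepath a b t)"
  proof -
    have "AE t in lborel. t \<notin> {0, 1::real}" by (intro AE_not_in finite_imp_null_set_lborel) simp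
    then show ?thesis by eventually_elim (auto simp: indicator_def)
  qed
  have i2: "integrable lborel (\<lambda>t. indicator {0<..<1} t * g (linepath a b t))"
    by (rule integrable_cong_AE_imp[OF i1]) (use ae in auto)
  have eq: "(\<integral>t. indicator {0<..<1} t * g (linepath a b t) \<partial>lborel) = (LINT t:{0..1}|lborel. g (linepath a b t))"
    unfolding set_lebesgue_integral_def by (rule integral_cong_AE) (use ae in auto)
  have "integrable lborel ?F"
    using lborel_integrable_real_affine_iff[OF c, of ?F "snd a"] i2 unfolding F by simp
  moreover have "integral\<^sup>L lborel ?F = dist a b * (LINT t:{0..1}|lborel. g (linepath a b t)) * fst (N (a, b))"
  proof -
    have "integral\<^sup>L lborel ?F = \<bar>c\<bar> * (sgn (fst (N (a, b))) * (LINT t:{0..1}|lborel. g (linepath a b t)))"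
      using lborel_integral_real_affine[OF c, of ?F "snd a"] unfolding F by (simp add: eq)
    also have "\<bar>c\<bar> = dist a b * \<bar>fst (N (a, b))\<bar>" using normal_facts[OF e] by (simp add: c_def)
    finally show ?thesis by (simp add: mult_sgn_abs mult.assoc mult.left_commute)
       (metis abs_mult_sgn mult.commute mult.left_commute)
  qed
  ultimately show ?thesis by (simp add: has_bochner_integral_iff)
qed

theorem divergence_x:
  fixes g h :: "point \<Rightarrow> real"
  assumes g: "\<And>x y. ((\<lambda>s. g (s, y)) has_real_derivative h (x, y)) (at x)"
    and gc: "continuous_on UNIV g" and h: "continuous_on UNIV h"
  shows "(LINT z:S|lborel. h z) =
    (\<Sum>(a, b)\<in>E. dist a b * (LINT t:{0..1}|lborel. g (linepath a b t)) * fst (N (a, b)))"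
proof -
  have "integrable lborel (\<lambda>z. indicator S z *\<^sub>R h z)"
    using continuous_on_subset[OF h] by (intro borel_integrable_compact compact_S) auto
  then have i: "integrable (lborel \<Otimes>\<^sub>M lborel) (case_prod (\<lambda>x y. indicator S (x, y) * h (x, y)))"
    by (simp add: lborel_prod split_def)
  have "(LINT z:S|lborel. h z) = integral\<^sup>L (lborel \<Otimes>\<^sub>M lborel) (case_prod (\<lambda>x y. indicator S (x, y) * h (x, y)))"
    by (simp add: lborel_prod split_def set_lebesgue_integral_def)
  also have "\<dots> = (\<integral>y. (\<integral>x. indicator S (x, y) * h (x, y) \<partial>lborel) \<partial>lborel)"
    by (rule lborel_pair.integral_snd[OF i, symmetric])
  also have "\<dots> = (\<integral>y. (\<Sum>e\<in>E. if crosses e y then sgn (fst (N e)) * g (level_x e y, y) else 0) \<partial>lborel)"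
  proof (rule integral_cong_AE)
    show "(\<lambda>y. \<integral>x. indicator S (x, y) * h (x, y) \<partial>lborel) \<in> borel_measurable lborel"
      using lborel_pair.integrable_snd[OF i] by simp
    show "(\<lambda>y. \<Sum>e\<in>E. if crosses e y then sgn (fst (N e)) * g (level_x e y, y) else 0) \<in> borel_measurable lborel"
      using has_integral_crossing[OF gc]
      by (intro borel_measurable_sum) (force simp: has_bochner_integral_iff)
    \<comment> \<open>The slice formula may fail on lines through vertices, which occur at finitely
      many heights only.\<close>
    have "AE y in lborel. y \<notin> snd ` (fst ` E \<union> snd ` E)"
      using finite_E by (intro AE_not_in finite_imp_null_set_lborel) simp
    then show "AE y in lborel. (\<integral>x. indicator S (x, y) * h (x, y) \<partial>lborel) =
      (\<Sum>e\<in>E. if crosses e y then sgn (fst (N e)) * g (level_x e y, y) else 0)"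
    proof eventually_elim
      case (elim y)
      show ?case using integral_slice[OF elim g h] finite_E by (simp add: sum.inter_filter)
    qed
  qed
  also have "\<dots> = (\<Sum>e\<in>E. case e of (a, b) \<Rightarrow> dist a b * (LINT t:{0..1}|lborel. g (linepath a b t)) * fst (N (a, b)))"
  proof (intro has_bochner_integral_integral_eq has_bochner_integral_sum)
    fix e assume "e \<in> E"
    then show "has_bochner_integral lborel
      (\<lambda>y. if crosses e y then sgn (fst (N e)) * g (level_x e y, y) else 0)
      (case e of (a, b) \<Rightarrow> dist a b * (LINT t:{0..1}|lborel. g (linepath a b t)) * fst (N (a, b)))"
      using has_integral_crossing[OF gc, of "fst e" "snd e"] by (simp add: split_def cong: if_cong)
  qed
  finally show ?thesis .
qed

end

section \<open>Exchanging the coordinates\<close>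

lemma linear_swap: "linear (prod.swap :: point \<Rightarrow> point)"
  by (auto simp: linear_iff)

lemma norm_swap: "norm (prod.swap x :: point) = norm x"
  by (simp add: norm_prod_def add.commute)

lemma inner_swap: "prod.swap x \<bullet> (prod.swap y :: point) = x \<bullet> y"
  by (simp add: inner_prod_def add.commute)

lemma swap_diff: "prod.swap x - prod.swap y = (prod.swap (x - y) :: point)"
  by (simp add: prod_eq_iff)

lemma dist_swap: "dist (prod.swap x) (prod.swap y :: point) = dist x y"
  by (simp add: dist_norm swap_diff norm_swap)

lemma half_plane_at_swap:
  assumes "half_plane_at S x n"
  shows "half_plane_at (prod.swap ` S) (prod.swap x) (prod.swap n)"
proof -
  obtain r where r: "r > 0" "\<And>y. y \<in> ball x r \<Longrightarrow> y \<in> S \<longleftrightarrow> (y - x) \<bullet> n \<le> 0" and n: "norm n = 1"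
    using assms unfolding half_plane_at_def by blast
  have "y \<in> prod.swap ` S \<longleftrightarrow> (y - prod.swap x) \<bullet> prod.swap n \<le> 0" if "y \<in> ball (prod.swap x) r" for y
  proof -
    define z where "z = prod.swap y"
    have y: "y = prod.swap z" by (simp add: z_def)
    have "z \<in> ball x r" using that unfolding y by (simp only: mem_ball dist_swap)
    moreover have "y \<in> prod.swap ` S \<longleftrightarrow> z \<in> S" unfolding y by (metis image_iff swap_swap)
    ultimately show ?thesis using r(2)[of z] unfolding y swap_diff inner_swap by simp
  qed
  then show ?thesis using r(1) n unfolding half_plane_at_def norm_swap by blast
qed

lemma linepath_swap: "linepath (prod.swap a) (prod.swap b) t = (prod.swap (linepath a b t) :: point)"
  by (simp add: linepath_def prod_eq_iff)

lemma closed_segment_swap: "closed_segment (prod.swap a) (prod.swap b) = (prod.swap ` closed_segment a b :: point set)"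
  by (rule closed_segment_linear_image[OF linear_swap])

lemma open_segment_swap: "open_segment (prod.swap a) (prod.swap b) = (prod.swap ` open_segment a b :: point set)"
  by (rule open_segment_linear_image[OF linear_swap]) simp

text \<open>Lebesgue measure on pairs is a product of equal factors and so is invariant under
  exchanging them.\<close>

lemma set_integral_swap:
  fixes h :: "point \<Rightarrow> real"
  assumes [measurable]: "h \<in> borel_measurable borel" "S \<in> sets borel"
  shows "(LINT z:prod.swap ` S|lborel. h (prod.swap z)) = (LINT z:S|lborel. h z)"
proof -
  let ?f = "\<lambda>z. indicator S z *\<^sub>R h z"
  have "?f \<in> borel_measurable borel" by measurable
  then have m: "?f \<in> borel_measurable (lborel \<Otimes>\<^sub>M lborel)" unfolding lborel_prod by simp
  have "(LINT z:prod.swap ` S|lborel. h (prod.swap z)) = (\<integral>z. ?f (prod.swap z) \<partial>(lborel :: point measure))"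
    unfolding set_lebesgue_integral_def
  proof (intro Bochner_Integration.integral_cong refl)
    fix z :: point
    have "z \<in> prod.swap ` S \<longleftrightarrow> prod.swap z \<in> S" by (metis image_iff swap_swap)
    then show "indicator (prod.swap ` S) z *\<^sub>R h (prod.swap z) = ?f (prod.swap z)" by (simp add: indicator_def)
  qed
  also have "\<dots> = (\<integral>(x, y). ?f (y, x) \<partial>(lborel \<Otimes>\<^sub>M lborel))"
    unfolding lborel_prod by (simp add: split_def prod.swap_def)
  also have "\<dots> = integral\<^sup>L (lborel \<Otimes>\<^sub>M lborel) ?f"
    by (rule lborel_pair.integral_product_swap[OF m])
  also have "\<dots> = (LINT z:S|lborel. h z)" unfolding lborel_prod set_lebesgue_integral_def ..
  finally show ?thesis .
qed

text \<open>Reflection in the diagonal is an isometry, so it maps half-planes to half-planes and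
  reflects their normals. As \<open>N\<close> is a function of the original edge, the reflected edge
  is reflected back before \<open>N\<close> is applied.\<close>

lemma (in polygonal_region) polygonal_region_swap:
  "polygonal_region (prod.swap ` S) (map_prod prod.swap prod.swap ` E)
     (\<lambda>e. prod.swap (N (map_prod prod.swap prod.swap e)))"
proof
  have fr: "frontier (prod.swap ` S) = prod.swap ` frontier S"
    by (simp add: frontier_def interior_bijective_linear_image[OF linear_swap bij_swap]
        closure_injective_linear_image[OF linear_swap bij_is_inj[OF bij_swap], symmetric] image_set_diff)
  show "compact (prod.swap ` S)"
    using compact_S by (intro compact_continuous_image) (auto simp: prod.swap_def intro!: continuous_intros)
  show "finite (map_prod prod.swap prod.swap ` E)" using finite_E by simp
  show "frontier (prod.swap ` S) \<subseteq> (\<Union>(a, b)\<in>map_prod prod.swap prod.swap ` E. closed_segment a b)"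
  proof -
    have "prod.swap ` frontier S \<subseteq> prod.swap ` (\<Union>(a, b)\<in>E. closed_segment a b)"
      using frontier_S by (rule image_mono)
    also have "\<dots> = (\<Union>(a, b)\<in>map_prod prod.swap prod.swap ` E. closed_segment a b)"
      unfolding image_UN SUP_image
      by (intro SUP_cong refl) (simp only: split_def comp_def map_prod_def fst_conv snd_conv closed_segment_swap)
    finally show ?thesis unfolding fr .
  qed
  fix a b assume "(a, b) \<in> map_prod prod.swap prod.swap ` E"
  then obtain a0 b0 where 0: "(a0, b0) \<in> E" "a = prod.swap a0" "b = prod.swap b0" by auto
  show "a \<noteq> b" using nondeg[OF 0(1)] 0 by (metis swap_swap)
  show "prod.swap (N (map_prod prod.swap prod.swap (a, b))) \<bullet> (b - a) = 0"
    using perp[OF 0(1)] by (simp only: 0 map_prod_simp swap_swap swap_diff inner_swap)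
  show "half_plane_at (prod.swap ` S) x (prod.swap (N (map_prod prod.swap prod.swap (a, b))))"
    if x: "x \<in> open_segment a b" for x
  proof -
    obtain x0 where "x = prod.swap x0" "x0 \<in> open_segment a0 b0"
      using x unfolding 0 open_segment_swap by blast
    then show ?thesis using half_plane_at_swap[OF half_plane[OF 0(1)]] by (simp only: 0 map_prod_simp swap_swap)
  qed
  fix a' b' assume "(a', b') \<in> map_prod prod.swap prod.swap ` E" and ne: "(a, b) \<noteq> (a', b')"
  then obtain a1 b1 where 1: "(a1, b1) \<in> E" "a' = prod.swap a1" "b' = prod.swap b1" by auto
  have "(a0, b0) \<noteq> (a1, b1)" using ne 0 1 by auto
  then have "open_segment a0 b0 \<inter> closed_segment a1 b1 = {}" using disj 0 1 by blast
  then show "open_segment a b \<inter> closed_segment a' b' = {}"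
    unfolding 0 1 open_segment_swap closed_segment_swap by (metis image_Int image_empty inj_swap)
qed

text \<open>This is the horizontal theorem for the reflected region, whose first normal component is
  the second one of the original region.\<close>

theorem (in polygonal_region) divergence_y:
  fixes g h :: "point \<Rightarrow> real"
  assumes g: "\<And>x y. ((\<lambda>s. g (x, s)) has_real_derivative h (x, y)) (at y)"
    and gc: "continuous_on UNIV g" and h: "continuous_on UNIV h"
  shows "(LINT z:S|lborel. h z) =
    (\<Sum>(a, b)\<in>E. dist a b * (LINT t:{0..1}|lborel. g (linepath a b t)) * snd (N (a, b)))"
proof -
  interpret sw: polygonal_region "prod.swap ` S" "map_prod prod.swap prod.swap ` E"
    "\<lambda>e. prod.swap (N (map_prod prod.swap prod.swap e))" by (rule polygonal_region_swap)
  have hm: "h \<in> borel_measurable borel" using h by (rule borel_measurable_continuous_onI)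
  have Sm: "S \<in> sets borel" using compact_S by (rule borel_compact)
  have inj: "inj_on (map_prod prod.swap prod.swap) E" by (auto simp: inj_on_def)
  have sc: "continuous_on UNIV (prod.swap :: point \<Rightarrow> point)" by (auto simp: prod.swap_def intro!: continuous_intros)
  have "(LINT z:S|lborel. h z) = (LINT z:prod.swap ` S|lborel. h (prod.swap z))"
    by (rule set_integral_swap[OF hm Sm, symmetric])
  also have "\<dots> = (\<Sum>(a, b)\<in>map_prod prod.swap prod.swap ` E. dist a b *
      (LINT t:{0..1}|lborel. g (prod.swap (linepath a b t))) * fst (prod.swap (N (map_prod prod.swap prod.swap (a, b)))))"
    by (rule sw.divergence_x) (use g continuous_on_compose2[OF gc sc] continuous_on_compose2[OF h sc] in auto)
  also have "\<dots> = (\<Sum>(a, b)\<in>E. dist a b * (LINT t:{0..1}|lborel. g (linepath a b t)) * snd (N (a, b)))"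
    unfolding sum.reindex[OF inj]
    by (intro sum.cong refl) (simp only: split_def comp_def map_prod_def fst_conv snd_conv dist_swap linepath_swap swap_swap fst_swap prod.collapse)
  finally show ?thesis .
qed

section \<open>Quadrilaterals as polygonal regions\<close>

lemma edges_nondeg: "is_quad K \<Longrightarrow> (a, b) \<in> edges K \<Longrightarrow> a \<noteq> b"
  using is_quad_distinct by (cases K) auto

lemma finite_edges: "finite (edges K)" by (cases K) auto

text \<open>The midpoint represents the interior of the edge. This gives one vector for the whole
  edge, whereas \<open>nrm K\<close> is controlled only away from the vertices.\<close>

definition edge_normal :: "quad \<Rightarrow> point \<times> point \<Rightarrow> point" where
  "edge_normal K e = nrm K (midpoint (fst e) (snd e))"

lemma half_plane_at_edge_normal:
  assumes "is_quad K" "(a, b) \<in> edges K"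
  shows "edge_normal K (a, b) \<bullet> (b - a) = 0"
    and "x \<in> open_segment a b \<Longrightarrow> half_plane_at (cell K) x (edge_normal K (a, b))"
proof -
  obtain n where n: "n \<bullet> (b - a) = 0" "\<And>x. x \<in> open_segment a b \<Longrightarrow> half_plane_at (cell K) x n"
    using half_plane_at_edge_const[OF assms] by blast
  have "midpoint a b \<in> open_segment a b" using edges_nondeg[OF assms] by simp
  then have "edge_normal K (a, b) = n" using outward_normal_eq[OF n(2)] by (simp add: edge_normal_def)
  then show "edge_normal K (a, b) \<bullet> (b - a) = 0"
    "x \<in> open_segment a b \<Longrightarrow> half_plane_at (cell K) x (edge_normal K (a, b))" using n by auto
qed

lemma nrm_on_edge: "is_quad K \<Longrightarrow> (a, b) \<in> edges K \<Longrightarrow> x \<in> open_segment a b \<Longrightarrow> nrm K x = edge_normal K (a, b)"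
  by (rule outward_normal_eq[OF half_plane_at_edge_normal(2)])

lemma polygonal_region_cell:
  assumes "is_quad K" shows "polygonal_region (cell K) (edges K) (edge_normal K)"
proof
  show "frontier (cell K) \<subseteq> (\<Union>(a, b)\<in>edges K. closed_segment a b)"
    using frontier_cell_subset[OF assms] unfolding path_image_quad .
qed (use assms compact_cell finite_edges edges_nondeg half_plane_at_edge_normal quad_edges_disjoint in blast)+

section \<open>Edge integrals up to finitely many points\<close>

definition edge_int :: "point \<times> point \<Rightarrow> (point \<Rightarrow> real) \<Rightarrow> real" where
  "edge_int e f = dist (fst e) (snd e) * (LINT t:{0..1}|lborel. f (linepath (fst e) (snd e) t))"

text \<open>Bounded and measurable along the edge: unlike integrability, this is closed under products.\<close>

definition edge_adm :: "point \<times> point \<Rightarrow> (point \<Rightarrow> real) \<Rightarrow> bool" where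
  "edge_adm e f \<longleftrightarrow> set_borel_measurable lborel {0..1} (\<lambda>t. f (linepath (fst e) (snd e) t)) \<and>
     (\<exists>B. \<forall>t\<in>{0..1}. \<bar>f (linepath (fst e) (snd e) t)\<bar> \<le> B)"

lemma edge_adm_integrable:
  assumes "edge_adm e f"
  shows "set_integrable lborel {0..1} (\<lambda>t. f (linepath (fst e) (snd e) t))"
proof -
  obtain B where B: "\<And>t. t \<in> {0..1} \<Longrightarrow> \<bar>f (linepath (fst e) (snd e) t)\<bar> \<le> B"
    using assms unfolding edge_adm_def by blast
  have "integrable lborel (\<lambda>t. indicator {0..1::real} t *\<^sub>R B)"
    by (intro borel_integrable_compact) auto
  then show ?thesis unfolding set_integrable_def
    by (rule Bochner_Integration.integrable_bound)
      (use assms B in \<open>auto simp: edge_adm_def set_borel_measurable_def indicator_def intro!: AE_I2 order_trans[OF B]\<close>)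
qed

lemma edge_adm_const: "edge_adm e (\<lambda>x. c)"
  by (auto simp: edge_adm_def set_borel_measurable_def)

lemma edge_adm_borel:
  assumes "f \<in> borel_measurable borel" "bounded (f ` closed_segment (fst e) (snd e))"
  shows "edge_adm e f"
proof -
  have "(\<lambda>t. f (linepath (fst e) (snd e) t)) \<in> borel_measurable borel"
    using assms(1) by (rule measurable_compose[rotated])
      (auto intro!: borel_measurable_continuous_onI continuous_intros)
  moreover have "linepath (fst e) (snd e) t \<in> closed_segment (fst e) (snd e)" if "t \<in> {0..1}" for t
    using that by (auto simp: linepath_in_path)
  ultimately show ?thesis
    using assms(2) unfolding edge_adm_def set_borel_measurable_def bounded_iff ball_simps real_norm_def
    by (intro conjI) (simp, blast)
qed

lemma edge_adm_continuous:
  assumes "continuous_on UNIV f" shows "edge_adm e f"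
proof (rule edge_adm_borel)
  show "f \<in> borel_measurable borel" using assms by (rule borel_measurable_continuous_onI)
  show "bounded (f ` closed_segment (fst e) (snd e))"
    using continuous_on_subset[OF assms] by (intro compact_imp_bounded compact_continuous_image) auto
qed

lemma edge_adm_add:
  assumes "edge_adm e f" "edge_adm e g" shows "edge_adm e (\<lambda>x. f x + g x)"
proof -
  obtain B C where "\<And>t. t \<in> {0..1} \<Longrightarrow> \<bar>f (linepath (fst e) (snd e) t)\<bar> \<le> B"
    "\<And>t. t \<in> {0..1} \<Longrightarrow> \<bar>g (linepath (fst e) (snd e) t)\<bar> \<le> C"
    using assms unfolding edge_adm_def by blast
  then have "\<bar>f (linepath (fst e) (snd e) t) + g (linepath (fst e) (snd e) t)\<bar> \<le> B + C" if "t \<in> {0..1}" for t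
    using that by (smt (verit))
  then show ?thesis using assms unfolding edge_adm_def set_borel_measurable_def scaleR_add_right
    by (intro conjI borel_measurable_add) (simp, simp, blast)
qed

lemma edge_adm_mult:
  assumes "edge_adm e f" "edge_adm e g" shows "edge_adm e (\<lambda>x. f x * g x)"
proof -
  let ?p = "linepath (fst e) (snd e)"
  obtain B C where B: "\<And>t. t \<in> {0..1} \<Longrightarrow> \<bar>f (?p t)\<bar> \<le> B"
    "\<And>t. t \<in> {0..1} \<Longrightarrow> \<bar>g (?p t)\<bar> \<le> C"
    using assms unfolding edge_adm_def by blast
  have "\<bar>f (?p t) * g (?p t)\<bar> \<le> B * C" if "t \<in> {0..1}" for t
    using B[OF that] unfolding abs_mult by (intro mult_mono) auto
  moreover have eq: "(\<lambda>t. indicator {0..1} t *\<^sub>R (f (?p t) * g (?p t))) =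
    (\<lambda>t. (indicator {0..1} t *\<^sub>R f (?p t)) * (indicator {0..1} t *\<^sub>R g (?p t)))"
    by (auto simp: indicator_def)
  have "set_borel_measurable lborel {0..1} (\<lambda>t. f (?p t) * g (?p t))"
    using assms unfolding edge_adm_def set_borel_measurable_def eq by (intro borel_measurable_times) simp_all
  ultimately show ?thesis unfolding edge_adm_def by blast
qed

lemma edge_adm_minus: "edge_adm e f \<Longrightarrow> edge_adm e (\<lambda>x. - f x)"
  using edge_adm_mult[OF edge_adm_const[of e "-1"]] by simp

lemma edge_adm_diff: "edge_adm e f \<Longrightarrow> edge_adm e g \<Longrightarrow> edge_adm e (\<lambda>x. f x - g x)"
  using edge_adm_add[OF _ edge_adm_minus] by simp

lemma edge_adm_power2: "edge_adm e f \<Longrightarrow> edge_adm e (\<lambda>x. (f x)\<^sup>2)"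
  unfolding power2_eq_square by (rule edge_adm_mult)

lemma edge_adm_sum: "(\<And>i. i \<in> I \<Longrightarrow> edge_adm e (f i)) \<Longrightarrow> edge_adm e (\<lambda>x. \<Sum>i\<in>I. f i x)"
  by (induction I rule: infinite_finite_induct) (auto intro: edge_adm_add edge_adm_const)

lemmas edge_adm_intros = edge_adm_const edge_adm_add edge_adm_mult edge_adm_minus edge_adm_diff
  edge_adm_power2 edge_adm_sum

lemma finite_linepath_vimage:
  assumes "fst e \<noteq> snd e" "finite V"
  shows "finite {t. linepath (fst e) (snd e) t \<in> V}"
proof -
  have "inj (linepath (fst e) (snd e))"
  proof (rule injI)
    fix s t assume "linepath (fst e) (snd e) s = linepath (fst e) (snd e) t"
    then have "(s - t) *\<^sub>R (snd e - fst e) = 0" by (simp add: linepath_def algebra_simps)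
    then show "s = t" using assms(1) by auto
  qed
  then show ?thesis using finite_vimageI[OF assms(2)] by (simp add: vimage_def)
qed

lemma linepath_in_segment: "t \<in> {0..1} \<Longrightarrow> linepath a b t \<in> closed_segment a b"
  by (auto simp: linepath_in_path)

text \<open>The changed function is the old one plus finitely many multiples of indicators of single
  parameters, which are Borel; the new values merely enlarge the bound. This makes traces admissible
  whose values at the vertices are unknown.\<close>

lemma edge_adm_cong:
  assumes "fst e \<noteq> snd e" "finite V" "edge_adm e g"
    and eq: "\<And>x. x \<in> closed_segment (fst e) (snd e) - V \<Longrightarrow> f x = g x"
  shows "edge_adm e f"
proof -
  let ?p = "linepath (fst e) (snd e)"
  define W where "W = {t. ?p t \<in> V}"
  have W: "finite W" unfolding W_def by (rule finite_linepath_vimage[OF assms(1,2)])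
  have eq': "f (?p t) = g (?p t)" if "t \<in> {0..1}" "t \<notin> W" for t
    using eq[of "?p t"] that linepath_in_segment by (auto simp: W_def)
  have "(\<lambda>t. indicator {0..1} t *\<^sub>R g (?p t)) \<in> borel_measurable borel"
    using assms(3) by (simp add: edge_adm_def set_borel_measurable_def)
  moreover have "(\<lambda>t. indicator {0..1} t *\<^sub>R f (?p t)) =
     (\<lambda>t. indicator {0..1} t *\<^sub>R g (?p t) + (\<Sum>s\<in>W. indicator {s} t * (indicator {0..1} s *\<^sub>R (f (?p s) - g (?p s)))))"
  proof
    fix t
    have "(\<Sum>s\<in>W. indicator {s} t * (indicator {0..1} s *\<^sub>R (f (?p s) - g (?p s)))) =
      (if t \<in> W then indicator {0..1} t *\<^sub>R (f (?p t) - g (?p t)) else 0)"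
      using W by (simp add: indicator_def sum.delta if_distrib[of "\<lambda>x. x * _"] cong: if_cong)
    then show "indicator {0..1} t *\<^sub>R f (?p t) =
     indicator {0..1} t *\<^sub>R g (?p t) + (\<Sum>s\<in>W. indicator {s} t * (indicator {0..1} s *\<^sub>R (f (?p s) - g (?p s))))"
      using eq'[of t] by (auto simp: indicator_def)
  qed
  ultimately have m: "set_borel_measurable lborel {0..1} (\<lambda>t. f (?p t))"
    unfolding set_borel_measurable_def by simp
  obtain B where B: "\<And>t. t \<in> {0..1} \<Longrightarrow> \<bar>g (?p t)\<bar> \<le> B" using assms(3) unfolding edge_adm_def by blast
  have "\<bar>f (?p t)\<bar> \<le> \<bar>B\<bar> + (\<Sum>s\<in>W. \<bar>f (?p s)\<bar>)" if t: "t \<in> {0..1}" for t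
  proof (cases "t \<in> W")
    case True
    then have "\<bar>f (?p t)\<bar> \<le> (\<Sum>s\<in>W. \<bar>f (?p s)\<bar>)" using W by (intro member_le_sum) auto
    then show ?thesis by simp
  next
    case False
    then have "\<bar>f (?p t)\<bar> \<le> \<bar>B\<bar>" using eq' B[OF t] t by force
    moreover have "0 \<le> (\<Sum>s\<in>W. \<bar>f (?p s)\<bar>)" by (intro sum_nonneg) auto
    ultimately show ?thesis by linarith
  qed
  with m show ?thesis unfolding edge_adm_def by blast
qed

lemma edge_int_mono:
  assumes "fst e \<noteq> snd e" "finite V" "edge_adm e f" "edge_adm e g"
    and le: "\<And>x. x \<in> closed_segment (fst e) (snd e) - V \<Longrightarrow> f x \<le> g x"
  shows "edge_int e f \<le> edge_int e g"
  unfolding edge_int_def set_lebesgue_integral_def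
proof (intro mult_left_mono integral_mono_AE)
  let ?p = "linepath (fst e) (snd e)"
  show "integrable lborel (\<lambda>t. indicator {0..1} t *\<^sub>R f (?p t))" "integrable lborel (\<lambda>t. indicator {0..1} t *\<^sub>R g (?p t))"
    using edge_adm_integrable[OF assms(3)] edge_adm_integrable[OF assms(4)] unfolding set_integrable_def by auto
  have "AE t in lborel. t \<notin> {t. ?p t \<in> V}"
    by (intro AE_not_in finite_imp_null_set_lborel finite_linepath_vimage assms)
  then show "AE t in lborel. indicator {0..1} t *\<^sub>R f (?p t) \<le> indicator {0..1} t *\<^sub>R g (?p t)"
  proof eventually_elim
    case (elim t)
    show ?case
    proof (cases "t \<in> {0..1}")
      case True
      then have "?p t \<in> closed_segment (fst e) (snd e) - V" using elim linepath_in_segment by blast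
      then show ?thesis using le by (simp add: mult_left_mono)
    qed simp
  qed
qed simp

lemma edge_int_cong:
  assumes "fst e \<noteq> snd e" "finite V" "edge_adm e g"
    and eq: "\<And>x. x \<in> closed_segment (fst e) (snd e) - V \<Longrightarrow> f x = g x"
  shows "edge_int e f = edge_int e g"
  using edge_adm_cong[OF assms(1-3) eq]
  by (intro antisym edge_int_mono[OF assms(1,2)]) (use assms in auto)

lemma edge_int_nonneg:
  assumes "\<And>x. x \<in> closed_segment (fst e) (snd e) \<Longrightarrow> 0 \<le> f x"
  shows "0 \<le> edge_int e f"
proof -
  have "0 \<le> indicator {0..1} t *\<^sub>R f (linepath (fst e) (snd e) t)" for t
    by (cases "t \<in> {0..1}") (use assms[OF linepath_in_segment] in simp_all)
  then show ?thesis unfolding edge_int_def set_lebesgue_integral_def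
    by (intro mult_nonneg_nonneg integral_nonneg_AE AE_I2) auto
qed

lemma edge_int_add: "edge_adm e f \<Longrightarrow> edge_adm e g \<Longrightarrow> edge_int e (\<lambda>x. f x + g x) = edge_int e f + edge_int e g"
  by (simp add: edge_int_def edge_adm_integrable set_integral_add algebra_simps)

lemma edge_int_diff: "edge_adm e f \<Longrightarrow> edge_adm e g \<Longrightarrow> edge_int e (\<lambda>x. f x - g x) = edge_int e f - edge_int e g"
  by (simp add: edge_int_def edge_adm_integrable set_integral_diff algebra_simps)

lemma edge_int_cmult: "edge_int e (\<lambda>x. c * f x) = c * edge_int e f"
  by (simp add: edge_int_def)

lemma edge_int_sum:
  "(\<And>i. i \<in> I \<Longrightarrow> edge_adm e (f i)) \<Longrightarrow> edge_int e (\<lambda>x. \<Sum>i\<in>I. f i x) = (\<Sum>i\<in>I. edge_int e (f i))"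
proof (induction I rule: infinite_finite_induct)
  case (insert i I)
  then show ?case by (simp add: edge_int_add edge_adm_sum)
qed (auto simp: edge_int_def)

section \<open>Traces from neighbouring elements\<close>

abbreviation seg :: "point \<times> point \<Rightarrow> point set" where
  "seg e \<equiv> closed_segment (fst e) (snd e)"

lemma affine_in_closed_segment:
  fixes s1 s2 t :: real
  assumes "s1 \<noteq> s2"
  shows "s1 + (s2 - s1) * t \<in> closed_segment s1 s2 \<longleftrightarrow> t \<in> {0..1}"
proof
  assume "s1 + (s2 - s1) * t \<in> closed_segment s1 s2"
  then obtain u where u: "0 \<le> u" "u \<le> 1" "s1 + (s2 - s1) * t = (1 - u) * s1 + u * s2"
    by (auto simp: in_segment)
  then have "(s2 - s1) * t = (s2 - s1) * u" by (simp add: algebra_simps)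
  then show "t \<in> {0..1}" using assms u by simp
qed (auto simp: in_segment algebra_simps)

lemma line_in_closed_segment:
  fixes \<tau> :: "'a::real_vector"
  assumes "\<tau> \<noteq> 0"
  shows "p + s *\<^sub>R \<tau> \<in> closed_segment (p + s1 *\<^sub>R \<tau>) (p + s2 *\<^sub>R \<tau>) \<longleftrightarrow> s \<in> closed_segment s1 s2"
proof -
  have "(p + s *\<^sub>R \<tau> = (1 - u) *\<^sub>R (p + s1 *\<^sub>R \<tau>) + u *\<^sub>R (p + s2 *\<^sub>R \<tau>)) \<longleftrightarrow> s = (1 - u) * s1 + u * s2" for u
  proof -
    have "(1 - u) *\<^sub>R (p + s1 *\<^sub>R \<tau>) + u *\<^sub>R (p + s2 *\<^sub>R \<tau>) = p + ((1 - u) * s1 + u * s2) *\<^sub>R \<tau>"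
      by (simp add: algebra_simps)
    then show ?thesis using assms by simp
  qed
  then show ?thesis by (simp add: in_segment)
qed

text \<open>Position on a line with unit direction \<open>\<tau>\<close> as parameter: length and
  orientation of the edge survive only in the indicator of an interval, so that edges on the same
  line become comparable.\<close>

lemma edge_int_line:
  fixes \<tau> :: point
  assumes "norm \<tau> = 1" "s1 \<noteq> s2"
  shows "edge_int (p + s1 *\<^sub>R \<tau>, p + s2 *\<^sub>R \<tau>) F =
    (\<integral>s. indicator (closed_segment s1 s2) s * F (p + s *\<^sub>R \<tau>) \<partial>lborel)"
proof -
  have d: "dist (p + s1 *\<^sub>R \<tau>) (p + s2 *\<^sub>R \<tau>) = \<bar>s2 - s1\<bar>"
    using assms(1) by (simp add: dist_norm flip: scaleR_diff_left)
  have l: "linepath (p + s1 *\<^sub>R \<tau>) (p + s2 *\<^sub>R \<tau>) t = p + (s1 + (s2 - s1) * t) *\<^sub>R \<tau>" for t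
    by (simp add: linepath_def algebra_simps)
  have "(\<integral>s. indicator (closed_segment s1 s2) s * F (p + s *\<^sub>R \<tau>) \<partial>lborel) =
    \<bar>s2 - s1\<bar> *\<^sub>R (\<integral>t. indicator (closed_segment s1 s2) (s1 + (s2 - s1) * t) * F (p + (s1 + (s2 - s1) * t) *\<^sub>R \<tau>) \<partial>lborel)"
    using assms(2) by (intro lborel_integral_real_affine) simp
  also have "\<dots> = \<bar>s2 - s1\<bar> * (\<integral>t. indicator {0..1} t *\<^sub>R F (p + (s1 + (s2 - s1) * t) *\<^sub>R \<tau>) \<partial>lborel)"
    using affine_in_closed_segment[OF assms(2)] by (simp add: indicator_def)
  finally show ?thesis unfolding edge_int_def fst_conv snd_conv d l set_lebesgue_integral_def by simp
qed

text \<open>Both sides are the arc length integral of \<open>F\<close> over the intersection of the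
  segments. If this has at most one point, both vanish; otherwise the segments lie on one line, and
  both sides are the integral of \<open>F\<close> against the product of two interval indicators.
  Partial overlaps, as at hanging nodes, are covered.\<close>

lemma edge_int_overlap:
  assumes e: "fst e \<noteq> snd e" and e': "fst e' \<noteq> snd e'"
  shows "edge_int e (\<lambda>x. indicator (seg e') x * F x) = edge_int e' (\<lambda>x. indicator (seg e) x * F x)"
proof (cases "\<exists>x y. x \<noteq> y \<and> x \<in> seg e \<inter> seg e' \<and> y \<in> seg e \<inter> seg e'")
  case False
  then obtain x where x: "seg e \<inter> seg e' \<subseteq> {x}" by blast
  have "edge_int e (\<lambda>x. indicator (seg e') x * F x) = edge_int e (\<lambda>x. 0)"
    by (rule edge_int_cong[where V = "{x}"]) (use e x in \<open>auto simp: edge_adm_const indicator_def\<close>)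
  moreover have "edge_int e' (\<lambda>x. indicator (seg e) x * F x) = edge_int e' (\<lambda>x. 0)"
    by (rule edge_int_cong[where V = "{x}"]) (use e' x in \<open>auto simp: edge_adm_const indicator_def\<close>)
  moreover have "edge_int e (\<lambda>x. 0) = 0" for e by (simp add: edge_int_def)
  ultimately show ?thesis by simp
next
  case True
  then obtain x y where xy: "x \<noteq> y" "x \<in> seg e" "x \<in> seg e'" "y \<in> seg e" "y \<in> seg e'" by blast
  define \<tau> where "\<tau> = (y - x) /\<^sub>R norm (y - x)"
  have \<tau>: "norm \<tau> = 1" "\<tau> \<noteq> 0" using xy(1) by (simp_all add: \<tau>_def)
  \<comment> \<open>Any segment through \<open>x\<close> and \<open>y\<close> is described with the
    same base point \<open>x\<close> and direction \<open>\<tau>\<close>; its end points may come in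
    either order.\<close>
  have param: "\<exists>s1 s2. s1 \<noteq> s2 \<and> e = (x + s1 *\<^sub>R \<tau>, x + s2 *\<^sub>R \<tau>)"
    if "x \<in> seg e" "y \<in> seg e" "fst e \<noteq> snd e" for e :: "point \<times> point"
  proof -
    obtain s t where s: "x = fst e + s *\<^sub>R (snd e - fst e)" and t: "y = fst e + t *\<^sub>R (snd e - fst e)"
      using \<open>x \<in> seg e\<close> \<open>y \<in> seg e\<close> by (auto simp: in_segment algebra_simps)
    define d where "d = snd e - fst e"
    have yx: "y - x = (t - s) *\<^sub>R d" unfolding d_def s t by (simp add: scaleR_diff_left)
    then have ts: "t - s \<noteq> 0" using xy(1) by auto
    define k where "k = norm (y - x) / (t - s)"
    have k: "k \<noteq> 0" using ts xy(1) by (simp add: k_def)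
    have "k *\<^sub>R \<tau> = inverse (t - s) *\<^sub>R (y - x)" using xy(1) by (simp add: k_def \<tau>_def divide_inverse)
    then have d: "d = k *\<^sub>R \<tau>" using ts by (simp add: yx)
    have "fst e = x + (- s * k) *\<^sub>R \<tau>" "snd e = x + ((1 - s) * k) *\<^sub>R \<tau>"
      using s d by (simp_all add: d_def[symmetric] algebra_simps) (metis d d_def diff_add_cancel add.commute)
    moreover have "- s * k \<noteq> (1 - s) * k" using k by (simp add: algebra_simps)
    ultimately show ?thesis by (metis prod.collapse)
  qed
  obtain s1 s2 where s: "s1 \<noteq> s2" "e = (x + s1 *\<^sub>R \<tau>, x + s2 *\<^sub>R \<tau>)" using param xy e by blast
  obtain t1 t2 where t: "t1 \<noteq> t2" "e' = (x + t1 *\<^sub>R \<tau>, x + t2 *\<^sub>R \<tau>)" using param xy e' by blast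
  have i: "indicator (closed_segment (x + a *\<^sub>R \<tau>) (x + b *\<^sub>R \<tau>)) (x + s *\<^sub>R \<tau>) = (indicator (closed_segment a b) s :: real)" for a b s
    using line_in_closed_segment[OF \<tau>(2)] by (simp add: indicator_def)
  show ?thesis unfolding s(2) t(2) edge_int_line[OF \<tau>(1) s(1)] edge_int_line[OF \<tau>(1) t(1)] fst_conv snd_conv i
    by (simp add: mult_ac)
qed

lemma half_plane_interior:
  assumes "half_plane_at S x n"
  shows "\<exists>r>0. \<forall>y\<in>ball x r. (y - x) \<bullet> n < 0 \<longrightarrow> y \<in> interior S"
proof -
  obtain r where r: "r > 0" "\<And>y. y \<in> ball x r \<Longrightarrow> y \<in> S \<longleftrightarrow> (y - x) \<bullet> n \<le> 0"
    using assms unfolding half_plane_at_def by blast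
  define H where "H = ball x r \<inter> {y. n \<bullet> y < n \<bullet> x}"
  have "open H" unfolding H_def by (intro open_Int open_ball open_halfspace_lt)
  moreover have "H \<subseteq> S" using r(2) unfolding H_def by (fastforce simp: inner_diff_right inner_commute)
  ultimately have "H \<subseteq> interior S" by (rule interior_maximal[rotated])
  moreover have "y \<in> H" if "y \<in> ball x r" "(y - x) \<bullet> n < 0" for y
    using that unfolding H_def by (simp add: inner_diff_right inner_commute[of "y - x"])
  ultimately show ?thesis using r(1) by blast
qed

section \<open>Neighbours across a face\<close>

locale mesh =
  fixes \<Omega> :: "point set" and T :: "quad set"
  assumes quad_mesh: "quad_mesh \<Omega> T"
begin

lemma finite_T: "finite T" and quad: "K \<in> T \<Longrightarrow> is_quad K"
  and interiors_disjoint: "K \<in> T \<Longrightarrow> K' \<in> T \<Longrightarrow> K \<noteq> K' \<Longrightarrow> interior (cell K) \<inter> interior (cell K') = {}"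
  and cells_cover: "(\<Union>K\<in>T. cell K) = closure \<Omega>"
  and open_\<Omega>: "open \<Omega>"
  using quad_mesh unfolding quad_mesh_def by auto

text \<open>The exceptional set of the pointwise statements below. A hanging node is a vertex of
  some element and hence belongs to it.\<close>

definition vertices :: "point set" where
  "vertices = (\<Union>K\<in>T. fst ` edges K \<union> snd ` edges K)"

lemma finite_vertices: "finite vertices"
  using finite_T finite_edges by (auto simp: vertices_def)

lemma in_open_edge:
  assumes "K \<in> T" "e \<in> edges K" "x \<in> seg e" "x \<notin> vertices"
  shows "x \<in> open_segment (fst e) (snd e)"
  using assms unfolding vertices_def open_segment_def by blast

lemma seg_subset_cell: "e \<in> edges K \<Longrightarrow> seg e \<subseteq> cell K"
  unfolding cell_def path_image_quad by (cases e) auto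

lemma edge_ne: "K \<in> T \<Longrightarrow> e \<in> edges K \<Longrightarrow> fst e \<noteq> snd e"
  using edges_nondeg[OF quad] by (cases e) auto

lemma edge_half_plane:
  assumes "K \<in> T" "e \<in> edges K" "x \<in> seg e" "x \<notin> vertices"
  shows "half_plane_at (cell K) x (edge_normal K e)" "nrm K x = edge_normal K e"
  using half_plane_at_edge_normal(2)[OF quad, of K "fst e" "snd e" x] in_open_edge[OF assms]
    nrm_on_edge[OF quad, of K "fst e" "snd e" x] assms by auto

lemma norm_edge_normal: "K \<in> T \<Longrightarrow> e \<in> edges K \<Longrightarrow> norm (edge_normal K e) = 1"
  using polygonal_region.normal_facts(1)[OF polygonal_region_cell[OF quad], of K "fst e" "snd e"] by simp

text \<open>The point is not interior to the second cell, since a step back along the normal would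
  reach a point interior to both; hence it lies on an edge of that cell. If the two normals were not
  opposite, a step against their sum would enter both interiors.\<close>

lemma neighbour_normal:
  assumes K: "K \<in> T" "e \<in> edges K" "x \<in> seg e" and K': "K' \<in> T" "K' \<noteq> K" "x \<in> cell K'"
    and x: "x \<notin> vertices"
  shows "\<exists>e'\<in>edges K'. x \<in> seg e' \<and> edge_normal K' e' = - edge_normal K e"
proof -
  define n where "n = edge_normal K e"
  have hp: "half_plane_at (cell K) x n" using edge_half_plane K x by (simp add: n_def)
  then obtain r where r: "r > 0" "\<And>y. y \<in> ball x r \<Longrightarrow> (y - x) \<bullet> n < 0 \<Longrightarrow> y \<in> interior (cell K)"
    using half_plane_interior by blast
  have n: "norm n = 1" using hp by (simp add: half_plane_at_def)
  then have nn: "n \<bullet> n = 1" by (simp add: norm_eq_1)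
  have "x \<notin> interior (cell K')"
  proof
    assume "x \<in> interior (cell K')"
    then obtain s where s: "s > 0" "ball x s \<subseteq> interior (cell K')"
      using open_contains_ball open_interior by blast
    define \<delta> where "\<delta> = min r s / 2"
    have \<delta>: "\<delta> > 0" "\<delta> < r" "\<delta> < s" using r(1) s(1) by (auto simp: \<delta>_def)
    define y where "y = x - \<delta> *\<^sub>R n"
    have "y \<in> ball x r" "y \<in> ball x s" using \<delta> n by (auto simp: y_def dist_norm)
    moreover have "(y - x) \<bullet> n < 0" using \<delta> nn by (simp add: y_def)
    ultimately have "y \<in> interior (cell K) \<inter> interior (cell K')" using r(2) s(2) by blast
    then show False using interiors_disjoint[of K K'] K K' by blast
  qed
  then have "x \<in> frontier (cell K')" using K'(3) closure_subset by (auto simp: frontier_def)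
  then have "x \<in> (\<Union>(a, b)\<in>edges K'. closed_segment a b)"
    using frontier_cell_subset[OF quad[OF K'(1)]] unfolding path_image_quad by blast
  then obtain e' where e': "e' \<in> edges K'" "x \<in> seg e'" by auto
  define n' where "n' = edge_normal K' e'"
  have hp': "half_plane_at (cell K') x n'" using edge_half_plane K' e' x by (simp add: n'_def)
  then obtain s where s: "s > 0" "\<And>y. y \<in> ball x s \<Longrightarrow> (y - x) \<bullet> n' < 0 \<Longrightarrow> y \<in> interior (cell K')"
    using half_plane_interior by blast
  have n': "norm n' = 1" using hp' by (simp add: half_plane_at_def)
  then have nn': "n' \<bullet> n' = 1" by (simp add: norm_eq_1)
  have "n' = - n"
  proof (rule ccontr)
    assume "n' \<noteq> - n"
    then have "n + n' \<noteq> 0" by (metis add_eq_0_iff)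
    then have "(n + n') \<bullet> (n + n') > 0" by simp
    \<comment> \<open>Half the squared norm of \<open>n + n'\<close>, and at the same time the inner
      product of \<open>n + n'\<close> with either normal.\<close>
    then have pos: "1 + n \<bullet> n' > 0" by (simp add: inner_add_left inner_add_right nn nn' inner_commute)
    define \<delta> where "\<delta> = min r s / 4"
    have \<delta>: "\<delta> > 0" "2 * \<delta> < r" "2 * \<delta> < s" using r(1) s(1) by (auto simp: \<delta>_def)
    define y where "y = x - \<delta> *\<^sub>R (n + n')"
    have "norm (n + n') \<le> 2" using norm_triangle_ineq[of n n'] n n' by simp
    then have "\<delta> * norm (n + n') \<le> \<delta> * 2" using \<delta>(1) by (intro mult_left_mono) auto
    then have "\<delta> * norm (n + n') < r" "\<delta> * norm (n + n') < s" using \<delta> by linarith+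
    then have "y \<in> ball x r" "y \<in> ball x s" using \<delta> by (auto simp: y_def dist_norm)
    moreover have "(y - x) \<bullet> n = - (\<delta> * (1 + n \<bullet> n'))" "(y - x) \<bullet> n' = - (\<delta> * (1 + n \<bullet> n'))"
      by (simp_all add: y_def inner_add_left nn nn' inner_commute algebra_simps)
    then have "(y - x) \<bullet> n < 0" "(y - x) \<bullet> n' < 0" using \<delta>(1) pos by simp_all
    ultimately have "y \<in> interior (cell K) \<inter> interior (cell K')" using r(2) s(2) by blast
    then show False using interiors_disjoint[of K K'] K K' by blast
  qed
  then show ?thesis using e' unfolding n_def n'_def by blast
qed

text \<open>Two different neighbours would be neighbours of each other. Both have the normal
  opposite to that of \<open>K\<close>, yet their normals would have to be opposite to one another,
  which no unit vector allows.\<close>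

lemma neighbour_unique:
  assumes K: "K \<in> T" "e \<in> edges K" "x \<in> seg e" and x: "x \<notin> vertices"
    and K': "K' \<in> T" "K' \<noteq> K" "x \<in> cell K'" and K'': "K'' \<in> T" "K'' \<noteq> K" "x \<in> cell K''"
  shows "K' = K''"
proof (rule ccontr)
  assume ne: "K' \<noteq> K''"
  obtain e' where e': "e' \<in> edges K'" "x \<in> seg e'" "edge_normal K' e' = - edge_normal K e"
    using neighbour_normal[OF K K' x] by blast
  obtain e'' where e'': "e'' \<in> edges K''" "x \<in> seg e''" "edge_normal K'' e'' = - edge_normal K e"
    using neighbour_normal[OF K K'' x] by blast
  obtain e3 where e3: "e3 \<in> edges K''" "x \<in> seg e3" "edge_normal K'' e3 = - edge_normal K' e'"
    using neighbour_normal[OF K'(1) e'(1,2) K''(1) _ K''(3) x] ne by blast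
  have "edge_normal K'' e3 = edge_normal K'' e''"
    using edge_half_plane(2)[OF K''(1)] e'' e3 x by metis
  then have "edge_normal K e = - edge_normal K e" using e'(3) e''(3) e3(3) by simp
  then have "edge_normal K e + edge_normal K e = 0" by (metis add.right_inverse)
  then have "edge_normal K e = 0" by (simp flip: scaleR_2)
  then show False using norm_edge_normal[OF K(1,2)] by simp
qed

text \<open>Otherwise the union of the other cells, being closed, misses a ball around
  \<open>x\<close> inside \<open>\<Omega>\<close>. This ball is covered by \<open>cell K\<close>
  alone, contrary to the half-plane shape of the cell at \<open>x\<close>.\<close>

lemma neighbour_exists:
  assumes K: "K \<in> T" "e \<in> edges K" "x \<in> seg e" and x: "x \<notin> vertices" "x \<notin> frontier \<Omega>"
  shows "\<exists>K'\<in>T. K' \<noteq> K \<and> x \<in> cell K'"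
proof (rule ccontr)
  assume none: "\<not> ?thesis"
  have "x \<in> cell K" using seg_subset_cell K by blast
  then have "x \<in> closure \<Omega>" using cells_cover K by blast
  then have "x \<in> \<Omega>" using x(2) open_\<Omega> by (auto simp: frontier_def interior_open)
  define C where "C = (\<Union>K'\<in>T - {K}. cell K')"
  have "closed C" unfolding C_def using finite_T quad closed_cell by (intro closed_UN) auto
  then have "open (\<Omega> - C)" using open_\<Omega> by blast
  moreover have "x \<in> \<Omega> - C" using \<open>x \<in> \<Omega>\<close> none by (auto simp: C_def)
  ultimately obtain s where s: "s > 0" "ball x s \<subseteq> \<Omega> - C" using open_contains_ball by blast
  have sub: "ball x s \<subseteq> cell K"
  proof
    fix y assume y: "y \<in> ball x s"
    then have "y \<in> closure \<Omega>" using s closure_subset by blast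
    then show "y \<in> cell K" using cells_cover y s(2) unfolding C_def by blast
  qed
  define n where "n = edge_normal K e"
  have "half_plane_at (cell K) x n" using edge_half_plane K x by (simp add: n_def)
  then obtain r where r: "r > 0" "\<And>y. y \<in> ball x r \<Longrightarrow> y \<in> cell K \<longleftrightarrow> (y - x) \<bullet> n \<le> 0"
    and n: "norm n = 1" unfolding half_plane_at_def by blast
  define \<delta> where "\<delta> = min r s / 2"
  have \<delta>: "\<delta> > 0" "\<delta> < r" "\<delta> < s" using r(1) s(1) by (auto simp: \<delta>_def)
  define y where "y = x + \<delta> *\<^sub>R n"
  have "y \<in> ball x r" "y \<in> ball x s" using \<delta> n by (auto simp: y_def dist_norm)
  then have "(y - x) \<bullet> n \<le> 0" using r(2) sub by blast
  moreover have "n \<bullet> n = 1" using n by (simp add: norm_eq_1)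
  ultimately show False using \<delta> by (simp add: y_def)
qed

definition nbr :: "quad \<Rightarrow> point \<Rightarrow> quad" where
  "nbr K x = (SOME K'. K' \<in> T \<and> K' \<noteq> K \<and> x \<in> cell K')"

lemma ext_trace_nbr: "ext_trace \<Omega> T w K x = (if x \<in> frontier \<Omega> then 0 else w (nbr K x) x)"
  by (simp add: ext_trace_def nbr_def)

lemma nbr:
  assumes K: "K \<in> T" "e \<in> edges K" "x \<in> seg e" and x: "x \<notin> vertices" "x \<notin> frontier \<Omega>"
  shows "nbr K x \<in> T" "nbr K x \<noteq> K" "x \<in> cell (nbr K x)"
  using someI_ex[of "\<lambda>K'. K' \<in> T \<and> K' \<noteq> K \<and> x \<in> cell K'"] neighbour_exists[OF assms]
  unfolding nbr_def by blast+

text \<open>The point is that the choice of the neighbour is measurable along the edge. Off the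
  vertices the neighbour is unique, so the trace equals a finite sum over the other elements in
  which the indicators keep exactly one term, and none on \<open>frontier \<Omega>\<close>.\<close>

lemma edge_adm_ext_trace:
  fixes w :: "real broken"
  assumes K: "K \<in> T" "e \<in> edges K" and w: "\<And>K'. K' \<in> T \<Longrightarrow> continuous_on UNIV (w K')"
  shows "edge_adm e (ext_trace \<Omega> T w K)"
proof (rule edge_adm_cong[OF edge_ne[OF K] finite_vertices])
  let ?g = "\<lambda>x. \<Sum>K'\<in>T - {K}. indicator (cell K' - frontier \<Omega>) x * w K' x"
  show "edge_adm e ?g"
  proof (intro edge_adm_sum edge_adm_mult)
    fix K' assume "K' \<in> T - {K}"
    then have K': "K' \<in> T" by blast
    show "edge_adm e (w K')" by (rule edge_adm_continuous[OF w[OF K']])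
    have "cell K' - frontier \<Omega> \<in> sets borel"
      using closed_cell[OF quad[OF K']] by (intro sets.Diff borel_closed) auto
    then show "edge_adm e (indicator (cell K' - frontier \<Omega>))"
      by (intro edge_adm_borel) (auto simp: bounded_iff indicator_def intro!: exI[of _ 1])
  qed
  fix x assume "x \<in> seg e - vertices"
  then have x: "x \<in> seg e" "x \<notin> vertices" by auto
  show "ext_trace \<Omega> T w K x = ?g x"
  proof (cases "x \<in> frontier \<Omega>")
    case True
    then show ?thesis by (simp add: ext_trace_nbr)
  next
    case False
    note nb = nbr[OF K x False]
    have "indicator (cell K' - frontier \<Omega>) x * w K' x = (if K' = nbr K x then w K' x else 0)"
      if "K' \<in> T - {K}" for K'
    proof (cases "x \<in> cell K'")
      case True
      then have "K' = nbr K x" using neighbour_unique[OF K x _ _ True nb] that by blast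
      then show ?thesis using True False by (simp add: indicator_def)
    next
      case no: False
      then have "K' \<noteq> nbr K x" using nb(3) by metis
      then show ?thesis using no by (simp add: indicator_def)
    qed
    then have "?g x = (\<Sum>K'\<in>T - {K}. if K' = nbr K x then w K' x else 0)" by (intro sum.cong) auto
    also have "\<dots> = w (nbr K x) x" using nb finite_T by (simp add: sum.delta)
    finally show ?thesis using False by (simp add: ext_trace_nbr)
  qed
qed

text \<open>The index set of inner traces. The element is kept with the edge because two elements
  may share the same pair of end points.\<close>

abbreviation sides :: "(quad \<times> point \<times> point) set" where
  "sides \<equiv> Sigma T edges"

lemma sides_iff: "i \<in> sides \<longleftrightarrow> fst i \<in> T \<and> snd i \<in> edges (fst i)"
  by (cases i) simp

lemma finite_sides: "finite sides" using finite_T finite_edges by auto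

text \<open>Exchanging the two sides of a face: almost every point of a face lies on at most one face of
  another element.\<close>

lemma sum_opposite_sides_le:
  fixes F :: "quad \<times> point \<times> point \<Rightarrow> point \<Rightarrow> real"
  assumes cont: "\<And>j. j \<in> sides \<Longrightarrow> continuous_on UNIV (F j)" and pos: "\<And>j x. j \<in> sides \<Longrightarrow> 0 \<le> F j x"
  shows "(\<Sum>i\<in>sides. edge_int (snd i) (\<lambda>x. \<Sum>j\<in>{j\<in>sides. fst j \<noteq> fst i}. indicator (seg (snd j)) x * F j x))
    \<le> (\<Sum>j\<in>sides. edge_int (snd j) (F j))"
proof -
  have ne: "fst (snd i) \<noteq> snd (snd i)" if "i \<in> sides" for i
    using edge_ne that unfolding sides_iff by blast
  have ind: "edge_adm e (indicator (seg e'))" for e e'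
    by (intro edge_adm_borel) (auto simp: bounded_iff indicator_def intro!: exI[of _ 1])
  have adm: "edge_adm e (\<lambda>x. indicator (seg e') x * F j x)" if "j \<in> sides" for e e' j
    by (intro edge_adm_mult ind edge_adm_continuous cont that)
  have "(\<Sum>i\<in>sides. edge_int (snd i) (\<lambda>x. \<Sum>j\<in>{j\<in>sides. fst j \<noteq> fst i}. indicator (seg (snd j)) x * F j x))
    = (\<Sum>i\<in>sides. \<Sum>j\<in>{j\<in>sides. fst j \<noteq> fst i}. edge_int (snd i) (\<lambda>x. indicator (seg (snd j)) x * F j x))"
    by (intro sum.cong refl edge_int_sum adm) auto
  \<comment> \<open>The overlap of two edges may be integrated along either of them: here the side
    that looks across the face changes places with the side that is seen.\<close>
  also have "\<dots> = (\<Sum>i\<in>sides. \<Sum>j\<in>{j\<in>sides. fst j \<noteq> fst i}. edge_int (snd j) (\<lambda>x. indicator (seg (snd i)) x * F j x))"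
    by (intro sum.cong refl edge_int_overlap ne) auto
  also have "\<dots> = (\<Sum>j\<in>sides. \<Sum>i\<in>{i\<in>sides. fst j \<noteq> fst i}. edge_int (snd j) (\<lambda>x. indicator (seg (snd i)) x * F j x))"
    by (rule sum.swap_restrict) (rule finite_sides)+
  also have "\<dots> = (\<Sum>j\<in>sides. edge_int (snd j) (\<lambda>x. \<Sum>i\<in>{i\<in>sides. fst j \<noteq> fst i}. indicator (seg (snd i)) x * F j x))"
    by (intro sum.cong refl edge_int_sum[symmetric] adm) auto
  also have "\<dots> \<le> (\<Sum>j\<in>sides. edge_int (snd j) (F j))"
  proof (rule sum_mono)
    fix j assume j: "j \<in> sides"
    obtain K e where Ke: "j = (K, e)" "K \<in> T" "e \<in> edges K" using j by blast
    let ?I = "{i\<in>sides. fst j \<noteq> fst i}"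
    show "edge_int (snd j) (\<lambda>x. \<Sum>i\<in>?I. indicator (seg (snd i)) x * F j x) \<le> edge_int (snd j) (F j)"
    proof (rule edge_int_mono[OF ne[OF j] finite_vertices])
      show "edge_adm (snd j) (\<lambda>x. \<Sum>i\<in>?I. indicator (seg (snd i)) x * F j x)"
        by (intro edge_adm_sum adm j)
      show "edge_adm (snd j) (F j)" by (intro edge_adm_continuous cont j)
      fix x assume "x \<in> seg (snd j) - vertices"
      then have x: "x \<in> seg e" "x \<notin> vertices" by (auto simp: Ke)
      have fin: "finite ?I" using finite_sides by simp
      \<comment> \<open>The sum counts the sides of other elements through \<open>x\<close>. There
        is at most one, because off the vertices the other element is unique and no two of its edges
        meet.\<close>
      have "(\<Sum>i\<in>?I. indicator (seg (snd i)) x) = real (card {i\<in>?I. x \<in> seg (snd i)})"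
        using fin by (simp add: indicator_def sum.If_cases Int_def)
      also have "card {i\<in>?I. x \<in> seg (snd i)} \<le> 1"
      proof (subst card_le_Suc0_iff_eq[THEN iffD2, unfolded One_nat_def[symmetric]])
        show "finite {i\<in>?I. x \<in> seg (snd i)}" using fin by (rule rev_finite_subset) blast
        show "\<forall>i1\<in>{i\<in>?I. x \<in> seg (snd i)}. \<forall>i2\<in>{i\<in>?I. x \<in> seg (snd i)}. i1 = i2"
        proof (intro ballI)
          fix i1 i2 assume "i1 \<in> {i\<in>?I. x \<in> seg (snd i)}" "i2 \<in> {i\<in>?I. x \<in> seg (snd i)}"
          then obtain K1 e1 K2 e2 where i: "i1 = (K1, e1)" "i2 = (K2, e2)" "K1 \<in> T" "K2 \<in> T" "K1 \<noteq> K" "K2 \<noteq> K"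
            "e1 \<in> edges K1" "e2 \<in> edges K2" "x \<in> seg e1" "x \<in> seg e2"
            unfolding Ke fst_conv mem_Collect_eq sides_iff by (metis prod.collapse)
          have K12: "K1 = K2"
            using neighbour_unique[OF Ke(2,3) x, of K1 K2] i seg_subset_cell by blast
          have "e1 = e2"
          proof (rule ccontr)
            assume "e1 \<noteq> e2"
            then have "open_segment (fst e1) (snd e1) \<inter> seg e2 = {}"
              using quad_edges_disjoint[OF quad[OF i(3)], of "fst e1" "snd e1" "fst e2" "snd e2"] i K12 by (metis prod.collapse)
            then show False using in_open_edge[OF i(3,7,9) x(2)] i(10) by blast
          qed
          then show "i1 = i2" using i K12 by simp
        qed
      qed simp
      finally have "(\<Sum>i\<in>?I. indicator (seg (snd i)) x) \<le> (1 :: real)" by simp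
      then have "(\<Sum>i\<in>?I. indicator (seg (snd i)) x) * F j x \<le> 1 * F j x"
        by (rule mult_right_mono) (rule pos[OF j])
      then show "(\<Sum>i\<in>?I. indicator (seg (snd i)) x * F j x) \<le> F j x" by (simp add: sum_distrib_right)
    qed
  qed
  finally show ?thesis .
qed

text \<open>Off the vertices and \<open>frontier \<Omega>\<close>, the exterior trace is the inner
  trace of one neighbouring side, whose opposite normal disappears in the square. Bounding it by the
  nonnegative sum over all sides of other elements through the point gives the form of
  \<open>sum_opposite_sides_le\<close>; on \<open>frontier \<Omega>\<close> the left-hand side is
  zero.\<close>

lemma ext_trace_skeleton_le:
  fixes \<phi> :: "real broken" and \<theta> :: "point broken"
  assumes \<phi>: "\<And>K. K \<in> T \<Longrightarrow> continuous_on UNIV (\<phi> K)" and \<theta>: "\<And>K. K \<in> T \<Longrightarrow> continuous_on UNIV (\<theta> K)"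
    and \<Phi>: "\<Phi> \<ge> 0"
    and adm: "\<And>K e. K \<in> T \<Longrightarrow> e \<in> edges K \<Longrightarrow>
      edge_adm e (\<lambda>x. (ext_trace \<Omega> T \<phi> K x)\<^sup>2 + \<Phi> * (ext_trace \<Omega> T \<theta> K x \<bullet> nrm K x)\<^sup>2)"
  shows "(\<Sum>K\<in>T. \<Sum>e\<in>edges K. edge_int e (\<lambda>x. (ext_trace \<Omega> T \<phi> K x)\<^sup>2 + \<Phi> * (ext_trace \<Omega> T \<theta> K x \<bullet> nrm K x)\<^sup>2))
    \<le> (\<Sum>K\<in>T. \<Sum>e\<in>edges K. edge_int e (\<lambda>x. (\<phi> K x)\<^sup>2 + \<Phi> * (\<theta> K x \<bullet> nrm K x)\<^sup>2))"
proof -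
  \<comment> \<open>With the constant \<open>edge_normal\<close> in place of \<open>nrm\<close>,
    each function is continuous on the whole plane and can be integrated along any edge.\<close>
  define F where "F j x = (\<phi> (fst j) x)\<^sup>2 + \<Phi> * (\<theta> (fst j) x \<bullet> edge_normal (fst j) (snd j))\<^sup>2" for j x
  have cont: "continuous_on UNIV (F j)" if "j \<in> sides" for j
    using that unfolding F_def sides_iff by (intro continuous_intros \<phi> \<theta>) simp_all
  have pos: "0 \<le> F j x" for j x using \<Phi> by (simp add: F_def)
  have ind: "edge_adm e (indicator (seg e'))" for e e'
    by (intro edge_adm_borel) (auto simp: bounded_iff indicator_def intro!: exI[of _ 1])
  have "(\<Sum>K\<in>T. \<Sum>e\<in>edges K. edge_int e (\<lambda>x. (ext_trace \<Omega> T \<phi> K x)\<^sup>2 + \<Phi> * (ext_trace \<Omega> T \<theta> K x \<bullet> nrm K x)\<^sup>2))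
    = (\<Sum>i\<in>sides. edge_int (snd i) (\<lambda>x. (ext_trace \<Omega> T \<phi> (fst i) x)\<^sup>2 + \<Phi> * (ext_trace \<Omega> T \<theta> (fst i) x \<bullet> nrm (fst i) x)\<^sup>2))"
    using finite_T finite_edges by (subst sum.Sigma) (simp_all add: split_def)
  also have "\<dots> \<le> (\<Sum>i\<in>sides. edge_int (snd i) (\<lambda>x. \<Sum>j\<in>{j\<in>sides. fst j \<noteq> fst i}. indicator (seg (snd j)) x * F j x))"
  proof (rule sum_mono)
    fix i assume i: "i \<in> sides"
    obtain K e where Ke: "i = (K, e)" "K \<in> T" "e \<in> edges K" using i by blast
    show "edge_int (snd i) (\<lambda>x. (ext_trace \<Omega> T \<phi> (fst i) x)\<^sup>2 + \<Phi> * (ext_trace \<Omega> T \<theta> (fst i) x \<bullet> nrm (fst i) x)\<^sup>2)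
      \<le> edge_int (snd i) (\<lambda>x. \<Sum>j\<in>{j\<in>sides. fst j \<noteq> fst i}. indicator (seg (snd j)) x * F j x)"
      unfolding Ke fst_conv snd_conv
    proof (rule edge_int_mono[OF edge_ne[OF Ke(2,3)] finite_vertices adm[OF Ke(2,3)]])
      let ?J = "{j\<in>sides. fst j \<noteq> K}"
      show "edge_adm e (\<lambda>x. \<Sum>j\<in>?J. indicator (seg (snd j)) x * F j x)"
        by (intro edge_adm_sum edge_adm_mult ind edge_adm_continuous cont) auto
      fix x assume "x \<in> seg e - vertices"
      then have x: "x \<in> seg e" "x \<notin> vertices" by auto
      have Jpos: "0 \<le> (\<Sum>j\<in>?J. indicator (seg (snd j)) x * F j x)"
        by (intro sum_nonneg mult_nonneg_nonneg pos) auto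
      show "(ext_trace \<Omega> T \<phi> K x)\<^sup>2 + \<Phi> * (ext_trace \<Omega> T \<theta> K x \<bullet> nrm K x)\<^sup>2
        \<le> (\<Sum>j\<in>?J. indicator (seg (snd j)) x * F j x)"
      proof (cases "x \<in> frontier \<Omega>")
        case True
        then show ?thesis using Jpos by (simp add: ext_trace_nbr)
      next
        case False
        note nb = nbr[OF Ke(2,3) x False]
        obtain e' where e': "e' \<in> edges (nbr K x)" "x \<in> seg e'"
          "edge_normal (nbr K x) e' = - edge_normal K e"
          using neighbour_normal[OF Ke(2,3) x(1) nb x(2)] by blast
        have "(ext_trace \<Omega> T \<phi> K x)\<^sup>2 + \<Phi> * (ext_trace \<Omega> T \<theta> K x \<bullet> nrm K x)\<^sup>2 = F (nbr K x, e') x"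
          using False e'(3) edge_half_plane(2)[OF Ke(2,3) x] by (simp add: F_def ext_trace_nbr)
        also have "\<dots> = indicator (seg (snd (nbr K x, e'))) x * F (nbr K x, e') x" using e' by simp
        also have "\<dots> \<le> (\<Sum>j\<in>?J. indicator (seg (snd j)) x * F j x)"
        proof (rule member_le_sum)
          show "(nbr K x, e') \<in> ?J" using e'(1) nb by (simp add: sides_iff)
          show "finite ?J" using finite_sides by simp
          show "0 \<le> indicator (seg (snd j)) x * F j x" for j by (intro mult_nonneg_nonneg pos) simp
        qed
        finally show ?thesis .
      qed
    qed
  qed
  also have "\<dots> \<le> (\<Sum>j\<in>sides. edge_int (snd j) (F j))"
    by (rule sum_opposite_sides_le[OF cont pos])
  also have "\<dots> = (\<Sum>j\<in>sides. edge_int (snd j) (\<lambda>x. (\<phi> (fst j) x)\<^sup>2 + \<Phi> * (\<theta> (fst j) x \<bullet> nrm (fst j) x)\<^sup>2))"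
  proof (rule sum.cong[OF refl])
    fix j assume j: "j \<in> sides"
    obtain K e where Ke: "j = (K, e)" "K \<in> T" "e \<in> edges K" using j by blast
    have "edge_int e (\<lambda>x. (\<phi> K x)\<^sup>2 + \<Phi> * (\<theta> K x \<bullet> nrm K x)\<^sup>2) = edge_int e (F j)"
      using edge_half_plane(2)[OF Ke(2,3)]
      by (intro edge_int_cong[OF edge_ne[OF Ke(2,3)] finite_vertices] edge_adm_continuous cont[OF j])
        (simp add: F_def Ke)
    then show "edge_int (snd j) (F j) = edge_int (snd j) (\<lambda>x. (\<phi> (fst j) x)\<^sup>2 + \<Phi> * (\<theta> (fst j) x \<bullet> nrm (fst j) x)\<^sup>2)"
      by (simp add: Ke)
  qed
  also have "\<dots> = (\<Sum>K\<in>T. \<Sum>e\<in>edges K. edge_int e (\<lambda>x. (\<phi> K x)\<^sup>2 + \<Phi> * (\<theta> K x \<bullet> nrm K x)\<^sup>2))"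
    using finite_T finite_edges by (subst sum.Sigma) (simp_all add: split_def)
  finally show ?thesis .
qed

end

section \<open>The energy estimate\<close>

lemma poly_space_smooth:
  assumes "w \<in> poly_space p"
  shows continuous_on_poly_space: "continuous_on UNIV w"
    and has_pdx_poly_space: "((\<lambda>s. w (s, y)) has_real_derivative pdx w (x, y)) (at x)"
    and has_pdy_poly_space: "((\<lambda>s. w (x, s)) has_real_derivative pdy w (x, y)) (at y)"
    and continuous_on_pdx_poly_space: "continuous_on UNIV (pdx w)"
    and continuous_on_pdy_poly_space: "continuous_on UNIV (pdy w)"
proof -
  obtain a where a: "\<And>x y. w (x, y) = (\<Sum>i\<le>p. \<Sum>j\<le>p - i. a i j * x ^ i * y ^ j)"
    using assms by (auto simp: poly_space_def)
  have w: "w = (\<lambda>z. \<Sum>i\<le>p. \<Sum>j\<le>p - i. a i j * fst z ^ i * snd z ^ j)"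
    using a by (auto simp: fun_eq_iff)
  show "continuous_on UNIV w" unfolding w by (intro continuous_intros)
  have x: "((\<lambda>s. w (s, y)) has_real_derivative
      (\<Sum>i\<le>p. \<Sum>j\<le>p - i. a i j * (real i * x ^ (i - 1)) * y ^ j)) (at x)" for x y
    unfolding a by (auto intro!: derivative_eq_intros sum.cong simp: One_nat_def)
  have y: "((\<lambda>s. w (x, s)) has_real_derivative
      (\<Sum>i\<le>p. \<Sum>j\<le>p - i. a i j * x ^ i * (real j * y ^ (j - 1)))) (at y)" for x y
    unfolding a by (auto intro!: derivative_eq_intros sum.cong simp: One_nat_def)
  have px: "pdx w = (\<lambda>z. \<Sum>i\<le>p. \<Sum>j\<le>p - i. a i j * (real i * fst z ^ (i - 1)) * snd z ^ j)"
    unfolding pdx_def using DERIV_imp_deriv[OF x] by blast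
  have py: "pdy w = (\<lambda>z. \<Sum>i\<le>p. \<Sum>j\<le>p - i. a i j * fst z ^ i * (real j * snd z ^ (j - 1)))"
    unfolding pdy_def using DERIV_imp_deriv[OF y] by blast
  show "((\<lambda>s. w (s, y)) has_real_derivative pdx w (x, y)) (at x)" using x by (simp add: px)
  show "((\<lambda>s. w (x, s)) has_real_derivative pdy w (x, y)) (at y)" using y by (simp add: py)
  show "continuous_on UNIV (pdx w)" unfolding px by (intro continuous_intros)
  show "continuous_on UNIV (pdy w)" unfolding py by (intro continuous_intros)
qed

definition vol_int :: "quad \<Rightarrow> (point \<Rightarrow> real) \<Rightarrow> real" where
  "vol_int K h = (LINT x:cell K|lborel. h x)"

lemma vol_integrable:
  assumes "is_quad K" "continuous_on UNIV h"
  shows "set_integrable lborel (cell K) (h :: point \<Rightarrow> real)"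
  unfolding set_integrable_def
  by (intro borel_integrable_compact compact_cell assms(1) continuous_on_subset[OF assms(2)] subset_UNIV)

lemma vol_int_add:
  assumes "is_quad K" "continuous_on UNIV f" "continuous_on UNIV g"
  shows "vol_int K (\<lambda>x. f x + g x) = vol_int K f + vol_int K g"
  unfolding vol_int_def using vol_integrable assms by (intro set_integral_add) auto

lemma vol_int_cmult: "vol_int K (\<lambda>x. c * f x) = c * vol_int K f"
  by (simp add: vol_int_def)

lemma vol_int_nonneg: "(\<And>x. 0 \<le> f x) \<Longrightarrow> 0 \<le> vol_int K f"
  unfolding vol_int_def set_lebesgue_integral_def
  by (intro integral_nonneg_AE AE_I2) (simp add: indicator_def)

lemma bdry_inner_edge_int: "bdry_inner K v w = (\<Sum>e\<in>edges K. edge_int e (\<lambda>x. v x \<bullet> w x))"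
  by (simp add: bdry_inner_def edge_int_def split_def)

lemma vol_inner_vol_int: "vol_inner K v w = vol_int K (\<lambda>x. v x \<bullet> w x)"
  by (simp add: vol_inner_def vol_int_def)

text \<open>The divergence theorem in one coordinate direction for the product \<open>P * U\<close>,
  combined with the product rule.\<close>

lemma green_poly:
  assumes K: "is_quad K" and P: "P \<in> poly_space p" and U: "U \<in> poly_space q"
  shows "vol_int K (\<lambda>x. U x * pdx P x) + vol_int K (\<lambda>x. P x * pdx U x) =
      (\<Sum>e\<in>edges K. edge_int e (\<lambda>x. P x * U x * fst (edge_normal K e)))"
    and "vol_int K (\<lambda>x. U x * pdy P x) + vol_int K (\<lambda>x. P x * pdy U x) =
      (\<Sum>e\<in>edges K. edge_int e (\<lambda>x. P x * U x * snd (edge_normal K e)))"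
proof -
  interpret polygonal_region "cell K" "edges K" "edge_normal K" by (rule polygonal_region_cell[OF K])
  note cP = continuous_on_poly_space[OF P] continuous_on_pdx_poly_space[OF P] continuous_on_pdy_poly_space[OF P]
  note cU = continuous_on_poly_space[OF U] continuous_on_pdx_poly_space[OF U] continuous_on_pdy_poly_space[OF U]
  have c: "continuous_on UNIV (\<lambda>x. P x * U x)" by (intro continuous_intros cP cU)
  have e: "edge_int e (\<lambda>x. P x * U x * n) = dist (fst e) (snd e) *
      (LINT t:{0..1}|lborel. P (linepath (fst e) (snd e) t) * U (linepath (fst e) (snd e) t)) * n" for e n
    by (simp add: edge_int_def)
  have "vol_int K (\<lambda>x. U x * pdx P x) + vol_int K (\<lambda>x. P x * pdx U x) = vol_int K (\<lambda>x. U x * pdx P x + P x * pdx U x)"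
    by (intro vol_int_add[symmetric] K continuous_intros cP cU)
  also have "\<dots> = (\<Sum>(a, b)\<in>edges K. dist a b * (LINT t:{0..1}|lborel. P (linepath a b t) * U (linepath a b t)) * fst (edge_normal K (a, b)))"
    unfolding vol_int_def
    by (rule divergence_x)
      (auto intro!: continuous_intros cP cU derivative_eq_intros has_pdx_poly_space[OF P] has_pdx_poly_space[OF U])
  finally show "vol_int K (\<lambda>x. U x * pdx P x) + vol_int K (\<lambda>x. P x * pdx U x) =
      (\<Sum>e\<in>edges K. edge_int e (\<lambda>x. P x * U x * fst (edge_normal K e)))"
    by (simp only: e split_def prod.collapse)
  have "vol_int K (\<lambda>x. U x * pdy P x) + vol_int K (\<lambda>x. P x * pdy U x) = vol_int K (\<lambda>x. U x * pdy P x + P x * pdy U x)"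
    by (intro vol_int_add[symmetric] K continuous_intros cP cU)
  also have "\<dots> = (\<Sum>(a, b)\<in>edges K. dist a b * (LINT t:{0..1}|lborel. P (linepath a b t) * U (linepath a b t)) * snd (edge_normal K (a, b)))"
    unfolding vol_int_def
    by (rule divergence_y)
      (auto intro!: continuous_intros cP cU derivative_eq_intros has_pdy_poly_space[OF P] has_pdy_poly_space[OF U])
  finally show "vol_int K (\<lambda>x. U x * pdy P x) + vol_int K (\<lambda>x. P x * pdy U x) =
      (\<Sum>e\<in>edges K. edge_int e (\<lambda>x. P x * U x * snd (edge_normal K e)))"
    by (simp only: e split_def prod.collapse)
qed

context mesh
begin

lemma edge_adm_nrm:
  assumes K: "K \<in> T" "e \<in> edges K"
  shows "edge_adm e (\<lambda>x. fst (nrm K x))" "edge_adm e (\<lambda>x. snd (nrm K x))"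
  using edge_half_plane(2)[OF K]
  by (auto intro!: edge_adm_cong[OF edge_ne[OF K] finite_vertices edge_adm_const])

text \<open>With the solution as test function, the Coriolis terms are plus and minus
  \<open>\<Phi>\<close> times the integral of \<open>f * U * W\<close>. The volume terms with
  derivatives combine in pairs to Green's formula, whose boundary term cancels the normal velocity
  flux tested with \<open>P\<close>. The numerical trace is kept as an arbitrary admissible
  \<open>h\<close>.\<close>

lemma energy_identity:
  fixes P U W h f :: "point \<Rightarrow> real"
  assumes K: "K \<in> T" and P: "P \<in> poly_space p" and U: "U \<in> poly_space p" and W: "W \<in> poly_space p"
    and h: "\<And>e. e \<in> edges K \<Longrightarrow> edge_adm e h" and f: "continuous_on UNIV f"
    and e1: "vol_inner K (\<lambda>x. P x / \<Delta>t) P - vol_inner K (\<lambda>x. \<Phi> *\<^sub>R (U x, W x)) (grad P)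
      + bdry_inner K (\<lambda>x. \<Phi> * ((U x, W x) \<bullet> nrm K x) + sqrt \<Phi> * (P x - h x)) P = 0"
    and e2: "vol_inner K (\<lambda>x. \<Phi> * U x / \<Delta>t) U - vol_inner K (\<lambda>x. \<Phi> * P x) (pdx U)
      + bdry_inner K (\<lambda>x. \<Phi> * h x * fst (nrm K x)) U
      = vol_inner K (\<lambda>x. f x * \<Phi> * W x - \<gamma> * \<Phi> * U x) U"
    and e3: "vol_inner K (\<lambda>x. \<Phi> * W x / \<Delta>t) W - vol_inner K (\<lambda>x. \<Phi> * P x) (pdy W)
      + bdry_inner K (\<lambda>x. \<Phi> * h x * snd (nrm K x)) W
      = vol_inner K (\<lambda>x. - f x * \<Phi> * U x - \<gamma> * \<Phi> * W x) W"
  shows "vol_int K (\<lambda>x. (P x)\<^sup>2) / \<Delta>t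
    + (1 / \<Delta>t + \<gamma>) * \<Phi> * (vol_int K (\<lambda>x. (U x)\<^sup>2) + vol_int K (\<lambda>x. (W x)\<^sup>2))
    + (\<Sum>e\<in>edges K. edge_int e (\<lambda>x. sqrt \<Phi> * (P x - h x) * P x + \<Phi> * h x * ((U x, W x) \<bullet> nrm K x))) = 0"
proof -
  note q = quad[OF K]
  note cP = continuous_on_poly_space[OF P] continuous_on_pdx_poly_space[OF P] continuous_on_pdy_poly_space[OF P]
  note cU = continuous_on_poly_space[OF U] continuous_on_pdx_poly_space[OF U] continuous_on_pdy_poly_space[OF U]
  note cW = continuous_on_poly_space[OF W] continuous_on_pdx_poly_space[OF W] continuous_on_pdy_poly_space[OF W]
  note c = cP cU cW f
  let ?n1 = "\<lambda>x. fst (nrm K x)" and ?n2 = "\<lambda>x. snd (nrm K x)"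
  have v1: "vol_inner K (\<lambda>x. P x / \<Delta>t) P = vol_int K (\<lambda>x. (P x)\<^sup>2) / \<Delta>t"
    using vol_int_cmult[of K "1 / \<Delta>t" "\<lambda>x. (P x)\<^sup>2"]
    by (simp add: vol_inner_vol_int power2_eq_square)
  have v2: "vol_inner K (\<lambda>x. \<Phi> *\<^sub>R (U x, W x)) (grad P) =
      \<Phi> * (vol_int K (\<lambda>x. U x * pdx P x) + vol_int K (\<lambda>x. W x * pdy P x))"
  proof -
    have "vol_inner K (\<lambda>x. \<Phi> *\<^sub>R (U x, W x)) (grad P) = vol_int K (\<lambda>x. \<Phi> * (U x * pdx P x + W x * pdy P x))"
      by (simp add: vol_inner_vol_int grad_def inner_prod_def algebra_simps)
    also have "\<dots> = \<Phi> * (vol_int K (\<lambda>x. U x * pdx P x) + vol_int K (\<lambda>x. W x * pdy P x))"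
      by (subst vol_int_cmult, subst vol_int_add) (intro q continuous_intros c | simp)+
    finally show ?thesis .
  qed
  have v3: "vol_inner K (\<lambda>x. \<Phi> * w x / \<Delta>t) w = \<Phi> / \<Delta>t * vol_int K (\<lambda>x. (w x)\<^sup>2)" for w
    using vol_int_cmult[of K "\<Phi> / \<Delta>t" "\<lambda>x. (w x)\<^sup>2"]
    by (simp add: vol_inner_vol_int power2_eq_square algebra_simps)
  have v4: "vol_inner K (\<lambda>x. \<Phi> * P x) w = \<Phi> * vol_int K (\<lambda>x. P x * w x)" for w
    using vol_int_cmult[of K \<Phi> "\<lambda>x. P x * w x"] by (simp add: vol_inner_vol_int algebra_simps)
  have v5: "vol_inner K (\<lambda>x. f x * \<Phi> * W x - \<gamma> * \<Phi> * U x) U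
     = \<Phi> * vol_int K (\<lambda>x. f x * U x * W x) + (- (\<gamma> * \<Phi>)) * vol_int K (\<lambda>x. (U x)\<^sup>2)"
  proof -
    have "vol_inner K (\<lambda>x. f x * \<Phi> * W x - \<gamma> * \<Phi> * U x) U =
      vol_int K (\<lambda>x. \<Phi> * (f x * U x * W x) + (- (\<gamma> * \<Phi>)) * (U x)\<^sup>2)"
      unfolding vol_inner_vol_int
      by (rule arg_cong[where f = "vol_int K"], rule ext) (simp add: power2_eq_square algebra_simps)
    also have "\<dots> = vol_int K (\<lambda>x. \<Phi> * (f x * U x * W x)) + vol_int K (\<lambda>x. (- (\<gamma> * \<Phi>)) * (U x)\<^sup>2)"
      by (intro vol_int_add q continuous_intros c)
    finally show ?thesis unfolding vol_int_cmult .
  qed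
  have v6: "vol_inner K (\<lambda>x. - f x * \<Phi> * U x - \<gamma> * \<Phi> * W x) W
     = (- \<Phi>) * vol_int K (\<lambda>x. f x * U x * W x) + (- (\<gamma> * \<Phi>)) * vol_int K (\<lambda>x. (W x)\<^sup>2)"
  proof -
    have "vol_inner K (\<lambda>x. - f x * \<Phi> * U x - \<gamma> * \<Phi> * W x) W =
      vol_int K (\<lambda>x. (- \<Phi>) * (f x * U x * W x) + (- (\<gamma> * \<Phi>)) * (W x)\<^sup>2)"
      unfolding vol_inner_vol_int
      by (rule arg_cong[where f = "vol_int K"], rule ext) (simp add: power2_eq_square algebra_simps)
    also have "\<dots> = vol_int K (\<lambda>x. (- \<Phi>) * (f x * U x * W x)) + vol_int K (\<lambda>x. (- (\<gamma> * \<Phi>)) * (W x)\<^sup>2)"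
      by (intro vol_int_add q continuous_intros c)
    finally show ?thesis unfolding vol_int_cmult .
  qed
  \<comment> \<open>The boundary integral of \<open>P\<close> times the normal velocity, in the form
    with constant edge normals that \<open>green_poly\<close> delivers.\<close>
  define G where "G = (\<Sum>e\<in>edges K. edge_int e (\<lambda>x. P x * U x * fst (edge_normal K e)))
    + (\<Sum>e\<in>edges K. edge_int e (\<lambda>x. P x * W x * snd (edge_normal K e)))"
  have green: "vol_int K (\<lambda>x. U x * pdx P x) + vol_int K (\<lambda>x. P x * pdx U x)
      + (vol_int K (\<lambda>x. W x * pdy P x) + vol_int K (\<lambda>x. P x * pdy W x)) = G"
    unfolding G_def green_poly(1)[OF q P U] green_poly(2)[OF q P W] ..
  have "bdry_inner K (\<lambda>x. \<Phi> * ((U x, W x) \<bullet> nrm K x) + sqrt \<Phi> * (P x - h x)) P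
    + bdry_inner K (\<lambda>x. \<Phi> * h x * ?n1 x) U + bdry_inner K (\<lambda>x. \<Phi> * h x * ?n2 x) W - \<Phi> * G
    = (\<Sum>e\<in>edges K. edge_int e (\<lambda>x. sqrt \<Phi> * (P x - h x) * P x + \<Phi> * h x * ((U x, W x) \<bullet> nrm K x)))"
    unfolding bdry_inner_edge_int G_def distrib_left sum_distrib_left sum.distrib[symmetric] sum_subtractf[symmetric]
  proof (rule sum.cong[OF refl])
    fix e assume e: "e \<in> edges K"
    note adm = edge_adm_intros h[OF e] edge_adm_nrm[OF K e]
      edge_adm_continuous[OF cP(1)] edge_adm_continuous[OF cU(1)] edge_adm_continuous[OF cW(1)]
    have n: "edge_int e (\<lambda>x. P x * U x * fst (edge_normal K e)) = edge_int e (\<lambda>x. P x * U x * ?n1 x)"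
      "edge_int e (\<lambda>x. P x * W x * snd (edge_normal K e)) = edge_int e (\<lambda>x. P x * W x * ?n2 x)"
      using edge_half_plane(2)[OF K e]
      by (auto intro!: edge_int_cong[OF edge_ne[OF K e] finite_vertices] adm)
    have "edge_int e (\<lambda>x. sqrt \<Phi> * (P x - h x) * P x + \<Phi> * h x * ((U x, W x) \<bullet> nrm K x))
      = edge_int e (\<lambda>x. (\<Phi> * (U x * ?n1 x + W x * ?n2 x) + sqrt \<Phi> * (P x - h x)) * P x
         + \<Phi> * h x * ?n1 x * U x + \<Phi> * h x * ?n2 x * W x
         - (\<Phi> * (P x * U x * ?n1 x) + \<Phi> * (P x * W x * ?n2 x)))"
      by (simp add: inner_prod_def algebra_simps)
    also have "\<dots> = edge_int e (\<lambda>x. (\<Phi> * (U x * ?n1 x + W x * ?n2 x) + sqrt \<Phi> * (P x - h x)) * P x)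
      + edge_int e (\<lambda>x. \<Phi> * h x * ?n1 x * U x) + edge_int e (\<lambda>x. \<Phi> * h x * ?n2 x * W x)
      - (edge_int e (\<lambda>x. \<Phi> * (P x * U x * ?n1 x)) + edge_int e (\<lambda>x. \<Phi> * (P x * W x * ?n2 x)))"
      by (subst edge_int_diff edge_int_add, (intro adm)+)+ simp
    finally show "edge_int e (\<lambda>x. (\<Phi> * ((U x, W x) \<bullet> nrm K x) + sqrt \<Phi> * (P x - h x)) \<bullet> P x)
      + edge_int e (\<lambda>x. (\<Phi> * h x * ?n1 x) \<bullet> U x) + edge_int e (\<lambda>x. (\<Phi> * h x * ?n2 x) \<bullet> W x)
      - (\<Phi> * edge_int e (\<lambda>x. P x * U x * fst (edge_normal K e)) + \<Phi> * edge_int e (\<lambda>x. P x * W x * snd (edge_normal K e)))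
      = edge_int e (\<lambda>x. sqrt \<Phi> * (P x - h x) * P x + \<Phi> * h x * ((U x, W x) \<bullet> nrm K x))"
      unfolding n edge_int_cmult by (simp add: inner_prod_def)
  qed
  moreover have "\<Phi> * G = \<Phi> * (vol_int K (\<lambda>x. U x * pdx P x) + vol_int K (\<lambda>x. W x * pdy P x))
    + \<Phi> * vol_int K (\<lambda>x. P x * pdx U x) + \<Phi> * vol_int K (\<lambda>x. P x * pdy W x)"
    unfolding green[symmetric] by (simp add: algebra_simps)
  ultimately show ?thesis
    using e1 e2 e3 unfolding v1 v2 v3 v4 v5 v6 by (simp add: algebra_simps)
qed

end

text \<open>Young's inequality with weight \<open>\<epsilon>\<close> is applied to each of the four products of an old and a
  new trace; \<open>q\<close> stands for \<open>sqrt \<Phi>\<close>, \<open>a, s\<close> for the new traces \<open>\<phi>, \<theta> \<bullet> n\<close> and \<open>b, t\<close> for the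
  old ones.\<close>

lemma flux_lower_bound:
  fixes q a s b t \<epsilon> A :: real
  assumes q: "q > 0" and \<epsilon>: "\<epsilon> > 0" and A1: "q\<^sup>2 + q \<le> 4 * \<epsilon> * A" and A2: "1 + q \<le> 4 * \<epsilon> * A"
    and h: "h = 1 / 2 * (a + b) + q / 2 * (s - t)"
  shows "(2 * q - (q\<^sup>2 + q) * \<epsilon>) / 4 * a\<^sup>2 + (2 * q - (1 + q) * \<epsilon>) / 4 * (q\<^sup>2 * s\<^sup>2)
    - A * (b\<^sup>2 + q\<^sup>2 * t\<^sup>2) \<le> q * (a - h) * a + q\<^sup>2 * h * s"
proof -
  define i where "i = 1 / \<epsilon>"
  have young: "2 * (x * y) \<le> \<epsilon> * x\<^sup>2 + i * y\<^sup>2" for x y :: real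
  proof -
    have "0 \<le> (\<epsilon> * x - y)\<^sup>2 / \<epsilon>" using \<epsilon> by simp
    also have "\<dots> = \<epsilon> * x\<^sup>2 + i * y\<^sup>2 - 2 * (x * y)"
      using \<epsilon> by (simp add: i_def power2_diff power_mult_distrib add_divide_distrib diff_divide_distrib)
        (simp add: power2_eq_square)
    finally show ?thesis by simp
  qed
  have i: "i > 0" using \<epsilon> by (simp add: i_def)
  \<comment> \<open>The two products of the new traces \<open>a\<close> and \<open>s\<close> cancel.
    In the last two of the four remaining products the sign is moved to the old trace, so that every
    product is subtracted and \<open>young\<close> applies to each.\<close>
  have R: "4 * (q * (a - h) * a + q\<^sup>2 * h * s) = 2 * q * a\<^sup>2 + 2 * q ^ 3 * s\<^sup>2
    - q * (2 * (a * b)) - q ^ 3 * (2 * (s * t)) - q\<^sup>2 * (2 * (s * - b)) - q\<^sup>2 * (2 * (a * - t))"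
    unfolding h by (simp add: field_simps power2_eq_square power3_eq_cube)
  have L: "4 * ((2 * q - (q\<^sup>2 + q) * \<epsilon>) / 4 * a\<^sup>2 + (2 * q - (1 + q) * \<epsilon>) / 4 * (q\<^sup>2 * s\<^sup>2)
    - A * (b\<^sup>2 + q\<^sup>2 * t\<^sup>2)) = 2 * q * a\<^sup>2 + 2 * q ^ 3 * s\<^sup>2
    - q * (\<epsilon> * a\<^sup>2) - q\<^sup>2 * (\<epsilon> * a\<^sup>2) - q\<^sup>2 * (\<epsilon> * s\<^sup>2) - q ^ 3 * (\<epsilon> * s\<^sup>2)
    - 4 * A * b\<^sup>2 - 4 * A * (q\<^sup>2 * t\<^sup>2)"
    by (simp add: field_simps power2_eq_square power3_eq_cube)
  have "q * (2 * (a * b)) \<le> q * (\<epsilon> * a\<^sup>2 + i * b\<^sup>2)"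
    using young[of a b] q by (intro mult_left_mono) auto
  moreover have "q ^ 3 * (2 * (s * t)) \<le> q ^ 3 * (\<epsilon> * s\<^sup>2 + i * t\<^sup>2)"
    using young[of s t] q by (intro mult_left_mono) auto
  moreover have "q\<^sup>2 * (2 * (s * - b)) \<le> q\<^sup>2 * (\<epsilon> * s\<^sup>2 + i * (- b)\<^sup>2)"
    using young[of s "- b"] by (intro mult_left_mono) auto
  moreover have "q\<^sup>2 * (2 * (a * - t)) \<le> q\<^sup>2 * (\<epsilon> * a\<^sup>2 + i * (- t)\<^sup>2)"
    using young[of a "- t"] by (intro mult_left_mono) auto
  \<comment> \<open>The old trace \<open>b\<close> has collected the weights of two products and
    \<open>t\<close>, relative to \<open>q\<^sup>2\<close>, those of the other two. These two
    demands on \<open>A\<close> are the origin of the maximum in \<open>const_A\<close>.\<close>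
  moreover have "(q\<^sup>2 + q) * i * b\<^sup>2 \<le> 4 * A * b\<^sup>2"
    using A1 \<epsilon> by (intro mult_right_mono) (auto simp: i_def field_simps)
  moreover have "(1 + q) * i * (q\<^sup>2 * t\<^sup>2) \<le> 4 * A * (q\<^sup>2 * t\<^sup>2)"
    using A2 \<epsilon> by (intro mult_right_mono) (auto simp: i_def field_simps)
  moreover have "(q\<^sup>2 + q) * i * b\<^sup>2 = q\<^sup>2 * (i * b\<^sup>2) + q * (i * b\<^sup>2)"
    "(1 + q) * i * (q\<^sup>2 * t\<^sup>2) = q\<^sup>2 * (i * t\<^sup>2) + q ^ 3 * (i * t\<^sup>2)"
    by (simp_all add: algebra_simps power2_eq_square power3_eq_cube)
  ultimately have "4 * ((2 * q - (q\<^sup>2 + q) * \<epsilon>) / 4 * a\<^sup>2 + (2 * q - (1 + q) * \<epsilon>) / 4 * (q\<^sup>2 * s\<^sup>2)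
    - A * (b\<^sup>2 + q\<^sup>2 * t\<^sup>2)) \<le> 4 * (q * (a - h) * a + q\<^sup>2 * h * s)"
    unfolding L R unfolding distrib_left power2_minus by linarith
  then show ?thesis by (simp only: mult_le_cancel_left_pos zero_less_numeral)
qed

section \<open>Estimates for one iteration\<close>

context mesh
begin

lemma ext_trace_velocity:
  "ext_trace \<Omega> T (velocity u v) K x = (ext_trace \<Omega> T u K x, ext_trace \<Omega> T v K x)"
  by (simp add: ext_trace_def velocity_def zero_prod_def)

lemma edge_adm_normal_trace:
  assumes "K \<in> T" "e \<in> edges K" "edge_adm e f" "edge_adm e g"
  shows "edge_adm e (\<lambda>x. (f x, g x) \<bullet> nrm K x)"
  unfolding inner_prod_def fst_conv snd_conv inner_real_def
  by (intro edge_adm_intros assms edge_adm_nrm)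

lemma skeleton_norm2_edge_int:
  assumes \<Phi>: "\<Phi> \<ge> 0"
    and c: "\<And>K. K \<in> T \<Longrightarrow> continuous_on UNIV (\<phi> K) \<and> continuous_on UNIV (u K) \<and> continuous_on UNIV (v K)"
  shows "skeleton_norm2 T \<Phi> \<phi> (velocity u v) =
    (\<Sum>K\<in>T. \<Sum>e\<in>edges K. edge_int e (\<lambda>x. (\<phi> K x)\<^sup>2 + \<Phi> * (velocity u v K x \<bullet> nrm K x)\<^sup>2))"
  unfolding skeleton_norm2_def
proof (rule sum.cong[OF refl])
  fix K assume K: "K \<in> T"
  have b: "(bdry_norm K w)\<^sup>2 = (\<Sum>e\<in>edges K. edge_int e (\<lambda>x. (w x)\<^sup>2))" for w :: "point \<Rightarrow> real"
  proof -
    have "0 \<le> (\<Sum>e\<in>edges K. edge_int e (\<lambda>x. (w x)\<^sup>2))" by (intro sum_nonneg edge_int_nonneg) simp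
    then show ?thesis by (simp add: bdry_norm_def bdry_inner_edge_int power2_eq_square)
  qed
  have "(bdry_norm K (\<phi> K))\<^sup>2 + (bdry_wnorm \<Phi> K (\<lambda>x. velocity u v K x \<bullet> nrm K x))\<^sup>2 =
    (\<Sum>e\<in>edges K. edge_int e (\<lambda>x. (\<phi> K x)\<^sup>2) + edge_int e (\<lambda>x. \<Phi> * (velocity u v K x \<bullet> nrm K x)\<^sup>2))"
    using \<Phi> by (simp add: bdry_wnorm_def b power_mult_distrib sum.distrib)
  also have "\<dots> = (\<Sum>e\<in>edges K. edge_int e (\<lambda>x. (\<phi> K x)\<^sup>2 + \<Phi> * (velocity u v K x \<bullet> nrm K x)\<^sup>2))"
    unfolding velocity_def using c[OF K]
    by (intro sum.cong refl edge_int_add[symmetric] edge_adm_intros edge_adm_normal_trace K edge_adm_continuous) auto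
  finally show "(bdry_norm K (\<phi> K))\<^sup>2 + (bdry_wnorm \<Phi> K (\<lambda>x. velocity u v K x \<bullet> nrm K x))\<^sup>2 =
    (\<Sum>e\<in>edges K. edge_int e (\<lambda>x. (\<phi> K x)\<^sup>2 + \<Phi> * (velocity u v K x \<bullet> nrm K x)\<^sup>2))" .
qed

lemma mesh_norm2_vol_int:
  assumes \<Phi>: "\<Phi> \<ge> 0"
    and c: "\<And>K. K \<in> T \<Longrightarrow> continuous_on UNIV (u K) \<and> continuous_on UNIV (v K)"
  shows "mesh_norm2 T \<Phi> \<phi> (velocity u v) = (\<Sum>K\<in>T. vol_int K (\<lambda>x. (\<phi> K x)\<^sup>2)
    + \<Phi> * (vol_int K (\<lambda>x. (u K x)\<^sup>2) + vol_int K (\<lambda>x. (v K x)\<^sup>2)))"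
  unfolding mesh_norm2_def
proof (rule sum.cong[OF refl])
  fix K assume K: "K \<in> T"
  have b: "(vol_norm K w)\<^sup>2 = vol_int K (\<lambda>x. w x \<bullet> w x)" for w :: "point \<Rightarrow> 'a::real_inner"
    using vol_int_nonneg[of "\<lambda>x. w x \<bullet> w x" K] by (simp add: vol_norm_def vol_inner_vol_int)
  have "(vol_wnorm \<Phi> K (velocity u v K))\<^sup>2 = vol_int K (\<lambda>x. \<Phi> * ((u K x)\<^sup>2 + (v K x)\<^sup>2))"
    unfolding vol_wnorm_def b
  proof (rule arg_cong[where f = "vol_int K"], rule ext)
    fix x
    let ?w = "velocity u v K x"
    have "(sqrt \<Phi> *\<^sub>R ?w) \<bullet> (sqrt \<Phi> *\<^sub>R ?w) = (sqrt \<Phi> * sqrt \<Phi>) * (?w \<bullet> ?w)" by simp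
    also have "\<dots> = \<Phi> * ((u K x)\<^sup>2 + (v K x)\<^sup>2)"
      using \<Phi> by (simp add: velocity_def inner_prod_def power2_eq_square)
    finally show "(sqrt \<Phi> *\<^sub>R ?w) \<bullet> (sqrt \<Phi> *\<^sub>R ?w) = \<Phi> * ((u K x)\<^sup>2 + (v K x)\<^sup>2)" .
  qed
  also have "\<dots> = \<Phi> * (vol_int K (\<lambda>x. (u K x)\<^sup>2) + vol_int K (\<lambda>x. (v K x)\<^sup>2))"
    unfolding vol_int_cmult using c[OF K] quad[OF K] by (subst vol_int_add) (auto intro!: continuous_intros)
  finally show "(vol_norm K (\<phi> K))\<^sup>2 + (vol_wnorm \<Phi> K (velocity u v K))\<^sup>2 = vol_int K (\<lambda>x. (\<phi> K x)\<^sup>2)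
    + \<Phi> * (vol_int K (\<lambda>x. (u K x)\<^sup>2) + vol_int K (\<lambda>x. (v K x)\<^sup>2))"
    by (simp add: b) (simp add: power2_eq_square)
qed

lemma edge_adm_phi_hat:
  assumes K: "K \<in> T" "e \<in> edges K"
    and c: "\<And>K. K \<in> T \<Longrightarrow> continuous_on UNIV (\<phi> K) \<and> continuous_on UNIV (u K) \<and> continuous_on UNIV (v K)"
    and c': "\<And>K. K \<in> T \<Longrightarrow> continuous_on UNIV (\<phi>' K) \<and> continuous_on UNIV (u' K) \<and> continuous_on UNIV (v' K)"
  shows "edge_adm e (phi_hat \<Omega> T \<Phi> \<phi> (velocity u v) \<phi>' (velocity u' v') K)"
proof -
  have "edge_adm e (\<phi>' K)" "edge_adm e (u' K)" "edge_adm e (v' K)"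
    using c'[OF K(1)] edge_adm_continuous by blast+
  moreover have "edge_adm e (ext_trace \<Omega> T \<phi> K)" "edge_adm e (ext_trace \<Omega> T u K)" "edge_adm e (ext_trace \<Omega> T v K)"
    using c by (intro edge_adm_ext_trace K; blast)+
  ultimately show ?thesis
    unfolding phi_hat_def[abs_def] ext_trace_velocity inner_minus_right velocity_def
    by (intro edge_adm_intros edge_adm_normal_trace K)
qed

text \<open>\<open>energy_identity\<close> with the flux bounded below pointwise by
  \<open>flux_lower_bound\<close>. The volume terms stay as they are, because the skeleton norm and
  the mesh norm exploit them differently.\<close>

lemma element_estimate:
  assumes step: "ihdg2_step \<Omega> T p \<Phi> \<gamma> (coriolis f\<^sub>0 \<beta> y\<^sub>m) \<Delta>t \<phi> u v \<phi>' u' v'"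
    and c: "\<And>K. K \<in> T \<Longrightarrow> continuous_on UNIV (\<phi> K) \<and> continuous_on UNIV (u K) \<and> continuous_on UNIV (v K)"
    and \<Phi>: "\<Phi> > 0" and \<epsilon>: "\<epsilon> > 0" and K: "K \<in> T"
  shows "vol_int K (\<lambda>x. (\<phi>' K x)\<^sup>2) / \<Delta>t
    + (1 / \<Delta>t + \<gamma>) * \<Phi> * (vol_int K (\<lambda>x. (u' K x)\<^sup>2) + vol_int K (\<lambda>x. (v' K x)\<^sup>2))
    + (2 * sqrt \<Phi> - (\<Phi> + sqrt \<Phi>) * \<epsilon>) / 4 * (\<Sum>e\<in>edges K. edge_int e (\<lambda>x. (\<phi>' K x)\<^sup>2))
    + (2 * sqrt \<Phi> - (1 + sqrt \<Phi>) * \<epsilon>) / 4 * (\<Sum>e\<in>edges K. edge_int e (\<lambda>x. \<Phi> * (velocity u' v' K x \<bullet> nrm K x)\<^sup>2))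
    \<le> const_A \<Phi> \<epsilon> * (\<Sum>e\<in>edges K. edge_int e (\<lambda>x. (ext_trace \<Omega> T \<phi> K x)\<^sup>2
          + \<Phi> * (ext_trace \<Omega> T (velocity u v) K x \<bullet> nrm K x)\<^sup>2))"
proof -
  let ?h = "phi_hat \<Omega> T \<Phi> \<phi> (velocity u v) \<phi>' (velocity u' v') K"
  let ?s = "\<lambda>x. (u' K x, v' K x) \<bullet> nrm K x"
  let ?t = "\<lambda>x. ext_trace \<Omega> T (velocity u v) K x \<bullet> nrm K x"
  let ?b = "ext_trace \<Omega> T \<phi> K"
  let ?b1 = "(2 * sqrt \<Phi> - (\<Phi> + sqrt \<Phi>) * \<epsilon>) / 4" and ?b2 = "(2 * sqrt \<Phi> - (1 + sqrt \<Phi>) * \<epsilon>) / 4"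
  let ?A = "const_A \<Phi> \<epsilon>"
  have ps: "\<phi>' K \<in> poly_space p" "u' K \<in> poly_space p" "v' K \<in> poly_space p" if "K \<in> T" for K
    using step that unfolding ihdg2_step_def by auto
  have c': "continuous_on UNIV (\<phi>' K) \<and> continuous_on UNIV (u' K) \<and> continuous_on UNIV (v' K)" if "K \<in> T" for K
    using ps[OF that] continuous_on_poly_space by blast
  have eqs: "vol_inner K (\<lambda>x. \<phi>' K x / \<Delta>t) w - vol_inner K (\<lambda>x. \<Phi> *\<^sub>R (u' K x, v' K x)) (grad w)
      + bdry_inner K (\<lambda>x. \<Phi> * ?s x + sqrt \<Phi> * (\<phi>' K x - ?h x)) w = 0"
    "vol_inner K (\<lambda>x. \<Phi> * u' K x / \<Delta>t) w - vol_inner K (\<lambda>x. \<Phi> * \<phi>' K x) (pdx w)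
      + bdry_inner K (\<lambda>x. \<Phi> * ?h x * fst (nrm K x)) w
      = vol_inner K (\<lambda>x. coriolis f\<^sub>0 \<beta> y\<^sub>m x * \<Phi> * v' K x - \<gamma> * \<Phi> * u' K x) w"
    "vol_inner K (\<lambda>x. \<Phi> * v' K x / \<Delta>t) w - vol_inner K (\<lambda>x. \<Phi> * \<phi>' K x) (pdy w)
      + bdry_inner K (\<lambda>x. \<Phi> * ?h x * snd (nrm K x)) w
      = vol_inner K (\<lambda>x. - coriolis f\<^sub>0 \<beta> y\<^sub>m x * \<Phi> * u' K x - \<gamma> * \<Phi> * v' K x) w"
    if "w \<in> poly_space p" for w
    using step K that unfolding ihdg2_step_def Let_def velocity_def by blast+
  have energy: "vol_int K (\<lambda>x. (\<phi>' K x)\<^sup>2) / \<Delta>t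
    + (1 / \<Delta>t + \<gamma>) * \<Phi> * (vol_int K (\<lambda>x. (u' K x)\<^sup>2) + vol_int K (\<lambda>x. (v' K x)\<^sup>2))
    + (\<Sum>e\<in>edges K. edge_int e (\<lambda>x. sqrt \<Phi> * (\<phi>' K x - ?h x) * \<phi>' K x + \<Phi> * ?h x * ?s x)) = 0"
  proof (rule energy_identity[OF K ps[OF K]])
    show "continuous_on UNIV (coriolis f\<^sub>0 \<beta> y\<^sub>m)" unfolding coriolis_def[abs_def] by (intro continuous_intros)
    show "edge_adm e ?h" if "e \<in> edges K" for e by (rule edge_adm_phi_hat[OF K that c c'])
  qed (rule eqs ps[OF K])+
  have qq: "(sqrt \<Phi>)\<^sup>2 = \<Phi>" using \<Phi> by simp
  have A: "(sqrt \<Phi>)\<^sup>2 + sqrt \<Phi> \<le> 4 * \<epsilon> * ?A" "1 + sqrt \<Phi> \<le> 4 * \<epsilon> * ?A"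
    using \<epsilon> \<Phi> by (simp_all add: const_A_def)
  have "?b1 * (\<Sum>e\<in>edges K. edge_int e (\<lambda>x. (\<phi>' K x)\<^sup>2)) + ?b2 * (\<Sum>e\<in>edges K. edge_int e (\<lambda>x. \<Phi> * (?s x)\<^sup>2))
    - ?A * (\<Sum>e\<in>edges K. edge_int e (\<lambda>x. (?b x)\<^sup>2 + \<Phi> * (?t x)\<^sup>2))
    = (\<Sum>e\<in>edges K. ?b1 * edge_int e (\<lambda>x. (\<phi>' K x)\<^sup>2) + ?b2 * edge_int e (\<lambda>x. \<Phi> * (?s x)\<^sup>2)
        - ?A * edge_int e (\<lambda>x. (?b x)\<^sup>2 + \<Phi> * (?t x)\<^sup>2))"
    by (simp only: sum_distrib_left sum.distrib sum_subtractf)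
  also have "\<dots> \<le> (\<Sum>e\<in>edges K. edge_int e (\<lambda>x. sqrt \<Phi> * (\<phi>' K x - ?h x) * \<phi>' K x + \<Phi> * ?h x * ?s x))"
  proof (rule sum_mono)
    fix e assume e: "e \<in> edges K"
    have "edge_adm e (\<phi>' K)" "edge_adm e (u' K)" "edge_adm e (v' K)"
      using c'[OF K(1)] edge_adm_continuous by blast+
    moreover have "edge_adm e (ext_trace \<Omega> T \<phi> K)" "edge_adm e (ext_trace \<Omega> T u K)" "edge_adm e (ext_trace \<Omega> T v K)"
      using c by (intro edge_adm_ext_trace K e; blast)+
    ultimately have adm: "edge_adm e (\<phi>' K)" "edge_adm e ?s" "edge_adm e ?b" "edge_adm e ?t"
      unfolding ext_trace_velocity by (simp_all add: edge_adm_normal_trace K e)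
    note admh = edge_adm_phi_hat[OF K e c c']
    have "?b1 * edge_int e (\<lambda>x. (\<phi>' K x)\<^sup>2) + ?b2 * edge_int e (\<lambda>x. \<Phi> * (?s x)\<^sup>2)
        - ?A * edge_int e (\<lambda>x. (?b x)\<^sup>2 + \<Phi> * (?t x)\<^sup>2)
      = edge_int e (\<lambda>x. ?b1 * (\<phi>' K x)\<^sup>2 + ?b2 * (\<Phi> * (?s x)\<^sup>2) - ?A * ((?b x)\<^sup>2 + \<Phi> * (?t x)\<^sup>2))"
      unfolding edge_int_cmult[symmetric]
      by (subst edge_int_diff edge_int_add, (intro edge_adm_intros adm)+)+ simp
    also have "\<dots> \<le> edge_int e (\<lambda>x. sqrt \<Phi> * (\<phi>' K x - ?h x) * \<phi>' K x + \<Phi> * ?h x * ?s x)"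
    proof (rule edge_int_mono[OF edge_ne[OF K e] finite_vertices])
      show "edge_adm e (\<lambda>x. ?b1 * (\<phi>' K x)\<^sup>2 + ?b2 * (\<Phi> * (?s x)\<^sup>2) - ?A * ((?b x)\<^sup>2 + \<Phi> * (?t x)\<^sup>2))"
        by (intro edge_adm_intros adm)
      show "edge_adm e (\<lambda>x. sqrt \<Phi> * (\<phi>' K x - ?h x) * \<phi>' K x + \<Phi> * ?h x * ?s x)"
        by (intro edge_adm_intros adm admh)
      fix x
      \<comment> \<open>The old normal trace gets a minus sign since the exterior normal is opposite
        to \<open>nrm K x\<close>.\<close>
      have "?h x = 1 / 2 * (\<phi>' K x + ?b x) + sqrt \<Phi> / 2 * (?s x - ?t x)"
        by (simp add: phi_hat_def velocity_def)
      then show "?b1 * (\<phi>' K x)\<^sup>2 + ?b2 * (\<Phi> * (?s x)\<^sup>2) - ?A * ((?b x)\<^sup>2 + \<Phi> * (?t x)\<^sup>2)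
        \<le> sqrt \<Phi> * (\<phi>' K x - ?h x) * \<phi>' K x + \<Phi> * ?h x * ?s x"
        using flux_lower_bound[OF _ \<epsilon> A, of "?h x" "\<phi>' K x" "?b x" "?s x" "?t x"] \<Phi> unfolding qq by simp
    qed
    finally show "?b1 * edge_int e (\<lambda>x. (\<phi>' K x)\<^sup>2) + ?b2 * edge_int e (\<lambda>x. \<Phi> * (?s x)\<^sup>2)
        - ?A * edge_int e (\<lambda>x. (?b x)\<^sup>2 + \<Phi> * (?t x)\<^sup>2)
      \<le> edge_int e (\<lambda>x. sqrt \<Phi> * (\<phi>' K x - ?h x) * \<phi>' K x + \<Phi> * ?h x * ?s x)" .
  qed
  finally show ?thesis using energy unfolding velocity_def[of u' v'] by linarith
qed

lemma step_estimate:
  assumes step: "ihdg2_step \<Omega> T p \<Phi> \<gamma> (coriolis f\<^sub>0 \<beta> y\<^sub>m) \<Delta>t \<phi> u v \<phi>' u' v'"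
    and c: "\<And>K. K \<in> T \<Longrightarrow> continuous_on UNIV (\<phi> K) \<and> continuous_on UNIV (u K) \<and> continuous_on UNIV (v K)"
    and \<Phi>: "\<Phi> > 0" and \<gamma>: "\<gamma> \<ge> 0" and \<Delta>t: "\<Delta>t > 0" and \<epsilon>: "\<epsilon> > 0" and cpos: "cc > 0"
    and inv: "inverse_trace_ineq T p cc"
  shows "const_B \<Phi> \<gamma> \<epsilon> \<Delta>t cc (mesh_size T) p * skeleton_norm2 T \<Phi> \<phi>' (velocity u' v')
      \<le> const_A \<Phi> \<epsilon> * skeleton_norm2 T \<Phi> \<phi> (velocity u v)"
    and "mesh_norm2 T \<Phi> \<phi>' (velocity u' v') \<le> \<Delta>t * (const_A \<Phi> \<epsilon> * skeleton_norm2 T \<Phi> \<phi> (velocity u v)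
      + const_G \<Phi> \<epsilon> * skeleton_norm2 T \<Phi> \<phi>' (velocity u' v'))"
proof -
  define A where "A = const_A \<Phi> \<epsilon>"
  define G where "G = const_G \<Phi> \<epsilon>"
  define B where "B = const_B \<Phi> \<gamma> \<epsilon> \<Delta>t cc (mesh_size T) p"
  define b1 where "b1 = (2 * sqrt \<Phi> - (\<Phi> + sqrt \<Phi>) * \<epsilon>) / 4"
  define b2 where "b2 = (2 * sqrt \<Phi> - (1 + sqrt \<Phi>) * \<epsilon>) / 4"
  \<comment> \<open>The factor in the inverse trace inequality after cancelling 2 against the
    dimension; \<open>\<kappa> / \<Delta>t\<close> and
    \<open>(1 / \<Delta>t + \<gamma>) * \<kappa>\<close> are the first summands of
    \<open>const_B1\<close> and \<open>const_B2\<close>.\<close>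
  define \<kappa> where "\<kappa> = cc * mesh_size T / ((real p + 1) * (real p + 2))"
  define vP where "vP K = vol_int K (\<lambda>x. (\<phi>' K x)\<^sup>2)" for K
  define vU where "vU K = vol_int K (\<lambda>x. (u' K x)\<^sup>2) + vol_int K (\<lambda>x. (v' K x)\<^sup>2)" for K
  define X where "X K = (\<Sum>e\<in>edges K. edge_int e (\<lambda>x. (\<phi>' K x)\<^sup>2))" for K
  define Y where "Y K = (\<Sum>e\<in>edges K. edge_int e (\<lambda>x. \<Phi> * (velocity u' v' K x \<bullet> nrm K x)\<^sup>2))" for K
  define Z where "Z K = (\<Sum>e\<in>edges K. edge_int e (\<lambda>x. (ext_trace \<Omega> T \<phi> K x)\<^sup>2
          + \<Phi> * (ext_trace \<Omega> T (velocity u v) K x \<bullet> nrm K x)\<^sup>2))" for K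
  have ps: "\<phi>' K \<in> poly_space p" "u' K \<in> poly_space p" "v' K \<in> poly_space p" if "K \<in> T" for K
    using step that unfolding ihdg2_step_def by auto
  have c': "continuous_on UNIV (\<phi>' K) \<and> continuous_on UNIV (u' K) \<and> continuous_on UNIV (v' K)" if "K \<in> T" for K
    using ps[OF that] continuous_on_poly_space by blast
  have adm': "edge_adm e (\<phi>' K)" "edge_adm e (u' K)" "edge_adm e (v' K)"
    "edge_adm e (\<lambda>x. velocity u' v' K x \<bullet> nrm K x)" if "K \<in> T" "e \<in> edges K" for K e
    using c'[OF that(1)] unfolding velocity_def
    by (intro edge_adm_normal_trace that edge_adm_continuous; simp)+
  have pos: "0 \<le> X K" "0 \<le> Y K" "0 \<le> vP K" "0 \<le> vU K" for K
    unfolding X_def Y_def vP_def vU_def using \<Phi>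
    by (intro sum_nonneg edge_int_nonneg vol_int_nonneg add_nonneg_nonneg; simp)+
  have est: "vP K / \<Delta>t + (1 / \<Delta>t + \<gamma>) * \<Phi> * vU K + b1 * X K + b2 * Y K \<le> A * Z K" if "K \<in> T" for K
    unfolding vP_def vU_def b1_def b2_def X_def Y_def Z_def A_def
    by (rule element_estimate[OF step c \<Phi> \<epsilon> that])
  have inv': "\<kappa> * (\<Sum>e\<in>edges K. edge_int e (\<lambda>x. (w x)\<^sup>2)) \<le> vol_int K (\<lambda>x. (w x)\<^sup>2)"
    if "K \<in> T" "w \<in> poly_space p" for K w
  proof -
    have "2 * cc * mesh_size T / (2 * (real p + 1) * (real p + 2)) = \<kappa>"
      unfolding \<kappa>_def mult.assoc by (rule mult_divide_mult_cancel_left) simp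
    then have "\<kappa> * bdry_inner K w w \<le> vol_inner K w w"
      using inv that unfolding inverse_trace_ineq_def by metis
    then show ?thesis by (simp add: bdry_inner_edge_int vol_inner_vol_int power2_eq_square)
  qed
  \<comment> \<open>The sign is derived from an element of \<open>T\<close>, since
    \<open>mesh_size\<close> is a maximum over \<open>T\<close> and unspecified for an empty
    set.\<close>
  have \<kappa>: "\<kappa> \<ge> 0" if "K \<in> T" for K
  proof -
    have "diameter (cell K) \<le> mesh_size T" unfolding mesh_size_def using finite_T that by (intro Max_ge) auto
    moreover have "0 \<le> diameter (cell K)"
      by (intro diameter_ge_0 compact_imp_bounded compact_cell quad that)
    ultimately show ?thesis using cpos by (simp add: \<kappa>_def)
  qed
  have XP: "\<kappa> * X K \<le> vP K" if "K \<in> T" for K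
    unfolding X_def vP_def by (rule inv'[OF that ps(1)[OF that]])
  \<comment> \<open>The normal velocity need not be a polynomial on the element. It is bounded by
    the speed through Cauchy-Schwarz, and the inverse trace inequality is applied to the two
    components.\<close>
  have YU: "\<kappa> * Y K \<le> \<Phi> * vU K" if K: "K \<in> T" for K
  proof -
    have "Y K \<le> \<Phi> * ((\<Sum>e\<in>edges K. edge_int e (\<lambda>x. (u' K x)\<^sup>2)) + (\<Sum>e\<in>edges K. edge_int e (\<lambda>x. (v' K x)\<^sup>2)))"
      unfolding Y_def sum.distrib[symmetric] edge_int_cmult sum_distrib_left[symmetric]
    proof (intro mult_left_mono sum_mono)
      fix e assume e: "e \<in> edges K"
      note adm = adm'[OF K e]
      have "edge_int e (\<lambda>x. (velocity u' v' K x \<bullet> nrm K x)\<^sup>2) \<le> edge_int e (\<lambda>x. (u' K x)\<^sup>2 + (v' K x)\<^sup>2)"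
      proof (rule edge_int_mono[OF edge_ne[OF K e] finite_vertices])
        show "edge_adm e (\<lambda>x. (velocity u' v' K x \<bullet> nrm K x)\<^sup>2)" "edge_adm e (\<lambda>x. (u' K x)\<^sup>2 + (v' K x)\<^sup>2)"
          by (intro edge_adm_intros adm)+
        fix x assume "x \<in> seg e - vertices"
        then have "norm (nrm K x) = 1"
          using edge_half_plane(2)[OF K e] norm_edge_normal[OF K e] by auto
        then have "\<bar>velocity u' v' K x \<bullet> nrm K x\<bar> \<le> norm (velocity u' v' K x)"
          using Cauchy_Schwarz_ineq2[of "velocity u' v' K x" "nrm K x"] by simp
        then have "(velocity u' v' K x \<bullet> nrm K x)\<^sup>2 \<le> (norm (velocity u' v' K x))\<^sup>2"
          by (rule abs_le_square_iff[THEN iffD1, of _ "norm _", simplified])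
        then show "(velocity u' v' K x \<bullet> nrm K x)\<^sup>2 \<le> (u' K x)\<^sup>2 + (v' K x)\<^sup>2"
          by (simp add: velocity_def norm_prod_def)
      qed
      also have "\<dots> = edge_int e (\<lambda>x. (u' K x)\<^sup>2) + edge_int e (\<lambda>x. (v' K x)\<^sup>2)"
        by (intro edge_int_add edge_adm_intros adm)
      finally show "edge_int e (\<lambda>x. (velocity u' v' K x \<bullet> nrm K x)\<^sup>2)
        \<le> edge_int e (\<lambda>x. (u' K x)\<^sup>2) + edge_int e (\<lambda>x. (v' K x)\<^sup>2)" .
    qed (use \<Phi> in simp)
    then have "\<kappa> * Y K \<le> \<kappa> * (\<Phi> * ((\<Sum>e\<in>edges K. edge_int e (\<lambda>x. (u' K x)\<^sup>2)) + (\<Sum>e\<in>edges K. edge_int e (\<lambda>x. (v' K x)\<^sup>2))))"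
      by (rule mult_left_mono[OF _ \<kappa>[OF K]])
    also have "\<dots> = \<Phi> * (\<kappa> * (\<Sum>e\<in>edges K. edge_int e (\<lambda>x. (u' K x)\<^sup>2)) + \<kappa> * (\<Sum>e\<in>edges K. edge_int e (\<lambda>x. (v' K x)\<^sup>2)))"
      by (simp add: algebra_simps)
    also have "\<dots> \<le> \<Phi> * vU K"
      unfolding vU_def using \<Phi> by (intro mult_left_mono add_mono inv' K ps) auto
    finally show ?thesis .
  qed
  have "skeleton_norm2 T \<Phi> \<phi>' (velocity u' v') =
    (\<Sum>K\<in>T. \<Sum>e\<in>edges K. edge_int e (\<lambda>x. (\<phi>' K x)\<^sup>2 + \<Phi> * (velocity u' v' K x \<bullet> nrm K x)\<^sup>2))"
    by (rule skeleton_norm2_edge_int[OF less_imp_le[OF \<Phi>] c'])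
  also have "\<dots> = (\<Sum>K\<in>T. \<Sum>e\<in>edges K. edge_int e (\<lambda>x. (\<phi>' K x)\<^sup>2)
      + edge_int e (\<lambda>x. \<Phi> * (velocity u' v' K x \<bullet> nrm K x)\<^sup>2))"
    by (intro sum.cong refl edge_int_add edge_adm_intros adm')
  also have "\<dots> = (\<Sum>K\<in>T. X K + Y K)" unfolding X_def Y_def sum.distrib ..
  finally have Sk': "skeleton_norm2 T \<Phi> \<phi>' (velocity u' v') = (\<Sum>K\<in>T. X K + Y K)" .
  have Sk: "skeleton_norm2 T \<Phi> \<phi> (velocity u v) =
    (\<Sum>K\<in>T. \<Sum>e\<in>edges K. edge_int e (\<lambda>x. (\<phi> K x)\<^sup>2 + \<Phi> * (velocity u v K x \<bullet> nrm K x)\<^sup>2))"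
    by (rule skeleton_norm2_edge_int[OF less_imp_le[OF \<Phi>] c])
  have "(\<Sum>K\<in>T. Z K) \<le> skeleton_norm2 T \<Phi> \<phi> (velocity u v)"
    unfolding Sk Z_def
  proof (rule ext_trace_skeleton_le)
    fix K assume K: "K \<in> T"
    show "continuous_on UNIV (\<phi> K)" using c[OF K] by blast
    show "continuous_on UNIV (velocity u v K)" unfolding velocity_def using c[OF K] by (intro continuous_intros) auto
    fix e assume e: "e \<in> edges K"
    have "edge_adm e (ext_trace \<Omega> T \<phi> K)" "edge_adm e (ext_trace \<Omega> T u K)" "edge_adm e (ext_trace \<Omega> T v K)"
      using c by (intro edge_adm_ext_trace K e; blast)+
    then show "edge_adm e (\<lambda>x. (ext_trace \<Omega> T \<phi> K x)\<^sup>2 + \<Phi> * (ext_trace \<Omega> T (velocity u v) K x \<bullet> nrm K x)\<^sup>2)"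
      unfolding ext_trace_velocity by (intro edge_adm_intros edge_adm_normal_trace K e)
  qed (use \<Phi> in simp)
  moreover have "A \<ge> 0" using \<epsilon> \<Phi> by (simp add: A_def const_A_def)
  ultimately have AZ: "(\<Sum>K\<in>T. A * Z K) \<le> A * skeleton_norm2 T \<Phi> \<phi> (velocity u v)"
    unfolding sum_distrib_left[symmetric] by (rule mult_left_mono)
  have B1: "const_B1 \<Phi> \<epsilon> \<Delta>t cc (mesh_size T) p = \<kappa> / \<Delta>t + b1"
    by (simp add: const_B1_def \<kappa>_def b1_def field_simps)
  have B2: "const_B2 \<Phi> \<gamma> \<epsilon> \<Delta>t cc (mesh_size T) p = (1 / \<Delta>t + \<gamma>) * \<kappa> + b2"
    by (simp add: const_B2_def \<kappa>_def b2_def add.commute)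
  have "B * (X K + Y K) \<le> A * Z K" if K: "K \<in> T" for K
  proof -
    have "B * X K \<le> (\<kappa> / \<Delta>t + b1) * X K" "B * Y K \<le> ((1 / \<Delta>t + \<gamma>) * \<kappa> + b2) * Y K"
      using pos by (intro mult_right_mono; simp add: B_def const_B_def B1 B2)+
    moreover have "\<kappa> * X K / \<Delta>t \<le> vP K / \<Delta>t" using XP[OF K] \<Delta>t by (intro divide_right_mono) auto
    moreover have "(1 / \<Delta>t + \<gamma>) * (\<kappa> * Y K) \<le> (1 / \<Delta>t + \<gamma>) * (\<Phi> * vU K)"
      using YU[OF K] \<Delta>t \<gamma> by (intro mult_left_mono) auto
    ultimately show ?thesis using est[OF K] by (simp add: algebra_simps)
  qed
  then have "(\<Sum>K\<in>T. B * (X K + Y K)) \<le> (\<Sum>K\<in>T. A * Z K)" by (rule sum_mono)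
  then show "const_B \<Phi> \<gamma> \<epsilon> \<Delta>t cc (mesh_size T) p * skeleton_norm2 T \<Phi> \<phi>' (velocity u' v')
      \<le> const_A \<Phi> \<epsilon> * skeleton_norm2 T \<Phi> \<phi> (velocity u v)"
    using AZ unfolding Sk' sum_distrib_left[symmetric] B_def[symmetric] A_def[symmetric] by linarith
  \<comment> \<open>The coefficients \<open>b1\<close> and \<open>b2\<close> may be negative, so
    their terms move to the right-hand side. Dropping the favourable part
    \<open>2 * sqrt \<Phi>\<close> and taking the larger remainder yields \<open>G\<close>; the
    nonnegative friction term is dropped as well.\<close>
  have "vP K + \<Phi> * vU K \<le> \<Delta>t * (A * Z K + G * (X K + Y K))" if K: "K \<in> T" for K
  proof -
    have "\<epsilon> * \<Phi> \<le> \<epsilon> * max 1 \<Phi>" "\<epsilon> * 1 \<le> \<epsilon> * max 1 \<Phi>"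
      using \<epsilon> by (intro mult_left_mono; simp)+
    moreover have "4 * b1 = 2 * sqrt \<Phi> - (\<epsilon> * \<Phi> + \<epsilon> * sqrt \<Phi>)" "4 * b2 = 2 * sqrt \<Phi> - (\<epsilon> * 1 + \<epsilon> * sqrt \<Phi>)"
      "4 * G = \<epsilon> * max 1 \<Phi> + \<epsilon> * sqrt \<Phi>"
      unfolding b1_def b2_def G_def const_G_def by (simp_all add: distrib_left distrib_right mult.commute)
    moreover have "sqrt \<Phi> > 0" using \<Phi> by simp
    ultimately have "- b1 \<le> G" "- b2 \<le> G" by linarith+
    then have "- b1 * X K \<le> G * X K" "- b2 * Y K \<le> G * Y K" using pos by (intro mult_right_mono; simp)+
    moreover have "0 \<le> \<gamma> * \<Phi> * vU K" using \<gamma> \<Phi> pos by simp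
    moreover have "(1 / \<Delta>t + \<gamma>) * \<Phi> * vU K = \<Phi> * vU K / \<Delta>t + \<gamma> * \<Phi> * vU K" by (simp add: algebra_simps)
    ultimately have "vP K / \<Delta>t + \<Phi> * vU K / \<Delta>t \<le> A * Z K + G * X K + G * Y K" using est[OF K] by linarith
    then have "(vP K + \<Phi> * vU K) / \<Delta>t \<le> A * Z K + G * (X K + Y K)" by (simp add: add_divide_distrib algebra_simps)
    then show ?thesis using \<Delta>t by (simp add: divide_le_eq mult.commute)
  qed
  then have "(\<Sum>K\<in>T. vP K + \<Phi> * vU K) \<le> (\<Sum>K\<in>T. \<Delta>t * (A * Z K + G * (X K + Y K)))" by (rule sum_mono)
  also have "\<dots> = \<Delta>t * ((\<Sum>K\<in>T. A * Z K) + G * (\<Sum>K\<in>T. X K + Y K))"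
    by (simp add: sum_distrib_left sum.distrib distrib_left)
  also have "\<dots> \<le> \<Delta>t * (A * skeleton_norm2 T \<Phi> \<phi> (velocity u v) + G * (\<Sum>K\<in>T. X K + Y K))"
    using AZ \<Delta>t by (intro mult_left_mono add_right_mono) auto
  finally have "(\<Sum>K\<in>T. vP K + \<Phi> * vU K) \<le> \<Delta>t * (A * skeleton_norm2 T \<Phi> \<phi> (velocity u v) + G * (\<Sum>K\<in>T. X K + Y K))" .
  moreover have "mesh_norm2 T \<Phi> \<phi>' (velocity u' v') = (\<Sum>K\<in>T. vP K + \<Phi> * vU K)"
    unfolding vP_def vU_def using c' \<Phi> by (intro mesh_norm2_vol_int) auto
  ultimately show "mesh_norm2 T \<Phi> \<phi>' (velocity u' v') \<le> \<Delta>t * (const_A \<Phi> \<epsilon> * skeleton_norm2 T \<Phi> \<phi> (velocity u v)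
      + const_G \<Phi> \<epsilon> * skeleton_norm2 T \<Phi> \<phi>' (velocity u' v'))"
    unfolding Sk' A_def G_def by simp
qed

end

theorem theorem2:
  fixes \<Omega> :: "point set" and T :: "quad set" and p :: nat
    and \<Phi> \<gamma> f\<^sub>0 \<beta> y\<^sub>m \<Delta>t \<epsilon> c :: real
    and \<phi> u v :: "nat \<Rightarrow> real broken"
  assumes "quad_mesh \<Omega> T"
    and "\<Phi> > 0" and "\<gamma> \<ge> 0" and "\<Delta>t > 0" and "\<epsilon> > 0"
    and "0 < c" and "c \<le> 1" and "inverse_trace_ineq T p c"
    and "\<forall>K\<in>T. \<exists>q. \<phi> 0 K \<in> poly_space q \<and> u 0 K \<in> poly_space q \<and> v 0 K \<in> poly_space q"
    and "\<forall>k. ihdg2_step \<Omega> T p \<Phi> \<gamma> (coriolis f\<^sub>0 \<beta> y\<^sub>m) \<Delta>t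
               (\<phi> k) (u k) (v k) (\<phi> (Suc k)) (u (Suc k)) (v (Suc k))"
    and "const_B \<Phi> \<gamma> \<epsilon> \<Delta>t c (mesh_size T) p > 0"
    and "const_C \<Phi> \<gamma> \<epsilon> \<Delta>t c (mesh_size T) p < 1"
  shows "(\<forall>k. skeleton_norm2 T \<Phi> (\<phi> k) (velocity (u k) (v k))
            \<le> const_C \<Phi> \<gamma> \<epsilon> \<Delta>t c (mesh_size T) p ^ k
                * skeleton_norm2 T \<Phi> (\<phi> 0) (velocity (u 0) (v 0))) \<and>
         (\<forall>k\<ge>1. mesh_norm2 T \<Phi> (\<phi> k) (velocity (u k) (v k))
            \<le> \<Delta>t * (const_A \<Phi> \<epsilon> + const_G \<Phi> \<epsilon> * const_C \<Phi> \<gamma> \<epsilon> \<Delta>t c (mesh_size T) p)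
                * const_C \<Phi> \<gamma> \<epsilon> \<Delta>t c (mesh_size T) p ^ (k - 1)
                * skeleton_norm2 T \<Phi> (\<phi> 0) (velocity (u 0) (v 0)))"
proof -
  interpret mesh \<Omega> T by unfold_locales fact
  define A where "A = const_A \<Phi> \<epsilon>"
  define G where "G = const_G \<Phi> \<epsilon>"
  define B where "B = const_B \<Phi> \<gamma> \<epsilon> \<Delta>t c (mesh_size T) p"
  define C where "C = const_C \<Phi> \<gamma> \<epsilon> \<Delta>t c (mesh_size T) p"
  define Sk where "Sk k = skeleton_norm2 T \<Phi> (\<phi> k) (velocity (u k) (v k))" for k
  define M where "M k = mesh_norm2 T \<Phi> (\<phi> k) (velocity (u k) (v k))" for k
  have B: "B > 0" using assms(11) by (simp add: B_def)
  have C: "C = A / B" by (simp add: C_def A_def B_def const_C_def)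
  have A: "A > 0" using assms(2,5) by (simp add: A_def const_A_def add_pos_pos)
  have G: "G > 0" using assms(2,5) by (simp add: G_def const_G_def add_pos_pos)
  \<comment> \<open>The old iterate enters a step through continuous pieces. This treats the initial
    iterate, whose degree may vary with the element, together with the later ones.\<close>
  have cont: "continuous_on UNIV (\<phi> k K) \<and> continuous_on UNIV (u k K) \<and> continuous_on UNIV (v k K)"
    if "K \<in> T" for k K
  proof (cases k)
    case 0
    then show ?thesis using assms(9) that continuous_on_poly_space by blast
  next
    case (Suc j)
    then show ?thesis using assms(10) that continuous_on_poly_space unfolding ihdg2_step_def by blast
  qed
  note st = step_estimate[OF spec[OF assms(10)] cont assms(2-6,8)]
  have step1: "Sk (Suc k) \<le> C * Sk k" for k
    using st(1)[of k] B unfolding C Sk_def A_def[symmetric] B_def[symmetric] by (simp add: field_simps)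
  have step2: "M (Suc k) \<le> \<Delta>t * (A * Sk k + G * Sk (Suc k))" for k
    using st(2)[of k] unfolding Sk_def M_def A_def G_def .
  have Cp: "C > 0" using A B by (simp add: C)
  have sk: "Sk k \<le> C ^ k * Sk 0" for k
  proof (induction k)
    case (Suc k)
    have "Sk (Suc k) \<le> C * Sk k" by (rule step1)
    also have "\<dots> \<le> C * (C ^ k * Sk 0)" using Suc Cp by (intro mult_left_mono) auto
    finally show ?case by (simp add: mult.assoc)
  qed simp
  have "M k \<le> \<Delta>t * (A + G * C) * C ^ (k - 1) * Sk 0" if k: "k \<ge> 1" for k
  proof -
    \<comment> \<open>The mesh norm at \<open>k\<close> is bounded by the skeleton norms at
      \<open>k - 1\<close> and at \<open>k\<close>. The latter is one contraction smaller, which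
      explains \<open>A + G * C\<close> and the exponent \<open>k - 1\<close>.\<close>
    obtain j where j: "k = Suc j" using k by (cases k) auto
    have "M k \<le> \<Delta>t * (A * Sk j + G * Sk (Suc j))" unfolding j by (rule step2)
    also have "\<dots> \<le> \<Delta>t * (A * Sk j + G * (C * Sk j))"
      using step1[of j] G assms(4) by (intro mult_left_mono add_left_mono) auto
    also have "\<dots> = \<Delta>t * (A + G * C) * Sk j" by (simp add: algebra_simps)
    also have "\<dots> \<le> \<Delta>t * (A + G * C) * (C ^ j * Sk 0)"
      using sk[of j] A G Cp assms(4) by (intro mult_left_mono) auto
    finally show ?thesis by (simp add: j mult.assoc)
  qed
  with sk show ?thesis unfolding Sk_def M_def A_def G_def C_def by blast
qed

end
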